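(* Let $\{J^kg\}_{k=0}^\infty$ be a block diagonal Carleson frame with $\sigma_p(J)\subset(0,1)$. Let $\Lambda=\{\lambda_k\}_{k=0}^\infty\subset[0,\infty)$ be a strictly increasing sequence with well-defined natural density, i.e. the limit $$\lim_{x\to\infty}\frac{N_\Lambda(x)}{x}=L$$ exists in $[0,\infty]$, where $N_\Lambda(x)=|\{k:\lambda_k\le x\}|$. Then $\{J^{\lambda_k}g\}_{k=0}^\infty$ is a frame for $\ell^2(\mathbb N_0)$ if and only if $0<L<\infty$.
   Context: $\mathbb N_0=\{0,1,2,\dots\}$. Let $(n_i)_{i\ge0}$ be positive integers with $\sup_i n_i<\infty$ and $(z_i)_{i\ge0}$ complex numbers. For each $i$, $V_i\cong\mathbb C^{n_i}$ has orthonormal basis $\{\delta_{i,j}\}_{j=0}^{n_i-1}$, and $\ell^2(\mathbb N_0)$ is identified with the orthogonal direct sum $\bigoplus_iV_i$. $J_{n_i}(z_i)$ is the operator on $V_i$ with $J_{n_i}(z_i)\delta_{i,j}=z_i\delta_{i,j}+(1-|z_i|^2)\delta_{i,j+1}$ for $0\le j<n_i-1$ and $J_{n_i}(z_i)\delta_{i,n_i-1}=z_i\delta_{i,n_i-1}$. A block diagonal Carleson frame is a frame for $\ell^2(\mathbb N_0)$ of the form $\{J^kg\}_{k=0}^\infty$, where $J=\bigoplus_iJ_{n_i}(z_i)$ is a (bounded) operator on $\ell^2(\mathbb N_0)$ and $g\in\ell^2(\mathbb N_0)$; $\sigma_p(J)=\{z_i\}_{i\ge 0}$ is the point spectrum.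 A sequence $\{f_k\}$ in a Hilbert space $H$ is a frame for $H$ if there are $B\ge A>0$ with $A\|h\|^2\le\sum_k|\langle h,f_k\rangle|^2\le B\|h\|^2$ for all $h\in H$. Noninteger powers: $J^\lambda=\bigoplus_iJ_{n_i}^\lambda(z_i)$, where for $z\ne0$ and $\lambda\in\mathbb C$, $J_n^\lambda(z)=\sum_{j=0}^{n-1}\binom{\lambda}{j}z^{\lambda-j}(1-|z|^2)^jM_n^j$, with $M_n$ the $n\times n$ matrix having ones on the subdiagonal and zeros elsewhere, $z^\lambda$ the principal branch, $\binom{\lambda}{j}=\lambda(\lambda-1)\cdots(\lambda-j+1)/j!$ and $\binom\lambda0=1$. *)

theory Defs
  imports "HOL-Analysis.Analysis" "Jordan_Normal_Form.Matrix"
begin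

section \<open>The Hilbert space \<open>\<ell>\<^sup>2(\<nat>)\<close> and frames\<close>

definition ell2 :: "(nat \<Rightarrow> complex) set" where
  "ell2 = {f. summable (\<lambda>m. (cmod (f m))\<^sup>2)}"

definition ell2_norm :: "(nat \<Rightarrow> complex) \<Rightarrow> real" where
  "ell2_norm f = sqrt (\<Sum>m. (cmod (f m))\<^sup>2)"

definition ell2_inner :: "(nat \<Rightarrow> complex) \<Rightarrow> (nat \<Rightarrow> complex) \<Rightarrow> complex" where
  "ell2_inner f g = (\<Sum>m. f m * cnj (g m))"

definition ell2_bounded_operator :: "((nat \<Rightarrow> complex) \<Rightarrow> nat \<Rightarrow> complex) \<Rightarrow> bool" where
  "ell2_bounded_operator T \<longleftrightarrow>
     (\<forall>f\<in>ell2. T f \<in> ell2) \<and>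
     (\<forall>f\<in>ell2. \<forall>g\<in>ell2. T (\<lambda>m. f m + g m) = (\<lambda>m. T f m + T g m)) \<and>
     (\<forall>c. \<forall>f\<in>ell2. T (\<lambda>m. c * f m) = (\<lambda>m. c * T f m)) \<and>
     (\<exists>K. \<forall>f\<in>ell2. ell2_norm (T f) \<le> K * ell2_norm f)"

definition point_spectrum :: "((nat \<Rightarrow> complex) \<Rightarrow> nat \<Rightarrow> complex) \<Rightarrow> complex set" where
  "point_spectrum T = {\<mu>. \<exists>f\<in>ell2. f \<noteq> (\<lambda>m. 0) \<and> T f = (\<lambda>m. \<mu> * f m)}"

text \<open>Summability is required explicitly, since \<^const>\<open>suminf\<close> carries no information
  about a divergent series.\<close>

definition ell2_frame :: "(nat \<Rightarrow> nat \<Rightarrow> complex) \<Rightarrow> bool" where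
  "ell2_frame f \<longleftrightarrow>
     (\<forall>k. f k \<in> ell2) \<and>
     (\<exists>A B. 0 < A \<and> A \<le> B \<and>
       (\<forall>h\<in>ell2. summable (\<lambda>k. (cmod (ell2_inner h (f k)))\<^sup>2) \<and>
          A * (ell2_norm h)\<^sup>2 \<le> (\<Sum>k. (cmod (ell2_inner h (f k)))\<^sup>2) \<and>
          (\<Sum>k. (cmod (ell2_inner h (f k)))\<^sup>2) \<le> B * (ell2_norm h)\<^sup>2))"

section \<open>Block diagonal operators\<close>

text \<open>The orthogonal sum of the spaces \<open>V\<^sub>i = \<complex>\<^bsup>n i\<^esup>\<close> is identified with \<open>\<ell>\<^sup>2(\<nat>)\<close> by
  listing the bases block after block: \<open>\<delta>\<^bsub>i,j\<^esub>\<close>, for \<open>j < n i\<close>, is the standard unit vector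
  with index \<open>block_start n i + j\<close>. If all \<open>n i\<close> are positive, every index lies in exactly one
  block.\<close>

definition block_start :: "(nat \<Rightarrow> nat) \<Rightarrow> nat \<Rightarrow> nat" where
  "block_start n i = (\<Sum>l<i. n l)"

definition block_index :: "(nat \<Rightarrow> nat) \<Rightarrow> nat \<Rightarrow> nat" where
  "block_index n m = (THE i. block_start n i \<le> m \<and> m < block_start n (Suc i))"

lemma block_index_eq:
  assumes "j < n i"
  shows "block_index n (block_start n i + j) = i"
  unfolding block_index_def
proof (rule the_equality)
  show "block_start n i \<le> block_start n i + j \<and> block_start n i + j < block_start n (Suc i)"
    using assms by (simp add: block_start_def)
next
  have mono: "block_start n a \<le> block_start n b" if "a \<le> b" for a b
    unfolding block_start_def using that by (intro sum_mono2) auto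
  fix k
  assume k: "block_start n k \<le> block_start n i + j \<and> block_start n i + j < block_start n (Suc k)"
  have "block_start n (Suc i) = block_start n i + n i"
    by (simp add: block_start_def)
  then show "k = i"
    using k assms mono[of "Suc k" i] mono[of "Suc i" k] by (cases k i rule: linorder_cases) auto
qed

definition block_component :: "(nat \<Rightarrow> nat) \<Rightarrow> nat \<Rightarrow> (nat \<Rightarrow> complex) \<Rightarrow> complex vec" where
  "block_component n i f = vec (n i) (\<lambda>j. f (block_start n i + j))"

definition block_diagonal ::
  "(nat \<Rightarrow> nat) \<Rightarrow> (nat \<Rightarrow> complex mat) \<Rightarrow> (nat \<Rightarrow> complex) \<Rightarrow> nat \<Rightarrow> complex" where
  "block_diagonal n A f m =
     (let i = block_index n m
      in vec_index (mult_mat_vec (A i) (block_component n i f)) (m - block_start n i))"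

definition carleson_block :: "nat \<Rightarrow> complex \<Rightarrow> complex mat" where
  "carleson_block n z = Matrix.mat n n (\<lambda>(p, q).
     if p = q then z else if p = Suc q then 1 - of_real ((cmod z)\<^sup>2) else 0)"

definition subdiag_mat :: "nat \<Rightarrow> complex mat" where
  "subdiag_mat n = Matrix.mat n n (\<lambda>(p, q). if p = Suc q then 1 else 0)"

text \<open>The power is meant for \<open>z \<noteq> 0\<close>; \<^term>\<open>z powr w\<close> is the principal branch.\<close>

definition carleson_block_powr :: "nat \<Rightarrow> complex \<Rightarrow> complex \<Rightarrow> complex mat" where
  "carleson_block_powr n z \<mu> = Matrix.mat n n (\<lambda>(p, q).
     \<Sum>j<n. (\<mu> gchoose j) * z powr (\<mu> - of_nat j) * (1 - of_real ((cmod z)\<^sup>2)) ^ j *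
       index_mat (pow_mat (subdiag_mat n) j) (p, q))"

definition carleson_op ::
  "(nat \<Rightarrow> nat) \<Rightarrow> (nat \<Rightarrow> complex) \<Rightarrow> (nat \<Rightarrow> complex) \<Rightarrow> nat \<Rightarrow> complex" where
  "carleson_op n z = block_diagonal n (\<lambda>i. carleson_block (n i) (z i))"

definition carleson_op_powr ::
  "(nat \<Rightarrow> nat) \<Rightarrow> (nat \<Rightarrow> complex) \<Rightarrow> complex \<Rightarrow> (nat \<Rightarrow> complex) \<Rightarrow> nat \<Rightarrow> complex" where
  "carleson_op_powr n z \<mu> = block_diagonal n (\<lambda>i. carleson_block_powr (n i) (z i) \<mu>)"

definition block_diagonal_carleson_frame ::
  "(nat \<Rightarrow> nat) \<Rightarrow> (nat \<Rightarrow> complex) \<Rightarrow> (nat \<Rightarrow> complex) \<Rightarrow> bool" where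
  "block_diagonal_carleson_frame n z g \<longleftrightarrow>
     (\<forall>i. 0 < n i) \<and> bdd_above (range n) \<and>
     ell2_bounded_operator (carleson_op n z) \<and> g \<in> ell2 \<and>
     ell2_frame (\<lambda>k. (carleson_op n z ^^ k) g)"

section \<open>Natural density\<close>

text \<open>For a bounded sequence the counting function is eventually infinite, and the density is
  then \<open>\<infinity>\<close>; hence the values in \<^typ>\<open>ennreal\<close>.\<close>

definition counting_fun :: "(nat \<Rightarrow> real) \<Rightarrow> real \<Rightarrow> ennreal" where
  "counting_fun lam x =
     (if finite {k. lam k \<le> x} then of_nat (card {k. lam k \<le> x}) else \<infinity>)"

definition has_natural_density :: "(nat \<Rightarrow> real) \<Rightarrow> ennreal \<Rightarrow> bool" where
  "has_natural_density lam L \<longleftrightarrow> ((\<lambda>x. counting_fun lam x / ennreal x) \<longlongrightarrow> L) at_top"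

end

theory Submission
  imports Defs "HOL-Complex_Analysis.Complex_Analysis" "HOL-Real_Asymp.Real_Asymp"
begin

text \<open>
  Put \<open>\<omega>\<^sub>i = 1 - z\<^sub>i\<^sup>2\<close>. For \<open>h \<in> \<ell>\<^sup>2\<close> the function \<open>\<phi>\<^sub>h(t) = \<langle>h, J\<^sup>t g\<rangle>\<close> is a combination of the functions
  \<open>binomial(t, j) z\<^sub>i\<^bsup>t - j\<^esup>\<close> with \<open>j < n\<^sub>i\<close>, and \<open>{J\<^bsup>\<lambda>\<^sub>k\<^esup> g}\<close> is a frame iff
  \<open>Q\<^sub>\<Lambda>(h) = \<Sum>\<^sub>k |\<phi>\<^sub>h(\<lambda>\<^sub>k)|\<^sup>2\<close> is comparable with \<open>\<parallel>h\<parallel>\<^sup>2\<close>. The hypothesis is the comparability of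
  \<open>Q\<^sub>\<nat>(h)\<close> with \<open>\<parallel>h\<parallel>\<^sup>2\<close>.

  The numbers \<open>z\<^sub>i\<close> tend to 1, and \<open>z\<^sub>i\<^sup>t\<close> varies on the scale \<open>1/\<omega>\<^sub>i\<close>. At a large scale a set of density
  \<open>L\<close> is indistinguishable from \<open>L\<close> times Lebesgue measure, and so are \<open>L\<close> copies of the integers. This
  is the Abelian theorem \<open>exp_sum_asymptotics\<close>. It implies that an entry of the Gram matrix of \<open>\<Lambda>\<close> differs
  from \<open>L\<close> times the corresponding entry for \<open>\<nat>\<close> by at most \<open>\<epsilon> \<surd>(\<omega>\<^sub>i\<omega>\<^sub>l) / (1 - z\<^sub>iz\<^sub>l)\<close>, with \<open>\<epsilon>\<close> small when
  both \<open>i\<close> and \<open>l\<close> are large. The matrix \<open>\<surd>(\<omega>\<^sub>i\<omega>\<^sub>l) / (1 - z\<^sub>iz\<^sub>l)\<close> has positive entries and is bounded on \<open>\<ell>\<^sup>2\<close>,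
  because up to constants it is the Gram matrix of the given frame against the first basis vectors of
  the blocks (\<open>block_gram_bound\<close>). Hence \<open>Q\<^sub>\<Lambda>\<close> is bounded, and \<open>Q\<^sub>\<Lambda> - L Q\<^sub>\<nat>\<close> is small on vectors supported
  far out (\<open>tail_energy_comparison\<close>), where \<open>Q\<^sub>\<Lambda>\<close> therefore inherits the lower bound of \<open>Q\<^sub>\<nat>\<close>.

  Only finitely many coordinates are left. If \<open>Q\<^sub>\<Lambda>\<close> had no lower bound, a weak limit of unit vectors with
  \<open>Q\<^sub>\<Lambda> \<rightarrow> 0\<close> would be a vector \<open>h\<close> with \<open>\<phi>\<^sub>h = 0\<close> on \<open>\<Lambda>\<close>. But \<open>\<phi>\<^sub>h\<close> extends to a holomorphic function of polynomial
  growth on \<open>Re t > -1\<close>, and \<open>\<Sum> 1/(1 + \<lambda>\<^sub>k) = \<infinity>\<close>, so that \<open>\<phi>\<^sub>h = 0\<close> by the Blaschke condition and \<open>h = 0\<close> by the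
  frame property of the integer orbit. Then the unit vectors move out to infinity, where \<open>Q\<^sub>\<Lambda>\<close> is bounded
  below: a contradiction (\<open>energy_lower_bound\<close>).

  Conversely, on the first basis vector of block \<open>i\<close> the energy \<open>Q\<^sub>\<Lambda>\<close> is, up to constants,
  \<open>\<omega>\<^sub>i \<Sum>\<^sub>k z\<^sub>i\<^bsup>2\<lambda>\<^sub>k\<^esup>\<close>. An upper bound for it limits the number of \<open>\<lambda>\<^sub>k \<le> 1/\<omega>\<^sub>i\<close> to a multiple of \<open>1/\<omega>\<^sub>i\<close>, which gives
  \<open>L < \<infinity>\<close>; and if \<open>L = 0\<close> it tends to 0 with \<open>\<omega>\<^sub>i\<close>, which contradicts a lower bound.
\<close>

section \<open>Exponential sums over a sequence of given density\<close>

text \<open>Sums over a sequence become integrals over a half-line, so that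
  their limit for small \<open>S\<close> can be taken by dominated convergence.\<close>
lemma step_function_integral:
  fixes F :: "nat \<Rightarrow> real" and S :: real
  assumes S: "0 < S" and sm: "summable (\<lambda>k. \<bar>F k\<bar>)"
  shows "integral\<^sup>L lborel (\<lambda>u. indicator {0..} u * F (nat \<lfloor>u / S\<rfloor>)) = S * (\<Sum>k. F k)"
proof -
  define I where "I = (\<lambda>k::nat. {S * real k ..< S * real (Suc k)})"
  define f where "f = (\<lambda>k u. indicator (I k) u * F k :: real)"
  have mem: "u \<in> I k \<longleftrightarrow> 0 \<le> u \<and> nat \<lfloor>u / S\<rfloor> = k" for u k
  proof -
    have "u \<in> I k \<longleftrightarrow> real k \<le> u / S \<and> u / S < real k + 1"
      using S by (simp add: I_def field_simps)
    also have "\<dots> \<longleftrightarrow> \<lfloor>u / S\<rfloor> = int k"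
      by (auto simp: floor_eq_iff)
    also have "\<dots> \<longleftrightarrow> 0 \<le> u \<and> nat \<lfloor>u / S\<rfloor> = k"
    proof -
      have "0 \<le> u \<longleftrightarrow> 0 \<le> \<lfloor>u / S\<rfloor>" using S by (simp add: zero_le_divide_iff)
      then show ?thesis by (auto simp del: zero_le_floor)
    qed
    finally show ?thesis .
  qed
  have meas: "measure lborel (I k) = S" for k
    using S by (simp add: I_def algebra_simps)
  have int: "integrable lborel (f k)" for k
    using S by (auto simp: f_def I_def intro!: integrable_mult_left integrable_real_indicator)
  have val: "integral\<^sup>L lborel (f k) = S * F k" for k
    by (simp add: f_def meas)
  have nval: "integral\<^sup>L lborel (\<lambda>u. \<bar>f k u\<bar>) = S * \<bar>F k\<bar>" for k
    by (simp add: f_def meas abs_mult)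
  have sums: "(\<lambda>k. f k u) sums (indicator {0..} u * F (nat \<lfloor>u / S\<rfloor>))" for u
  proof -
    have "(\<lambda>k. f k u) = (\<lambda>k. if k = nat \<lfloor>u / S\<rfloor> then indicator {0..} u * F k else 0)"
      using mem by (auto simp: f_def indicator_def fun_eq_iff)
    then show ?thesis using sums_single[of "nat \<lfloor>u / S\<rfloor>" "\<lambda>k. indicator {0..} u * F k"] by simp
  qed
  have nsums: "summable (\<lambda>k. norm (f k u))" for u
  proof (rule summable_finite[of "{nat \<lfloor>u / S\<rfloor>}"])
    show "norm (f k u) = 0" if "k \<notin> {nat \<lfloor>u / S\<rfloor>}" for k
      using that mem[of u k] by (auto simp: f_def)
  qed simp
  have "integral\<^sup>L lborel (\<lambda>u. indicator {0..} u * F (nat \<lfloor>u / S\<rfloor>)) = integral\<^sup>L lborel (\<lambda>u. \<Sum>k. f k u)"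
    using sums by (simp add: sums_iff)
  also have "\<dots> = (\<Sum>k. integral\<^sup>L lborel (f k))"
    by (rule integral_suminf[OF int]) (use nsums sm in \<open>auto simp: nval intro!: summable_mult\<close>)
  also have "\<dots> = S * (\<Sum>k. F k)"
    using sm by (simp add: val suminf_mult summable_rabs_cancel)
  finally show ?thesis .
qed

lemma power_times_exp_bound:
  fixes x a :: real
  assumes "0 < a" "0 \<le> x"
  shows "x ^ d * exp (- (a * x)) \<le> fact d / a ^ d"
proof -
  have "(a * x) ^ d / fact d \<le> exp (a * x)"
  proof -
    have "(a * x) ^ d / fact d = (\<Sum>n\<in>{d}. (a * x) ^ n /\<^sub>R fact n)" by (simp add: divide_inverse)
    also have "\<dots> \<le> (\<Sum>n. (a * x) ^ n /\<^sub>R fact n)"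
      by (rule sum_le_suminf[OF summable_exp_generic]) (use assms in auto)
    also have "\<dots> = exp (a * x)" by (simp add: exp_def)
    finally show ?thesis .
  qed
  then show ?thesis
    using assms by (simp add: exp_minus field_simps power_mult_distrib)
qed

text \<open>For an increasing sequence the asymptotic condition says that the natural density is \<open>1 / \<rho>\<close>. It is
  stated without monotonicity and with \<open>Suc k\<close> in place of \<open>k\<close>, to avoid a division by zero at \<open>k = 0\<close>.\<close>
locale regular_growth =
  fixes lam :: "nat \<Rightarrow> real" and \<rho> :: real
  assumes lam_nonneg: "0 \<le> lam k"
    and rho_pos: "0 < \<rho>"
    and lam_asymp: "(\<lambda>k. lam k / real (Suc k)) \<longlonglongrightarrow> \<rho>"
begin

lemma linear_lower_bound:
  obtains c0 C0 where "0 < c0" "0 \<le> C0" "\<And>k. c0 * real k - C0 \<le> lam k"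
proof -
  have "eventually (\<lambda>k. lam k / real (Suc k) > \<rho> / 2) sequentially"
    by (rule order_tendstoD[OF lam_asymp]) (use rho_pos in simp)
  then obtain K where K: "\<And>k. k \<ge> K \<Longrightarrow> lam k / real (Suc k) > \<rho> / 2"
    by (auto simp: eventually_sequentially)
  have "\<rho> / 2 * real k - \<rho> / 2 * real K \<le> lam k" for k
  proof (cases "k \<ge> K")
    case True
    have "\<rho> / 2 * real k \<le> \<rho> / 2 * real (Suc k)" using rho_pos by simp
    also have "\<dots> \<le> lam k" using K[OF True] by (simp add: field_simps)
    finally show ?thesis using rho_pos mult_nonneg_nonneg[of "\<rho> / 2" "real K"] by linarith
  next
    case False
    then have "\<rho> / 2 * real k \<le> \<rho> / 2 * real K" using rho_pos by simp
    then show ?thesis using lam_nonneg[of k] by linarith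
  qed
  then show ?thesis using rho_pos by (intro that[of "\<rho> / 2" "\<rho> / 2 * real K"]) auto
qed

lemma linear_upper_bound:
  obtains C where "0 < C" "\<And>k. lam k \<le> C * real (Suc k)"
proof -
  obtain K where K: "\<And>k. norm (lam k / real (Suc k)) \<le> K"
    using convergent_imp_Bseq[of "\<lambda>k. lam k / real (Suc k)"] lam_asymp
    unfolding convergent_def Bseq_def by blast
  show ?thesis
  proof (rule that[of "max K 1"])
    show "lam k \<le> max K 1 * real (Suc k)" for k
    proof -
      have "lam k / real (Suc k) \<le> max K 1" using abs_le_D1[OF K[of k, unfolded real_norm_def]] by (rule max.coboundedI1)
      then show ?thesis by (simp add: field_simps)
    qed
  qed simp
qed

lemma lam_at_top: "filterlim lam at_top sequentially"
proof -
  obtain c0 C0 where c: "0 < c0" "\<And>k. c0 * real k - C0 \<le> lam k" using linear_lower_bound by metis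
  have "filterlim (\<lambda>k. - C0 + c0 * real k) at_top sequentially"
    by (intro filterlim_tendsto_add_at_top[OF tendsto_const]
        filterlim_tendsto_pos_mult_at_top[OF tendsto_const c(1)] filterlim_real_sequentially)
  then show ?thesis by (rule filterlim_at_top_mono) (use c(2) in \<open>auto simp: algebra_simps\<close>)
qed

text \<open>Half of the exponential absorbs the polynomial weight. The result is
  uniform in \<open>S\<close> because the weight is a power of \<open>S (1 + lam k)\<close>.\<close>
lemma weighted_exp_bound:
  obtains C where "0 < C"
    "\<And>S k. 0 < S \<Longrightarrow> S \<le> T \<Longrightarrow> S ^ d * ((1 + lam k) ^ d * exp (- S * lam k)) \<le> C * exp (- S * lam k / 2)"
proof -
  define C where "C = fact d * 2 ^ d * exp (T / 2) + 1"
  show ?thesis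
  proof (rule that[of C])
    show "0 < C" unfolding C_def by (simp add: add_nonneg_pos)
    fix S k assume S: "0 < S" "S \<le> T"
    have p: "(S * (1 + lam k)) ^ d * exp (- (1/2 * (S * (1 + lam k)))) \<le> fact d / (1/2) ^ d"
      by (rule power_times_exp_bound) (use S lam_nonneg in auto)
    have "S ^ d * ((1 + lam k) ^ d * exp (- S * lam k)) =
      (S * (1 + lam k)) ^ d * exp (- (1/2 * (S * (1 + lam k)))) * exp (S / 2) * exp (- S * lam k / 2)"
      by (simp add: power_mult_distrib mult.assoc flip: exp_add) (simp add: field_simps)
    also have "\<dots> \<le> fact d / (1/2) ^ d * exp (T / 2) * exp (- S * lam k / 2)"
      using p S by (intro mult_mono) auto
    also have "\<dots> \<le> C * exp (- S * lam k / 2)"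
      by (intro mult_right_mono) (auto simp: C_def power_divide)
    finally show "S ^ d * ((1 + lam k) ^ d * exp (- S * lam k)) \<le> C * exp (- S * lam k / 2)" .
  qed
qed

text \<open>The linear lower bound on \<open>lam\<close> compares the sum with a geometric series of ratio
  \<open>exp (- S c / 2)\<close>, whose sum is of order \<open>1 / S\<close>.\<close>
lemma exp_sum_bound:
  obtains C where "0 < C"
    "\<And>S. 0 < S \<Longrightarrow> S \<le> T \<Longrightarrow> summable (\<lambda>k. exp (- S * lam k / 2))"
    "\<And>S. 0 < S \<Longrightarrow> S \<le> T \<Longrightarrow> S * (\<Sum>k. exp (- S * lam k / 2)) \<le> C"
proof -
  obtain c0 C0 where c: "0 < c0" "0 \<le> C0" "\<And>k. c0 * real k - C0 \<le> lam k" using linear_lower_bound by metis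
  define C where "C = exp (T * C0 / 2) * (2 / c0 * exp (T * c0 / 2))"
  have main: "summable (\<lambda>k. exp (- S * lam k / 2)) \<and> S * (\<Sum>k. exp (- S * lam k / 2)) \<le> C"
    if S: "0 < S" "S \<le> T" for S
  proof -
    define x where "x = exp (- (S * c0 / 2))"
    have x: "0 < x" "x < 1" using S c by (auto simp: x_def)
    have le: "exp (- S * lam k / 2) \<le> exp (S * C0 / 2) * x ^ k" for k
    proof -
      have "S * (c0 * real k - C0) \<le> S * lam k" using c(3)[of k] S by simp
      then have "- S * lam k / 2 \<le> S * C0 / 2 + real k * (- (S * c0 / 2))"
        by (simp add: algebra_simps)
      then show ?thesis
        unfolding x_def by (simp add: exp_of_nat_mult[symmetric] flip: exp_add)
    qed
    have sg: "summable (\<lambda>k. exp (S * C0 / 2) * x ^ k)"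
      using x by (intro summable_mult summable_geometric) auto
    have sm: "summable (\<lambda>k. exp (- S * lam k / 2))"
      by (rule summable_comparison_test'[OF sg]) (use le in auto)
    have "(\<Sum>k. exp (- S * lam k / 2)) \<le> (\<Sum>k. exp (S * C0 / 2) * x ^ k)"
      by (rule suminf_le[OF _ sm sg]) (use le in auto)
    also have "\<dots> = exp (S * C0 / 2) * (1 / (1 - x))"
      using x by (subst suminf_mult) (auto simp: suminf_geometric intro: summable_geometric)
    finally have "S * (\<Sum>k. exp (- S * lam k / 2)) \<le> S * (exp (S * C0 / 2) * (1 / (1 - x)))"
      by (rule mult_left_mono) (use S in simp)
    also have "\<dots> = exp (S * C0 / 2) * (S / (1 - x))" by simp
    also have "\<dots> \<le> exp (T * C0 / 2) * (2 / c0 * exp (T * c0 / 2))"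
    proof (intro mult_mono)
      have "1 + S * c0 / 2 \<le> exp (S * c0 / 2)" by simp
      then have "S * c0 / 2 * x \<le> 1 - x"
        by (simp add: x_def exp_minus field_simps)
      then have "S / (1 - x) \<le> 2 / c0 * (1 / x)"
        using x c S by (simp add: field_simps)
      also have "\<dots> \<le> 2 / c0 * exp (T * c0 / 2)"
        using c S by (intro mult_left_mono) (auto simp: x_def exp_minus inverse_eq_divide)
      finally show "S / (1 - x) \<le> 2 / c0 * exp (T * c0 / 2)" .
    qed (use S c x in \<open>auto intro: mult_right_mono\<close>)
    finally show ?thesis using sm by (simp add: C_def)
  qed
  show ?thesis
    by (rule that[of C]) (use main c in \<open>auto simp: C_def\<close>)
qed

lemma exp_sum_polynomial_bound:
  fixes p :: "real \<Rightarrow> real"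
  assumes p: "\<And>x. 0 \<le> x \<Longrightarrow> \<bar>p x\<bar> \<le> P * (1 + x) ^ d"
  shows "\<exists>C. \<forall>S. 0 < S \<longrightarrow> S \<le> T \<longrightarrow> summable (\<lambda>k. \<bar>p (lam k) * exp (- S * lam k)\<bar>) \<and>
    S ^ Suc d * \<bar>\<Sum>k. p (lam k) * exp (- S * lam k)\<bar> \<le> C"
proof -
  obtain C1 where C1: "0 < C1"
    "\<And>S k. 0 < S \<Longrightarrow> S \<le> T \<Longrightarrow> S ^ d * ((1 + lam k) ^ d * exp (- S * lam k)) \<le> C1 * exp (- S * lam k / 2)"
    using weighted_exp_bound by metis
  obtain C2 where C2: "0 < C2"
    "\<And>S. 0 < S \<Longrightarrow> S \<le> T \<Longrightarrow> summable (\<lambda>k. exp (- S * lam k / 2))"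
    "\<And>S. 0 < S \<Longrightarrow> S \<le> T \<Longrightarrow> S * (\<Sum>k. exp (- S * lam k / 2)) \<le> C2"
    using exp_sum_bound by metis
  have P: "0 \<le> P" using p[of 0] by simp
  have main: "summable (\<lambda>k. \<bar>p (lam k) * exp (- S * lam k)\<bar>) \<and>
      S ^ Suc d * \<bar>\<Sum>k. p (lam k) * exp (- S * lam k)\<bar> \<le> P * C1 * C2"
    if S: "0 < S" "S \<le> T" for S
  proof -
    have le: "S ^ d * \<bar>p (lam k) * exp (- S * lam k)\<bar> \<le> P * C1 * exp (- S * lam k / 2)" for k
    proof -
      have "S ^ d * \<bar>p (lam k) * exp (- S * lam k)\<bar> \<le> S ^ d * (P * (1 + lam k) ^ d * exp (- S * lam k))"
        unfolding abs_mult using p[OF lam_nonneg[of k]] S by (intro mult_left_mono mult_mono) auto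
      also have "\<dots> = P * (S ^ d * ((1 + lam k) ^ d * exp (- S * lam k)))" by simp
      also have "\<dots> \<le> P * (C1 * exp (- S * lam k / 2))" by (intro mult_left_mono C1 S P)
      finally show ?thesis by simp
    qed
    have s1: "summable (\<lambda>k. P * C1 * exp (- S * lam k / 2))" using C2(2)[OF S] by (rule summable_mult)
    have s2: "summable (\<lambda>k. S ^ d * \<bar>p (lam k) * exp (- S * lam k)\<bar>)"
      by (rule summable_comparison_test'[OF s1]) (use le S in \<open>auto simp: abs_mult\<close>)
    then have s3: "summable (\<lambda>k. \<bar>p (lam k) * exp (- S * lam k)\<bar>)"
      using S by (simp add: summable_cmult_iff)
    have "S ^ Suc d * \<bar>\<Sum>k. p (lam k) * exp (- S * lam k)\<bar> \<le> S ^ Suc d * (\<Sum>k. \<bar>p (lam k) * exp (- S * lam k)\<bar>)"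
      using S s3 by (intro mult_left_mono summable_rabs) auto
    also have "\<dots> = S * (\<Sum>k. S ^ d * \<bar>p (lam k) * exp (- S * lam k)\<bar>)"
      using s3 by (simp add: suminf_mult)
    also have "\<dots> \<le> S * (\<Sum>k. P * C1 * exp (- S * lam k / 2))"
      using S by (intro mult_left_mono suminf_le[OF _ s2 s1]) (use le in auto)
    also have "\<dots> = P * C1 * (S * (\<Sum>k. exp (- S * lam k / 2)))"
      using C2(2)[OF S] by (simp add: suminf_mult)
    also have "\<dots> \<le> P * C1 * C2" using C1 P by (intro mult_left_mono C2 S) auto
    finally show ?thesis using s3 by simp
  qed
  then show ?thesis by blast
qed

text \<open>On the scale \<open>1 / S\<close> the sequence is asymptotically the arithmetic progression of step \<open>\<rho>\<close>.
  This is the only way in which the density enters the Abelian theorem below.\<close>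
lemma scaled_lam_tendsto:
  assumes "0 < u"
  shows "((\<lambda>S. S * lam (nat \<lfloor>u / S\<rfloor>)) \<longlongrightarrow> \<rho> * u) (at_right 0)"
proof -
  have lim: "filterlim (\<lambda>S. nat \<lfloor>u / S\<rfloor>) sequentially (at_right 0)"
    using assms by real_asymp
  have "((\<lambda>S. lam (nat \<lfloor>u / S\<rfloor>) / real (Suc (nat \<lfloor>u / S\<rfloor>))) \<longlongrightarrow> \<rho>) (at_right 0)"
    by (rule filterlim_compose[OF lam_asymp lim])
  moreover have "((\<lambda>S. S * real (Suc (nat \<lfloor>u / S\<rfloor>))) \<longlongrightarrow> u) (at_right 0)"
    using assms by real_asymp
  ultimately have "((\<lambda>S. lam (nat \<lfloor>u / S\<rfloor>) / real (Suc (nat \<lfloor>u / S\<rfloor>)) * (S * real (Suc (nat \<lfloor>u / S\<rfloor>)))) \<longlongrightarrow> \<rho> * u) (at_right 0)"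
    by (rule tendsto_mult)
  then show ?thesis by (simp add: field_simps del: of_nat_Suc)
qed

text \<open>An Abelian theorem. The left-hand side is the integral over \<open>u \<ge> 0\<close> of
  \<open>S\<^sup>d p(\<mu>) exp (- S \<mu>)\<close> with \<open>\<mu> = lam (nat \<lfloor>u / S\<rfloor>)\<close>. Since \<open>S \<mu> \<rightarrow> \<rho> u\<close>, the integrand tends to
  \<open>c (\<rho> u)\<^sup>d exp (- \<rho> u)\<close>, and it is dominated by a decaying exponential. The limit depends on the sequence
  only through the factor \<open>1 / \<rho>\<close>; this is what makes \<open>lam\<close> comparable with the integers.\<close>
theorem exp_sum_asymptotics:
  fixes p :: "real \<Rightarrow> real"
  assumes p: "\<And>x. 0 \<le> x \<Longrightarrow> \<bar>p x\<bar> \<le> P * (1 + x) ^ d"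
    and lead: "((\<lambda>x. p x / x ^ d) \<longlongrightarrow> c) at_top"
  shows "((\<lambda>S. S ^ Suc d * (\<Sum>k. p (lam k) * exp (- S * lam k))) \<longlongrightarrow>
           c * (LINT x:{0..}|lborel. x ^ d * exp (- x)) / \<rho>) (at_right 0)"
proof -
  obtain c0 C0 where c: "0 < c0" "0 \<le> C0" "\<And>k. c0 * real k - C0 \<le> lam k" using linear_lower_bound by metis
  obtain C1 where C1: "0 < C1"
    "\<And>S k. 0 < S \<Longrightarrow> S \<le> 1 \<Longrightarrow> S ^ d * ((1 + lam k) ^ d * exp (- S * lam k)) \<le> C1 * exp (- S * lam k / 2)"
    using weighted_exp_bound by metis
  have sm: "\<And>S. 0 < S \<Longrightarrow> S \<le> 1 \<Longrightarrow> summable (\<lambda>k. \<bar>p (lam k) * exp (- S * lam k)\<bar>)"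
    using exp_sum_polynomial_bound[OF p] by blast
  have P: "0 \<le> P" using p[of 0] by simp
  define s where "s = (\<lambda>S u. indicator {0..} u * (S ^ d * (p (lam (nat \<lfloor>u / S\<rfloor>)) * exp (- S * lam (nat \<lfloor>u / S\<rfloor>)))) :: real)"
  define f where "f = (\<lambda>u. indicator {0..} u * (c * ((\<rho> * u) ^ d * exp (- (\<rho> * u)))) :: real)"
  define w where "w = (\<lambda>u. indicator {0..} u * (P * C1 * exp ((c0 + C0) / 2) * exp (- (c0 / 2 * u))) :: real)"
  have int_s: "integral\<^sup>L lborel (s S) = S ^ Suc d * (\<Sum>k. p (lam k) * exp (- S * lam k))"
    if "0 < S" "S \<le> 1" for S
  proof -
    have "integral\<^sup>L lborel (s S) = S * (\<Sum>k. S ^ d * (p (lam k) * exp (- S * lam k)))"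
      unfolding s_def
      by (rule step_function_integral[where F = "\<lambda>k. S ^ d * (p (lam k) * exp (- S * lam k))"])
         (use sm[OF that] that in \<open>auto simp: abs_mult intro: summable_mult\<close>)
    also have "\<dots> = S ^ Suc d * (\<Sum>k. p (lam k) * exp (- S * lam k))"
      using summable_rabs_cancel[OF sm[OF that]] by (simp add: suminf_mult)
    finally show ?thesis .
  qed
  have meas_s: "s S \<in> borel_measurable lborel" for S
  proof -
    have "(\<lambda>u. (\<lambda>k. p (lam k) * exp (- S * lam k)) (nat \<lfloor>u / S\<rfloor>)) \<in> borel_measurable lborel"
      by (rule measurable_compose_countable) measurable
    then show ?thesis unfolding s_def by measurable
  qed
  have "integrable lborel (\<lambda>u. indicator {0..} u *\<^sub>R exp (- (u * (c0 / 2))))"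
  proof -
    have "(\<lambda>u. exp (- (c0 / 2) * u)) absolutely_integrable_on {0..}"
      using integrable_on_exp_minus_to_infinity[of "c0 / 2" 0] c
      by (intro nonnegative_absolutely_integrable_1) auto
    then show ?thesis
      unfolding set_integrable_def by (subst (asm) integrable_completion) (simp_all add: mult.commute)
  qed
  from integrable_mult_right[OF this, of "P * C1 * exp ((c0 + C0) / 2)"]
  have int_w: "integrable lborel w"
    unfolding w_def by (simp add: mult_ac)
  have bound: "norm (s S u) \<le> w u" if S: "0 < S" "S \<le> 1" for S u
  proof (cases "0 \<le> u")
    case True
    define k where "k = nat \<lfloor>u / S\<rfloor>"
    have "u / S < real k + 1" using True S unfolding k_def by linarith
    then have uk: "u < S * real k + S" using S by (simp add: field_simps)
    have "norm (s S u) = S ^ d * (\<bar>p (lam k)\<bar> * exp (- S * lam k))"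
      using True S by (simp add: s_def k_def abs_mult)
    also have "\<dots> \<le> S ^ d * (P * (1 + lam k) ^ d * exp (- S * lam k))"
      using p[OF lam_nonneg[of k]] S by (intro mult_left_mono mult_right_mono) auto
    also have "\<dots> = P * (S ^ d * ((1 + lam k) ^ d * exp (- S * lam k)))" by simp
    also have "\<dots> \<le> P * (C1 * exp (- S * lam k / 2))" by (intro mult_left_mono C1 S P)
    also have "\<dots> \<le> P * (C1 * exp ((c0 + C0) / 2 + - (c0 / 2 * u)))"
    proof -
      have "c0 * u \<le> c0 * (S * real k + S)" using uk c by simp
      also have "\<dots> = S * (c0 * real k - C0) + S * (c0 + C0)" by (simp add: algebra_simps)
      also have "\<dots> \<le> S * lam k + 1 * (c0 + C0)"
        using c S by (intro add_mono mult_left_mono mult_right_mono) auto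
      finally have "- S * lam k / 2 \<le> (c0 + C0) / 2 + - (c0 / 2 * u)" by (simp add: field_simps)
      then show ?thesis using P C1 by (intro mult_left_mono) auto
    qed
    also have "\<dots> = w u" using True unfolding exp_add by (simp add: w_def)
    finally show ?thesis .
  qed (simp add: s_def w_def)
  have lim: "((\<lambda>S. s S u) \<longlongrightarrow> f u) (at_right 0)" if "u \<noteq> 0" for u
  proof (cases "0 < u")
    case True
    have sc: "((\<lambda>S. S * lam (nat \<lfloor>u / S\<rfloor>)) \<longlongrightarrow> \<rho> * u) (at_right 0)"
      by (rule scaled_lam_tendsto[OF True])
    have "filterlim (\<lambda>S. nat \<lfloor>u / S\<rfloor>) sequentially (at_right 0)"
      using True by real_asymp
    then have inf: "filterlim (\<lambda>S. lam (nat \<lfloor>u / S\<rfloor>)) at_top (at_right 0)"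
      by (rule filterlim_compose[OF lam_at_top])
    have "((\<lambda>S. p (lam (nat \<lfloor>u / S\<rfloor>)) / lam (nat \<lfloor>u / S\<rfloor>) ^ d * ((S * lam (nat \<lfloor>u / S\<rfloor>)) ^ d * exp (- (S * lam (nat \<lfloor>u / S\<rfloor>)))))
        \<longlongrightarrow> c * ((\<rho> * u) ^ d * exp (- (\<rho> * u)))) (at_right 0)"
      by (intro tendsto_intros sc filterlim_compose[OF lead inf])
    moreover have "eventually (\<lambda>S. 0 < lam (nat \<lfloor>u / S\<rfloor>)) (at_right 0)"
      using inf by (rule filterlim_at_top_dense[THEN iffD1, rule_format])
    then have "eventually (\<lambda>S. p (lam (nat \<lfloor>u / S\<rfloor>)) / lam (nat \<lfloor>u / S\<rfloor>) ^ d * ((S * lam (nat \<lfloor>u / S\<rfloor>)) ^ d * exp (- (S * lam (nat \<lfloor>u / S\<rfloor>))))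
         = s S u) (at_right 0)"
      by eventually_elim (use True in \<open>simp add: s_def power_mult_distrib\<close>)
    ultimately show ?thesis
      using True by (simp add: f_def Lim_transform_eventually)
  qed (use that in \<open>auto simp: s_def f_def indicator_def\<close>)
  have "((\<lambda>y. integral\<^sup>L lborel (s (inverse y))) \<longlongrightarrow> integral\<^sup>L lborel f) at_top"
  proof (rule integral_dominated_convergence_at_top[where w = w])
    show "f \<in> borel_measurable lborel" unfolding f_def by measurable
    show "\<forall>\<^sub>F y in at_top. AE x in lborel. norm (s (inverse y) x) \<le> w x"
      using eventually_ge_at_top[of 1]
    proof eventually_elim
      case (elim y)
      then have "0 < inverse y" "inverse y \<le> 1" by (auto simp: inverse_le_1_iff)
      then show ?case by (intro AE_I2 bound)
    qed
    have "AE x in lborel. x \<noteq> (0::real)" by (rule AE_lborel_singleton)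
    then show "AE x in lborel. ((\<lambda>y. s (inverse y) x) \<longlongrightarrow> f x) at_top"
      by eventually_elim (use lim in \<open>auto simp: filterlim_at_right_to_top\<close>)
  qed (use meas_s int_w in auto)
  then have lim_int: "((\<lambda>S. integral\<^sup>L lborel (s S)) \<longlongrightarrow> integral\<^sup>L lborel f) (at_right 0)"
    by (simp add: filterlim_at_right_to_top)
  have ev: "eventually (\<lambda>S. integral\<^sup>L lborel (s S) = S ^ Suc d * (\<Sum>k. p (lam k) * exp (- S * lam k))) (at_right 0)"
    using eventually_at_right_less[of 0] eventually_at_right_real[of 0 1, simplified]
    by eventually_elim (use int_s in auto)
  have int_f: "integral\<^sup>L lborel f = c * (LINT x:{0..}|lborel. x ^ d * exp (- x)) / \<rho>"
  proof -
    define g where "g = (\<lambda>x::real. indicator {0..} x * (x ^ d * exp (- x)))"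
    have ind: "(indicator {0..} (\<rho> * u) :: real) = indicator {0..} u" for u
      using rho_pos by (auto simp: indicator_def zero_le_mult_iff)
    have "integral\<^sup>L lborel g = \<bar>\<rho>\<bar> *\<^sub>R integral\<^sup>L lborel (\<lambda>u. g (0 + \<rho> * u))"
      by (rule lborel_integral_real_affine) (use rho_pos in auto)
    moreover have "f = (\<lambda>u. c * g (0 + \<rho> * u))"
      by (auto simp: f_def g_def ind fun_eq_iff)
    ultimately show ?thesis
      using rho_pos by (simp add: g_def set_lebesgue_integral_def)
  qed
  show ?thesis using Lim_transform_eventually[OF lim_int ev] unfolding int_f .
qed

end

section \<open>Zeros of bounded holomorphic functions\<close>

text \<open>Moving the zero to the origin by a Moebius transformation, this is the Schwarz lemma.
  The bound \<open>M\<close> passes to the quotient by the Schwarz lemma for \<open>f / M'\<close> with arbitrary \<open>M' > M\<close>.\<close>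
lemma divide_disc_zero:
  fixes f :: "complex \<Rightarrow> complex"
  assumes f: "f holomorphic_on ball 0 1"
    and bd: "\<And>x. norm x < 1 \<Longrightarrow> norm (f x) \<le> M"
    and a: "norm a < 1" "f a = 0"
  obtains g where "g holomorphic_on ball 0 1" "\<And>x. norm x < 1 \<Longrightarrow> norm (g x) \<le> M"
    "\<And>x. norm x < 1 \<Longrightarrow> f x = Moebius_function 0 a x * g x"
proof -
  define F where "F = f \<circ> Moebius_function 0 (- a)"
  have ma: "norm (- a) < 1" using a by simp
  have hF: "F holomorphic_on ball 0 1"
    unfolding F_def
    by (rule holomorphic_on_compose_gen[OF Moebius_function_holomorphic[OF ma] f])
       (use Moebius_function_norm_lt_1[OF ma] in auto)
  have F0: "F 0 = 0" using a by (simp add: F_def Moebius_function_of_zero)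
  have bdF: "norm (F x) \<le> M" if "norm x < 1" for x
    unfolding F_def o_def by (intro bd Moebius_function_norm_lt_1 ma that)
  obtain h where h: "h holomorphic_on ball 0 1" "\<And>z. norm z < 1 \<Longrightarrow> F z = z * h z" "deriv F 0 = h 0"
    using Schwarz3[OF hF F0] by metis
  have hb: "norm (h x) \<le> M" if x: "norm x < 1" for x
  proof (rule dense_ge)
    fix M' assume M': "M < M'"
    have "0 \<le> M" using order_trans[OF norm_ge_zero bd[of 0]] by simp
    then have pos: "0 < M'" using M' by simp
    define G where "G = (\<lambda>x. F x / of_real M')"
    have hG: "G holomorphic_on ball 0 1" unfolding G_def by (intro holomorphic_intros hF) (use pos in auto)
    have G0: "G 0 = 0" by (simp add: G_def F0)
    have ltG: "norm (G x) < 1" if "norm x < 1" for x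
      using bdF[OF that] M' pos by (simp add: G_def norm_divide)
    note Schwarz = Schwarz_Lemma[OF hG G0 ltG x]
    show "norm (h x) \<le> M'"
    proof (cases "x = 0")
      case True
      have "F field_differentiable at 0"
        using hF by (auto simp: holomorphic_on_def at_within_open[of _ "ball 0 1"])
      then have "deriv G 0 = deriv F 0 / of_real M'" unfolding G_def by (rule deriv_cdivide_right)
      then show ?thesis using Schwarz(2) True h(3) pos by (auto simp: norm_divide)
    next
      case False
      then show ?thesis using Schwarz(1) h(2)[OF x] pos by (simp add: G_def norm_mult norm_divide field_simps)
    qed
  qed
  show ?thesis
  proof (rule that[of "h \<circ> Moebius_function 0 a"])
    show "(h \<circ> Moebius_function 0 a) holomorphic_on ball 0 1"
      by (rule holomorphic_on_compose_gen[OF Moebius_function_holomorphic[OF a(1)] h(1)])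
         (use Moebius_function_norm_lt_1[OF a(1)] in auto)
    fix x :: complex assume x: "norm x < 1"
    have m: "norm (Moebius_function 0 a x) < 1" using Moebius_function_norm_lt_1 a x by blast
    show "norm ((h \<circ> Moebius_function 0 a) x) \<le> M" using hb[OF m] by simp
    have "F (Moebius_function 0 a x) = f x"
      unfolding F_def o_def using Moebius_function_compose[of "-a" a x] a x by simp
    then show "f x = Moebius_function 0 a x * (h \<circ> Moebius_function 0 a) x"
      using h(2)[OF m] by simp
  qed
qed

text \<open>From the identity
  \<open>1 - |b\<^sub>a(x)|\<^sup>2 = (1 - |x|\<^sup>2) (1 - |a|\<^sup>2) / |1 - cnj a x|\<^sup>2\<close> for the Moebius function \<open>b\<^sub>a\<close>, with the denominator at most 4.\<close>
lemma Moebius_function_norm_sq_le: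
  assumes a: "norm a < 1" and x: "norm x < 1"
  shows "(norm (Moebius_function 0 a x))\<^sup>2 \<le> 1 - (1 - (norm x)\<^sup>2) / 4 * (1 - norm a)"
proof -
  define D where "D = (cmod (1 - cnj a * x))\<^sup>2"
  have "norm (cnj a * x) < 1"
    using mult_strict_mono'[of "cmod a" 1 "cmod x" 1] a x by (simp add: norm_mult)
  then have D: "0 < D" "D \<le> 4"
  proof -
    assume n: "norm (cnj a * x) < 1"
    then have "1 - cnj a * x \<noteq> 0" by auto
    then show "0 < D" by (simp add: D_def)
    have "cmod (1 - cnj a * x) \<le> 2" using norm_triangle_ineq4[of 1 "cnj a * x"] n by simp
    then have "D \<le> 2\<^sup>2" unfolding D_def by (intro power_mono) auto
    then show "D \<le> 4" by simp
  qed
  have id: "D - (cmod (x - a))\<^sup>2 = (1 - (cmod x)\<^sup>2) * (1 - (cmod a)\<^sup>2)"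
    unfolding D_def cmod_power2 by (simp add: power2_eq_square algebra_simps)
  have x2: "0 \<le> 1 - (cmod x)\<^sup>2" using x by (simp add: power_le_one abs_square_le_1)
  have a2: "1 - cmod a \<le> 1 - (cmod a)\<^sup>2"
    using a by (simp add: power2_eq_square mult_left_le)
  have "(1 - (cmod x)\<^sup>2) / 4 * (1 - cmod a) \<le> (1 - (cmod x)\<^sup>2) * (1 - (cmod a)\<^sup>2) / D"
  proof -
    have "(1 - (cmod x)\<^sup>2) * (1 - cmod a) / 4 \<le> (1 - (cmod x)\<^sup>2) * (1 - (cmod a)\<^sup>2) / D"
      using D x2 a2 a by (intro frac_le mult_left_mono mult_nonneg_nonneg) auto
    then show ?thesis by simp
  qed
  also have "\<dots> = 1 - (cmod (x - a))\<^sup>2 / D" using D by (subst id[symmetric]) (simp add: diff_divide_distrib)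
  also have "(cmod (x - a))\<^sup>2 / D = (norm (Moebius_function 0 a x))\<^sup>2"
    by (simp add: D_def Moebius_function_simple norm_divide power_divide)
  finally show ?thesis by simp
qed

text \<open>The zeros are divided out one after the other; distinct zeros survive the division by
  the earlier factors.\<close>
lemma bounded_by_Blaschke_product:
  fixes f :: "complex \<Rightarrow> complex" and a :: "nat \<Rightarrow> complex"
  assumes f: "f holomorphic_on ball 0 1" and bd: "\<And>x. norm x < 1 \<Longrightarrow> norm (f x) \<le> M"
    and a: "\<And>k. norm (a k) < 1" "inj a" "\<And>k. f (a k) = 0"
    and x: "norm x < 1"
  shows "norm (f x) \<le> M * (\<Prod>k<n. norm (Moebius_function 0 (a k) x))"
proof -
  \<comment> \<open>the quotient by the first \<open>n\<close> factors keeps the bound \<open>M\<close>\<close>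
  have "\<exists>g. g holomorphic_on ball 0 1 \<and> (\<forall>x. norm x < 1 \<longrightarrow> norm (g x) \<le> M) \<and>
     (\<forall>x. norm x < 1 \<longrightarrow> f x = (\<Prod>k<n. Moebius_function 0 (a k) x) * g x)"
  proof (induction n)
    case 0
    then show ?case using f bd by (intro exI[of _ f]) auto
  next
    case (Suc n)
    then obtain g where g: "g holomorphic_on ball 0 1" "\<And>x. norm x < 1 \<Longrightarrow> norm (g x) \<le> M"
      "\<And>x. norm x < 1 \<Longrightarrow> f x = (\<Prod>k<n. Moebius_function 0 (a k) x) * g x" by blast
    have nz: "Moebius_function 0 (a k) (a n) \<noteq> 0" if "k < n" for k
    proof -
      have "a n \<noteq> a k" using that a(2) by (auto dest: injD)
      moreover have "norm (cnj (a k) * a n) < 1"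
        using a(1)[of k] a(1)[of n] mult_strict_mono'[of "cmod (a k)" 1 "cmod (a n)" 1] by (simp add: norm_mult)
      then have "1 - cnj (a k) * a n \<noteq> 0" by auto
      ultimately show ?thesis by (simp add: Moebius_function_simple)
    qed
    have "(\<Prod>k<n. Moebius_function 0 (a k) (a n)) * g (a n) = 0"
      using g(3)[OF a(1)[of n]] a(3) by simp
    then have gz: "g (a n) = 0" using nz by auto
    obtain G where G: "G holomorphic_on ball 0 1" "\<And>x. norm x < 1 \<Longrightarrow> norm (G x) \<le> M"
      "\<And>x. norm x < 1 \<Longrightarrow> g x = Moebius_function 0 (a n) x * G x"
      using divide_disc_zero[OF g(1,2) a(1)[of n] gz] by metis
    show ?case using G g(3) by (intro exI[of _ G]) auto
  qed
  then obtain g where g: "norm (g x) \<le> M" "f x = (\<Prod>k<n. Moebius_function 0 (a k) x) * g x"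
    using x by blast
  have "norm (f x) = norm (g x) * (\<Prod>k<n. norm (Moebius_function 0 (a k) x))"
    by (simp add: g(2) norm_mult prod_norm mult.commute)
  then show ?thesis using g(1) by (simp add: mult_right_mono prod_nonneg)
qed

text \<open>The partial Blaschke products at \<open>x\<close> are at most \<open>exp (- c \<Sum> (1 - |a\<^sub>k|))\<close>, hence tend to 0
  when the Blaschke condition fails.\<close>
theorem Blaschke_uniqueness:
  fixes f :: "complex \<Rightarrow> complex" and a :: "nat \<Rightarrow> complex"
  assumes f: "f holomorphic_on ball 0 1" and bd: "\<And>x. norm x < 1 \<Longrightarrow> norm (f x) \<le> M"
    and a: "\<And>k. norm (a k) < 1" "inj a" "\<And>k. f (a k) = 0"
    and div: "\<not> summable (\<lambda>k. 1 - norm (a k))"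
    and x: "norm x < 1"
  shows "f x = 0"
proof -
  define c where "c = (1 - (norm x)\<^sup>2) / 4"
  define s where "s = (\<lambda>n. \<Sum>k<n. 1 - norm (a k))"
  have c: "0 < c" using x by (simp add: c_def power_less_one_iff abs_square_less_1)
  have M: "0 \<le> M" using order_trans[OF norm_ge_zero bd[of 0]] by simp
  have le: "(norm (f x))\<^sup>2 \<le> M\<^sup>2 * exp (- (c * s n))" for n
  proof -
    have "(norm (f x))\<^sup>2 \<le> (M * (\<Prod>k<n. norm (Moebius_function 0 (a k) x)))\<^sup>2"
      by (intro power_mono bounded_by_Blaschke_product[OF f bd a x]) auto
    also have "\<dots> = M\<^sup>2 * (\<Prod>k<n. (norm (Moebius_function 0 (a k) x))\<^sup>2)"
      by (simp add: power_mult_distrib prod_power_distrib)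
    also have "\<dots> \<le> M\<^sup>2 * (\<Prod>k<n. exp (- (c * (1 - norm (a k)))))"
    proof (intro mult_left_mono prod_mono conjI)
      fix k
      have "(norm (Moebius_function 0 (a k) x))\<^sup>2 \<le> 1 - c * (1 - norm (a k))"
        unfolding c_def by (rule Moebius_function_norm_sq_le[OF a(1) x])
      also have "\<dots> \<le> exp (- (c * (1 - norm (a k))))"
        using exp_ge_add_one_self[of "- (c * (1 - norm (a k)))"] by simp
      finally show "(norm (Moebius_function 0 (a k) x))\<^sup>2 \<le> exp (- (c * (1 - norm (a k))))" .
    qed auto
    also have "\<dots> = M\<^sup>2 * exp (- (c * s n))"
      unfolding s_def sum_distrib_left sum_negf[symmetric] by (subst exp_sum) auto
    finally show ?thesis .
  qed
  have "mono s" unfolding s_def using a(1) by (intro monoI sum_mono2) (auto simp: less_imp_le)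
  have "filterlim s at_top sequentially"
  proof (rule ccontr)
    assume "\<not> ?thesis"
    then obtain b where "\<exists>\<^sub>F n in sequentially. s n < b"
      by (auto simp: filterlim_at_top not_eventually not_le)
    have b: "s n \<le> b" for n
    proof -
      obtain N where "n \<le> N" "s N < b"
        using \<open>\<exists>\<^sub>F n in sequentially. s n < b\<close> unfolding frequently_sequentially by blast
      then show ?thesis using monoD[OF \<open>mono s\<close>, of n N] by linarith
    qed
    have "summable (\<lambda>k. 1 - norm (a k))"
      by (rule summableI_nonneg_bounded[of _ b]) (use a(1) b in \<open>auto simp: s_def less_imp_le\<close>)
    with div show False by simp
  qed
  then have "filterlim (\<lambda>n. c * s n) at_top sequentially"
    by (rule filterlim_tendsto_pos_mult_at_top[OF tendsto_const c])
  then have "(\<lambda>n. exp (- (c * s n))) \<longlonglongrightarrow> 0"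
    by (intro filterlim_compose[OF exp_at_bot] filterlim_compose[OF filterlim_uminus_at_bot_at_top])
  then have "(\<lambda>n. M\<^sup>2 * exp (- (c * s n))) \<longlonglongrightarrow> M\<^sup>2 * 0" by (intro tendsto_intros)
  then have "(norm (f x))\<^sup>2 \<le> M\<^sup>2 * 0" by (rule LIMSEQ_le_const) (use le in auto)
  then show ?thesis by simp
qed

text \<open>The map \<open>x \<mapsto> 2 x / (1 - x)\<close> carries the unit disc onto the half-plane \<open>Re t > -1\<close>, and a zero
  \<open>t \<ge> 0\<close> corresponds to a point of the disc at distance \<open>2 / (t + 2)\<close> from the circle. For zeros of at most
  linear growth these distances have a divergent sum, by comparison with the harmonic series.\<close>
corollary half_plane_uniqueness:
  fixes F :: "complex \<Rightarrow> complex" and lam :: "nat \<Rightarrow> real"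
  assumes F: "F holomorphic_on {t. - 1 < Re t}" and bd: "\<And>t. - 1 < Re t \<Longrightarrow> norm (F t) \<le> M"
    and lam: "\<And>k. 0 \<le> lam k" "inj lam" "\<And>k. lam k \<le> C * real (Suc k)"
    and zero: "\<And>k. F (of_real (lam k)) = 0"
    and t: "- 1 < Re t"
  shows "F t = 0"
proof -
  \<comment> \<open>the inverse of \<open>t \<mapsto> t / (t + 2)\<close>\<close>
  define \<psi> :: "complex \<Rightarrow> complex" where "\<psi> = (\<lambda>x. 2 * x / (1 - x))"
  define a where "a = (\<lambda>k. complex_of_real (lam k / (lam k + 2)))"
  have \<psi>: "- 1 < Re (\<psi> x)" if x: "norm x < 1" for x
  proof -
    have "x \<noteq> 1" using x by auto
    then have D: "(cmod (1 - x))\<^sup>2 > 0" by simp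
    have "\<psi> x + 1 = (1 + x) / (1 - x)"
      using \<open>x \<noteq> 1\<close> by (simp add: \<psi>_def field_simps)
    then have "Re (\<psi> x) + 1 = Re ((1 + x) / (1 - x))"
      by (metis one_complex.sel(1) plus_complex.sel(1))
    also have "\<dots> = (1 - (cmod x)\<^sup>2) / (cmod (1 - x))\<^sup>2"
    proof -
      have "Re ((1 + x) * cnj (1 - x)) = 1 - (cmod x)\<^sup>2"
        unfolding cmod_power2 by (simp add: power2_eq_square algebra_simps)
      then show ?thesis by (simp only: complex_div_cnj[of "1 + x"] Re_divide_of_real flip: of_real_power)
    qed
    also have "\<dots> > 0" using D x by (simp add: abs_square_less_1)
    finally show ?thesis by simp
  qed
  have \<psi>_inv: "\<psi> (s / (s + 2)) = s" if "- 1 < Re s" for s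
  proof -
    have "s + 2 \<noteq> 0" using that by (auto simp: complex_eq_iff)
    then have "1 - s / (s + 2) = 2 / (s + 2)" by (simp add: field_simps)
    then show ?thesis using \<open>s + 2 \<noteq> 0\<close> by (simp add: \<psi>_def)
  qed
  have in_disc: "norm (s / (s + 2)) < 1" if "- 1 < Re s" for s
  proof -
    have "s + 2 \<noteq> 0" using that by (auto simp: complex_eq_iff)
    have "(cmod s)\<^sup>2 < (cmod (s + 2))\<^sup>2"
    proof -
      have "(cmod (s + 2))\<^sup>2 = (cmod s)\<^sup>2 + 4 * (Re s + 1)"
        unfolding cmod_power2 by (simp add: power2_eq_square distrib_left distrib_right)
      then show ?thesis using that by simp
    qed
    then have "cmod s < cmod (s + 2)" by (rule power2_less_imp_less) simp
    then show ?thesis using \<open>s + 2 \<noteq> 0\<close> by (simp add: norm_divide)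
  qed
  have a_eq: "a k = of_real (lam k) / (of_real (lam k) + 2)" for k by (simp add: a_def)
  have na: "norm (a k) = lam k / (lam k + 2)" for k
    using lam(1)[of k] by (simp add: a_def norm_divide)
  have hol: "(F \<circ> \<psi>) holomorphic_on ball 0 1"
  proof (rule holomorphic_on_compose_gen[OF _ F])
    show "\<psi> holomorphic_on ball 0 1" unfolding \<psi>_def by (intro holomorphic_intros) auto
  qed (use \<psi> in auto)
  have "(F \<circ> \<psi>) (t / (t + 2)) = 0"
  proof (rule Blaschke_uniqueness[OF hol, where a = a])
    show "norm ((F \<circ> \<psi>) x) \<le> M" if "norm x < 1" for x using bd[OF \<psi>[OF that]] by simp
    show "norm (a k) < 1" for k unfolding a_eq using lam(1)[of k] by (intro in_disc) simp
    show "inj a"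
    proof (rule injI)
      fix i j assume "a i = a j"
      then have "\<psi> (a i) = \<psi> (a j)" by simp
      then have "complex_of_real (lam i) = of_real (lam j)"
        unfolding a_eq using lam(1)[of i] lam(1)[of j] by (simp add: \<psi>_inv)
      then show "i = j" using lam(2) by (simp add: inj_eq)
    qed
    show "(F \<circ> \<psi>) (a k) = 0" for k
      using zero[of k] lam(1)[of k] by (simp add: a_eq \<psi>_inv)
    show "\<not> summable (\<lambda>k. 1 - norm (a k))"
    proof
      assume sm: "summable (\<lambda>k. 1 - norm (a k))"
      have C: "0 \<le> C" using lam(1)[of 0] lam(3)[of 0] by simp
      have le: "inverse (real (Suc k)) \<le> (C + 2) / 2 * (1 - norm (a k))" for k
      proof -
        have "1 - x / (x + 2) = 2 / (x + 2)" if "0 \<le> x" for x :: real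
          using that by (simp add: divide_simps)
        from this[OF lam(1)[of k]] have "1 - norm (a k) = 2 / (lam k + 2)" unfolding na .
        also have "\<dots> \<ge> 2 / ((C + 2) * real (Suc k))"
        proof (rule divide_left_mono)
          show "lam k + 2 \<le> (C + 2) * real (Suc k)" using lam(3)[of k] by (simp add: algebra_simps)
          show "0 < (C + 2) * real (Suc k) * (lam k + 2)"
            using C lam(1)[of k] by (intro mult_pos_pos add_nonneg_pos) auto
        qed simp
        finally have le: "(C + 2) / 2 * (2 / ((C + 2) * real (Suc k))) \<le> (C + 2) / 2 * (1 - norm (a k))"
          using C by (intro mult_left_mono) auto
        have cancel: "x / 2 * (2 / (x * y)) = inverse y" if "0 < x" for x y :: real
          using that by (simp add: inverse_eq_divide)
        have pos: "0 < C + 2" using C by linarith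
        show ?thesis using le unfolding cancel[OF pos] .
      qed
      have "summable (\<lambda>k. inverse (real (Suc k)))"
        by (rule summable_comparison_test'[OF summable_mult[OF sm, of "(C + 2) / 2"]]) (use le in auto)
      then have "summable (\<lambda>k. inverse (real k))" by (rule summable_Suc_iff[THEN iffD1])
      then show False using not_summable_harmonic[where 'a = real] by simp
    qed
  qed (rule in_disc[OF t])
  then show ?thesis by (simp add: \<psi>_inv[OF t])
qed

section \<open>Weak compactness in the sequence space\<close>

definition ell2_normsq :: "(nat \<Rightarrow> complex) \<Rightarrow> real" where
  "ell2_normsq f = (\<Sum>m. (cmod (f m))\<^sup>2)"

definition cutoff :: "nat \<Rightarrow> (nat \<Rightarrow> complex) \<Rightarrow> nat \<Rightarrow> complex" where
  "cutoff M h = (\<lambda>m. if m < M then h m else 0)"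

lemma ell2_normsq_nonneg: "f \<in> ell2 \<Longrightarrow> 0 \<le> ell2_normsq f"
  unfolding ell2_normsq_def by (auto intro: suminf_nonneg simp: ell2_def)

lemma ell2_norm_power2: "f \<in> ell2 \<Longrightarrow> (ell2_norm f)\<^sup>2 = ell2_normsq f"
  using ell2_normsq_nonneg by (simp add: ell2_norm_def ell2_normsq_def)

lemma ell2_eq_zero:
  assumes "f \<in> ell2" "ell2_normsq f \<le> 0"
  shows "f m = 0"
proof -
  have "ell2_normsq f = 0" using assms ell2_normsq_nonneg[of f] by simp
  then show ?thesis using assms(1) by (auto simp: ell2_normsq_def ell2_def suminf_eq_zero_iff)
qed

lemma ell2_finite_support:
  assumes "\<And>m. M \<le> m \<Longrightarrow> f m = 0"
  shows "f \<in> ell2" "ell2_normsq f = (\<Sum>m<M. (cmod (f m))\<^sup>2)" "ell2_inner f g = (\<Sum>m<M. f m * cnj (g m))"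
proof -
  have "summable (\<lambda>m. (cmod (f m))\<^sup>2)"
    by (rule summable_finite[of "{..<M}"]) (use assms in \<open>auto simp: not_less\<close>)
  then show "f \<in> ell2" by (simp add: ell2_def)
  show "ell2_normsq f = (\<Sum>m<M. (cmod (f m))\<^sup>2)"
    unfolding ell2_normsq_def by (rule suminf_finite) (use assms in auto)
  show "ell2_inner f g = (\<Sum>m<M. f m * cnj (g m))"
    unfolding ell2_inner_def by (rule suminf_finite) (use assms in auto)
qed

lemma ell2_summable_mult:
  assumes "f \<in> ell2" "g \<in> ell2"
  shows "summable (\<lambda>m. cmod (f m) * cmod (g m))"
proof (rule summable_comparison_test')
  show "summable (\<lambda>m. (cmod (f m))\<^sup>2 + (cmod (g m))\<^sup>2)"
    using assms by (auto simp: ell2_def intro: summable_add)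
  show "norm (cmod (f m) * cmod (g m)) \<le> (cmod (f m))\<^sup>2 + (cmod (g m))\<^sup>2" for m
  proof -
    have "0 \<le> cmod (f m) * cmod (g m)" by simp
    moreover have "norm (cmod (f m) * cmod (g m)) = cmod (f m) * cmod (g m)" by simp
    moreover have "2 * (cmod (f m) * cmod (g m)) \<le> (cmod (f m))\<^sup>2 + (cmod (g m))\<^sup>2"
      using sum_squares_bound[of "cmod (f m)" "cmod (g m)"] by (simp only: mult.assoc)
    ultimately show ?thesis by linarith
  qed
qed

lemma ell2_inner_summable:
  assumes "f \<in> ell2" "g \<in> ell2"
  shows "summable (\<lambda>m. f m * cnj (g m))"
  by (rule summable_norm_cancel) (use ell2_summable_mult[OF assms] in \<open>simp add: norm_mult\<close>)

lemma ell2_Cauchy_Schwarz: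
  assumes "f \<in> ell2" "g \<in> ell2"
  shows "(cmod (ell2_inner f g))\<^sup>2 \<le> ell2_normsq f * ell2_normsq g"
proof -
  have "(\<lambda>n. (cmod (\<Sum>m<n. f m * cnj (g m)))\<^sup>2) \<longlonglongrightarrow> (cmod (ell2_inner f g))\<^sup>2"
    unfolding ell2_inner_def by (intro tendsto_intros summable_LIMSEQ ell2_inner_summable assms)
  moreover have "(cmod (\<Sum>m<n. f m * cnj (g m)))\<^sup>2 \<le> ell2_normsq f * ell2_normsq g" for n
  proof -
    have "cmod (\<Sum>m<n. f m * cnj (g m)) \<le> (\<Sum>m<n. cmod (f m) * cmod (g m))"
      by (rule order_trans[OF norm_sum]) (simp add: norm_mult)
    then have "(cmod (\<Sum>m<n. f m * cnj (g m)))\<^sup>2 \<le> (\<Sum>m<n. cmod (f m) * cmod (g m))\<^sup>2"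
      by (intro power_mono) auto
    also have "\<dots> \<le> (\<Sum>m<n. (cmod (f m))\<^sup>2) * (\<Sum>m<n. (cmod (g m))\<^sup>2)"
      by (rule Cauchy_Schwarz_ineq_sum)
    also have "\<dots> \<le> ell2_normsq f * ell2_normsq g"
      unfolding ell2_normsq_def
      by (intro mult_mono sum_le_suminf suminf_nonneg sum_nonneg) (use assms in \<open>auto simp: ell2_def\<close>)
    finally show ?thesis .
  qed
  ultimately show ?thesis by (intro LIMSEQ_le_const2) auto
qed

lemma cmod_diff_square_le: "(cmod (x - y))\<^sup>2 \<le> 2 * (cmod x)\<^sup>2 + 2 * (cmod y)\<^sup>2"
proof -
  have "(cmod (x - y))\<^sup>2 \<le> (cmod x + cmod y)\<^sup>2" by (intro power_mono norm_triangle_ineq4) auto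
  also have "\<dots> \<le> 2 * (cmod x)\<^sup>2 + 2 * (cmod y)\<^sup>2"
    using zero_le_power2[of "cmod x - cmod y"] by (simp add: power2_eq_square algebra_simps)
  finally show ?thesis .
qed

lemma ell2_diff:
  assumes "f \<in> ell2" "g \<in> ell2"
  shows "(\<lambda>m. f m - g m) \<in> ell2"
    "ell2_normsq (\<lambda>m. f m - g m) \<le> 2 * ell2_normsq f + 2 * ell2_normsq g"
proof -
  have s: "summable (\<lambda>m. 2 * (cmod (f m))\<^sup>2 + 2 * (cmod (g m))\<^sup>2)"
    using assms by (auto simp: ell2_def intro!: summable_add summable_mult)
  show 1: "(\<lambda>m. f m - g m) \<in> ell2"
    unfolding ell2_def by (simp, rule summable_comparison_test'[OF s]) (use cmod_diff_square_le in auto)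
  have "ell2_normsq (\<lambda>m. f m - g m) \<le> (\<Sum>m. 2 * (cmod (f m))\<^sup>2 + 2 * (cmod (g m))\<^sup>2)"
    unfolding ell2_normsq_def by (rule suminf_le) (use cmod_diff_square_le s 1 in \<open>auto simp: ell2_def\<close>)
  also have "\<dots> = 2 * ell2_normsq f + 2 * ell2_normsq g"
    unfolding ell2_normsq_def using assms
    by (simp add: ell2_def suminf_mult summable_mult flip: suminf_add)
  finally show "ell2_normsq (\<lambda>m. f m - g m) \<le> 2 * ell2_normsq f + 2 * ell2_normsq g" .
qed

lemma ell2_inner_diff:
  assumes "f \<in> ell2" "g \<in> ell2" "u \<in> ell2"
  shows "ell2_inner (\<lambda>m. f m - g m) u = ell2_inner f u - ell2_inner g u"
  unfolding ell2_inner_def using assms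
  by (simp add: ell2_inner_summable suminf_diff left_diff_distrib)

lemma cutoff:
  assumes "h \<in> ell2"
  shows "cutoff M h \<in> ell2" "ell2_normsq (cutoff M h) = (\<Sum>m<M. (cmod (h m))\<^sup>2)"
    "ell2_inner (cutoff M h) u = (\<Sum>m<M. h m * cnj (u m))"
    "ell2_normsq (cutoff M h) \<le> ell2_normsq h"
proof -
  have z: "cutoff M h m = 0" if "M \<le> m" for m using that by (simp add: cutoff_def)
  show "cutoff M h \<in> ell2" by (rule ell2_finite_support[OF z])
  show n: "ell2_normsq (cutoff M h) = (\<Sum>m<M. (cmod (h m))\<^sup>2)"
    using ell2_finite_support(2)[of M "cutoff M h"] z by (simp add: cutoff_def)
  show "ell2_inner (cutoff M h) u = (\<Sum>m<M. h m * cnj (u m))"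
    using ell2_finite_support(3)[of M "cutoff M h"] z by (simp add: cutoff_def)
  show "ell2_normsq (cutoff M h) \<le> ell2_normsq h"
    unfolding n unfolding ell2_normsq_def using assms by (intro sum_le_suminf) (auto simp: ell2_def)
qed

lemma cutoff_normsq:
  assumes "h \<in> ell2"
  shows "ell2_normsq (\<lambda>m. h m - cutoff M h m) = ell2_normsq h - (\<Sum>m<M. (cmod (h m))\<^sup>2)"
proof -
  have "(\<lambda>m. (cmod (h m - cutoff M h m))\<^sup>2) = (\<lambda>m. (cmod (h m))\<^sup>2 - (if m < M then (cmod (h m))\<^sup>2 else 0))"
    by (auto simp: cutoff_def fun_eq_iff)
  moreover have "(\<lambda>m. if m < M then (cmod (h m))\<^sup>2 else 0) sums (\<Sum>m<M. (cmod (h m))\<^sup>2)"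
    using sums_If_finite_set[of "{..<M}" "\<lambda>m. (cmod (h m))\<^sup>2"] by simp
  ultimately show ?thesis
    unfolding ell2_normsq_def using assms by (simp add: suminf_diff[symmetric] sums_iff ell2_def)
qed

lemma cutoff_tendsto:
  assumes "h \<in> ell2"
  shows "(\<lambda>M. ell2_normsq (\<lambda>m. h m - cutoff M h m)) \<longlonglongrightarrow> 0"
proof -
  have s: "summable (\<lambda>m. (cmod (h m))\<^sup>2)" using assms by (simp add: ell2_def)
  have "(\<lambda>M. ell2_normsq h - (\<Sum>m<M. (cmod (h m))\<^sup>2)) \<longlonglongrightarrow> ell2_normsq h - ell2_normsq h"
    unfolding ell2_normsq_def by (intro tendsto_intros summable_LIMSEQ s)
  then show ?thesis by (simp add: cutoff_normsq[OF assms])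
qed

text \<open>The unit ball lies in a product of discs, which is compact by Tychonoff's theorem and metrizable;
  the limit stays in the ball because each partial sum of squares passes to the limit.\<close>
theorem ell2_weak_compactness:
  fixes h :: "nat \<Rightarrow> nat \<Rightarrow> complex"
  assumes h: "\<And>r. h r \<in> ell2" "\<And>r. ell2_normsq (h r) \<le> 1"
  obtains \<sigma> :: "nat \<Rightarrow> nat" and k where "strict_mono \<sigma>" "k \<in> ell2" "ell2_normsq k \<le> 1"
    "\<And>m. (\<lambda>r. h (\<sigma> r) m) \<longlonglongrightarrow> k m"
proof -
  define X where "X = (\<Pi>\<^sub>E m\<in>(UNIV::nat set). cball (0::complex) 1)"
  have "compactin (product_topology (\<lambda>m::nat. euclidean) UNIV) X"
    unfolding X_def by (subst compactin_PiE) auto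
  then have "compact X" by (simp add: euclidean_product_topology)
  then have "seq_compact X" by (simp add: compact_eq_seq_compact_metric)
  moreover have "\<forall>r. h r \<in> X"
  proof
    fix r
    have "(cmod (h r m))\<^sup>2 \<le> 1" for m
    proof -
      have "(cmod (h r m))\<^sup>2 = (\<Sum>m\<in>{m}. (cmod (h r m))\<^sup>2)" by simp
      also have "\<dots> \<le> ell2_normsq (h r)"
        unfolding ell2_normsq_def using h(1)[of r] by (intro sum_le_suminf) (auto simp: ell2_def)
      finally show ?thesis using h(2)[of r] by simp
    qed
    then show "h r \<in> X" by (auto simp: X_def abs_square_le_1)
  qed
  ultimately obtain k \<sigma> where k: "strict_mono \<sigma>" "((h \<circ> \<sigma>) \<longlongrightarrow> k) sequentially"
    by (metis seq_compactE)
  have lim: "(\<lambda>r. h (\<sigma> r) m) \<longlonglongrightarrow> k m" for m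
  proof -
    have "continuous_on UNIV (\<lambda>f::nat \<Rightarrow> complex. f m)"
      by (rule continuous_on_product_coordinates)
    then have "isCont (\<lambda>f::nat \<Rightarrow> complex. f m) k"
      by (metis UNIV_I continuous_on_eq_continuous_at open_UNIV)
    from isCont_tendsto_compose[OF this k(2)] show ?thesis by (simp add: o_def)
  qed
  have part: "(\<Sum>m<M. (cmod (k m))\<^sup>2) \<le> 1" for M
  proof (rule LIMSEQ_le_const2)
    show "(\<lambda>r. \<Sum>m<M. (cmod (h (\<sigma> r) m))\<^sup>2) \<longlonglongrightarrow> (\<Sum>m<M. (cmod (k m))\<^sup>2)"
      by (intro tendsto_intros lim)
    show "\<exists>N. \<forall>r\<ge>N. (\<Sum>m<M. (cmod (h (\<sigma> r) m))\<^sup>2) \<le> 1"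
      using cutoff(2,4)[OF h(1)] h(2) by (metis order_trans)
  qed
  have "summable (\<lambda>m. (cmod (k m))\<^sup>2)"
    by (rule summableI_nonneg_bounded[of _ 1]) (use part in auto)
  moreover from this have "ell2_normsq k \<le> 1"
    unfolding ell2_normsq_def by (rule suminf_le_const) (use part in auto)
  ultimately show ?thesis using that k(1) lim by (simp add: ell2_def)
qed

text \<open>For bounded sequences coordinatewise convergence is weak convergence: the tail of \<open>u\<close> contributes
  little, uniformly in \<open>r\<close>, by the Cauchy-Schwarz inequality.\<close>
lemma ell2_inner_weak_limit:
  fixes h :: "nat \<Rightarrow> nat \<Rightarrow> complex"
  assumes h: "\<And>r. h r \<in> ell2" "\<And>r. ell2_normsq (h r) \<le> 1"
    and k: "k \<in> ell2" "ell2_normsq k \<le> 1" and lim: "\<And>m. (\<lambda>r. h r m) \<longlonglongrightarrow> k m"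
    and u: "u \<in> ell2"
  shows "(\<lambda>r. ell2_inner (h r) u) \<longlonglongrightarrow> ell2_inner k u"
proof -
  have swap: "ell2_inner f (cutoff M u) = ell2_inner (cutoff M f) u" if "f \<in> ell2" for f M
    unfolding ell2_inner_def by (rule suminf_cong) (simp add: cutoff_def)
  have tail: "(cmod (ell2_inner f u - ell2_inner (cutoff M f) u))\<^sup>2 \<le> ell2_normsq (\<lambda>m. u m - cutoff M u m)"
    if f: "f \<in> ell2" "ell2_normsq f \<le> 1" for f M
  proof -
    have d: "(\<lambda>m. u m - cutoff M u m) \<in> ell2" by (intro ell2_diff cutoff u)
    have "ell2_inner f u - ell2_inner (cutoff M f) u = ell2_inner f (\<lambda>m. u m - cutoff M u m)"
    proof -
      have "ell2_inner f u - ell2_inner f (cutoff M u) = ell2_inner f (\<lambda>m. u m - cutoff M u m)"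
        unfolding ell2_inner_def
        using ell2_inner_summable[OF f(1) u] ell2_inner_summable[OF f(1) cutoff(1)[OF u]]
        by (simp add: suminf_diff right_diff_distrib)
      then show ?thesis by (simp add: swap[OF f(1)])
    qed
    then have "(cmod (ell2_inner f u - ell2_inner (cutoff M f) u))\<^sup>2
        \<le> ell2_normsq f * ell2_normsq (\<lambda>m. u m - cutoff M u m)"
      using ell2_Cauchy_Schwarz[OF f(1) d] by simp
    also have "\<dots> \<le> 1 * ell2_normsq (\<lambda>m. u m - cutoff M u m)"
      by (intro mult_right_mono f ell2_normsq_nonneg d)
    finally show ?thesis by simp
  qed
  show ?thesis
  proof (rule LIMSEQ_I)
    fix e :: real assume e: "0 < e"
    have "eventually (\<lambda>M. ell2_normsq (\<lambda>m. u m - cutoff M u m) < (e / 3)\<^sup>2) sequentially"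
      by (rule order_tendstoD(2)[OF cutoff_tendsto[OF u]]) (use e in simp)
    then obtain M where M: "ell2_normsq (\<lambda>m. u m - cutoff M u m) < (e / 3)\<^sup>2"
      by (auto simp: eventually_sequentially)
    have t: "cmod (ell2_inner f u - ell2_inner (cutoff M f) u) < e / 3"
      if f: "f \<in> ell2" "ell2_normsq f \<le> 1" for f
      by (rule power2_less_imp_less[OF le_less_trans[OF tail[OF f] M]]) (use e in simp)
    have "(\<lambda>r. \<Sum>m<M. h r m * cnj (u m)) \<longlonglongrightarrow> (\<Sum>m<M. k m * cnj (u m))"
      by (intro tendsto_intros lim)
    then have "(\<lambda>r. ell2_inner (cutoff M (h r)) u) \<longlonglongrightarrow> ell2_inner (cutoff M k) u"
      using cutoff(3) h(1) k(1) by simp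
    then have "\<exists>R. \<forall>r\<ge>R. cmod (ell2_inner (cutoff M (h r)) u - ell2_inner (cutoff M k) u) < e / 3"
      by (rule LIMSEQ_D) (use e in simp)
    then obtain R where R: "\<forall>r\<ge>R. cmod (ell2_inner (cutoff M (h r)) u - ell2_inner (cutoff M k) u) < e / 3" ..
    show "\<exists>R. \<forall>r\<ge>R. cmod (ell2_inner (h r) u - ell2_inner k u) < e"
    proof (intro exI[of _ R] allI impI)
      fix r assume "R \<le> r"
      then show "cmod (ell2_inner (h r) u - ell2_inner k u) < e"
      proof -
        let ?A = "ell2_inner (h r) u" and ?B = "ell2_inner (cutoff M (h r)) u"
        let ?C = "ell2_inner (cutoff M k) u" and ?D = "ell2_inner k u"
        assume "R \<le> r"
        have "cmod (?A - ?D) \<le> cmod (?A - ?B) + cmod (?B - ?D)"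
          using norm_triangle_ineq[of "?A - ?B" "?B - ?D"] by simp
        moreover have "cmod (?B - ?D) \<le> cmod (?B - ?C) + cmod (?D - ?C)"
          using norm_triangle_ineq4[of "?B - ?C" "?D - ?C"] by simp
        ultimately show ?thesis
          using t[OF h(1)[of r] h(2)[of r]] t[OF k] R[rule_format, OF \<open>R \<le> r\<close>] by linarith
      qed
    qed
  qed
qed

lemma ell2_frame_bounds:
  assumes "ell2_frame f"
  obtains A B where "0 < A" "A \<le> B" "\<And>k. f k \<in> ell2"
    "\<And>h. h \<in> ell2 \<Longrightarrow> summable (\<lambda>k. (cmod (ell2_inner h (f k)))\<^sup>2)"
    "\<And>h. h \<in> ell2 \<Longrightarrow> A * ell2_normsq h \<le> (\<Sum>k. (cmod (ell2_inner h (f k)))\<^sup>2)"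
    "\<And>h. h \<in> ell2 \<Longrightarrow> (\<Sum>k. (cmod (ell2_inner h (f k)))\<^sup>2) \<le> B * ell2_normsq h"
proof -
  have mem: "\<forall>k. f k \<in> ell2" using assms unfolding ell2_frame_def by (rule conjunct1)
  have "\<exists>A B. 0 < A \<and> A \<le> B \<and> (\<forall>h\<in>ell2. summable (\<lambda>k. (cmod (ell2_inner h (f k)))\<^sup>2) \<and>
          A * (ell2_norm h)\<^sup>2 \<le> (\<Sum>k. (cmod (ell2_inner h (f k)))\<^sup>2) \<and>
          (\<Sum>k. (cmod (ell2_inner h (f k)))\<^sup>2) \<le> B * (ell2_norm h)\<^sup>2)"
    using assms unfolding ell2_frame_def by (rule conjunct2)
  then obtain A B where AB: "0 < A" "A \<le> B" and bounds: "\<forall>h\<in>ell2. summable (\<lambda>k. (cmod (ell2_inner h (f k)))\<^sup>2) \<and>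
          A * (ell2_norm h)\<^sup>2 \<le> (\<Sum>k. (cmod (ell2_inner h (f k)))\<^sup>2) \<and>
          (\<Sum>k. (cmod (ell2_inner h (f k)))\<^sup>2) \<le> B * (ell2_norm h)\<^sup>2"
    by (elim exE conjE)
  show ?thesis
  proof (rule that[OF AB])
    show "f k \<in> ell2" for k using mem ..
    fix h :: "nat \<Rightarrow> complex" assume h: "h \<in> ell2"
    show "summable (\<lambda>k. (cmod (ell2_inner h (f k)))\<^sup>2)"
      "A * ell2_normsq h \<le> (\<Sum>k. (cmod (ell2_inner h (f k)))\<^sup>2)"
      "(\<Sum>k. (cmod (ell2_inner h (f k)))\<^sup>2) \<le> B * ell2_normsq h"
      using bspec[OF bounds h] by (simp_all only: ell2_norm_power2[OF h])
  qed
qed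

section \<open>Gram matrices of the Carleson kernels\<close>

text \<open>The \<open>j\<close>-th subdiagonal entry of the real power \<open>J\<^sup>t\<close> of a Jordan block with eigenvalue \<open>z\<close>.\<close>
definition carleson_kernel :: "nat \<Rightarrow> real \<Rightarrow> real \<Rightarrow> real" where
  "carleson_kernel j z t = (t gchoose j) * z powr (t - real j) * (1 - z\<^sup>2) ^ j"

lemma norm_gbinomial_le:
  fixes x :: "'a::{real_normed_field}"
  shows "norm (x gchoose a) \<le> (1 + norm x) ^ a"
proof -
  have "norm (x gchoose a) = (\<Prod>i<a. norm (x - of_nat i)) / fact a"
    by (simp add: gbinomial_prod_rev norm_divide prod_norm atLeast0LessThan)
  also have "\<dots> \<le> (\<Prod>i<a. real (Suc i) * (1 + norm x)) / fact a"
  proof (intro divide_right_mono prod_mono conjI)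
    fix i
    have "norm (x - of_nat i) \<le> norm x + real i"
      using norm_triangle_ineq4[of x "of_nat i"] by simp
    also have "\<dots> \<le> real (Suc i) * (1 + norm x)" by (simp add: algebra_simps)
    finally show "norm (x - of_nat i) \<le> real (Suc i) * (1 + norm x)" .
  qed auto
  also have "\<dots> = (1 + norm x) ^ a"
  proof -
    have "(\<Prod>i<a. real (Suc i)) = fact a"
      by (simp add: fact_prod_Suc atLeast0LessThan)
    then show ?thesis by (simp add: prod.distrib)
  qed
  finally show ?thesis .
qed

lemma gbinomial_asymptotics: "((\<lambda>x::real. (x gchoose a) / x ^ a) \<longlongrightarrow> 1 / fact a) at_top"
proof -
  have "((\<lambda>x::real. (\<Prod>i<a. 1 - real i / x) / fact a) \<longlongrightarrow> (\<Prod>i<a. 1 - 0) / fact a) at_top"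
    by (intro tendsto_intros tendsto_divide_0[OF tendsto_const] filterlim_at_top_imp_at_infinity filterlim_ident) auto
  moreover have "eventually (\<lambda>x::real. (\<Prod>i<a. 1 - real i / x) / fact a = (x gchoose a) / x ^ a) at_top"
    using eventually_gt_at_top[of 0]
  proof eventually_elim
    case (elim x)
    have "(\<Prod>i<a. 1 - real i / x) = (\<Prod>i<a. (x - real i) / x)"
      using elim by (intro prod.cong) (auto simp: field_simps)
    then show ?case by (simp add: gbinomial_prod_rev atLeast0LessThan prod_dividef)
  qed
  ultimately show ?thesis by (simp add: Lim_transform_eventually)
qed

definition binomial_gram :: "(nat \<Rightarrow> real) \<Rightarrow> nat \<Rightarrow> nat \<Rightarrow> real \<Rightarrow> real" where
  "binomial_gram lam a b S = (\<Sum>k. (lam k gchoose a) * (lam k gchoose b) * exp (- S * lam k))"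

lemma binomial_product_bound:
  assumes "0 \<le> (x::real)"
  shows "\<bar>(x gchoose a) * (x gchoose b)\<bar> \<le> 1 * (1 + x) ^ (a + b)"
proof -
  have "\<bar>x gchoose a\<bar> * \<bar>x gchoose b\<bar> \<le> (1 + x) ^ a * (1 + x) ^ b"
    using norm_gbinomial_le[of x a] norm_gbinomial_le[of x b] assms by (intro mult_mono) auto
  then show ?thesis by (simp add: abs_mult power_add)
qed

lemma binomial_product_asymptotics:
  "((\<lambda>x::real. (x gchoose a) * (x gchoose b) / x ^ (a + b)) \<longlongrightarrow> 1 / fact a * (1 / fact b)) at_top"
  using tendsto_mult[OF gbinomial_asymptotics[of a] gbinomial_asymptotics[of b]]
  by (simp add: power_add)

context regular_growth begin

lemma binomial_gram_summable:
  assumes "0 < S"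
  shows "summable (\<lambda>k. (lam k gchoose a) * (lam k gchoose b) * exp (- S * lam k))"
  using exp_sum_polynomial_bound[OF binomial_product_bound, of S a b] assms
  by (auto intro: summable_rabs_cancel)

text \<open>The Gram sums are of order at most \<open>S\<^bsup>-(a + b + 1)\<^esup>\<close>; one constant serves the finitely many pairs \<open>(a, b)\<close>.\<close>
lemma binomial_gram_bound:
  obtains C where "0 < C"
    "\<And>S a b. 0 < S \<Longrightarrow> S \<le> T \<Longrightarrow> a < N \<Longrightarrow> b < N \<Longrightarrow> S ^ Suc (a + b) * \<bar>binomial_gram lam a b S\<bar> \<le> C"
proof -
  have "\<exists>C. \<forall>S. 0 < S \<longrightarrow> S \<le> T \<longrightarrow> S ^ Suc (a + b) * \<bar>binomial_gram lam a b S\<bar> \<le> C" for a b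
    unfolding binomial_gram_def using exp_sum_polynomial_bound[OF binomial_product_bound, of T a b] by blast
  then have "\<forall>a b. \<exists>C. \<forall>S. 0 < S \<longrightarrow> S \<le> T \<longrightarrow> S ^ Suc (a + b) * \<bar>binomial_gram lam a b S\<bar> \<le> C"
    by blast
  then obtain C where "\<forall>a b. \<forall>S. 0 < S \<longrightarrow> S \<le> T \<longrightarrow> S ^ Suc (a + b) * \<bar>binomial_gram lam a b S\<bar> \<le> C a b"
    unfolding choice_iff by (elim exE)
  then have C: "\<And>a b S. 0 < S \<Longrightarrow> S \<le> T \<Longrightarrow> S ^ Suc (a + b) * \<bar>binomial_gram lam a b S\<bar> \<le> C a b"
    by blast
  define D where "D = (\<Sum>a<N. \<Sum>b<N. \<bar>C a b\<bar>) + 1"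
  have le: "C a b \<le> D" if "a < N" "b < N" for a b
  proof -
    have "C a b \<le> (\<Sum>b<N. \<bar>C a b\<bar>)"
      using that by (intro order_trans[OF _ member_le_sum[of b]]) auto
    also have "\<dots> \<le> (\<Sum>a<N. \<Sum>b<N. \<bar>C a b\<bar>)"
      using that by (intro member_le_sum[of a]) (auto intro: sum_nonneg)
    finally show ?thesis by (simp add: D_def)
  qed
  show ?thesis
  proof (rule that[of D])
    show "0 < D" by (simp add: D_def add_nonneg_pos sum_nonneg)
    show "S ^ Suc (a + b) * \<bar>binomial_gram lam a b S\<bar> \<le> D" if "0 < S" "S \<le> T" "a < N" "b < N" for S a b
      using C[OF that(1,2), of a b] le[OF that(3,4)] by linarith
  qed
qed

end

lemma regular_growth_nat: "regular_growth real 1"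
proof
  show "(\<lambda>k. real k / real (Suc k)) \<longlonglongrightarrow> 1" by real_asymp
qed auto

text \<open>Both sequences obey the Abelian theorem with the same polynomial, so that their limits differ exactly
  by the ratio \<open>1 / \<rho>\<close> of the densities.\<close>
lemma (in regular_growth) binomial_gram_comparison:
  assumes "0 < \<epsilon>"
  obtains S0 where "0 < S0" "\<And>S a b. 0 < S \<Longrightarrow> S \<le> S0 \<Longrightarrow> a < N \<Longrightarrow> b < N \<Longrightarrow>
    S ^ Suc (a + b) * \<bar>binomial_gram lam a b S - 1 / \<rho> * binomial_gram real a b S\<bar> \<le> \<epsilon>"
proof -
  interpret N: regular_growth real 1 by (rule regular_growth_nat)
  have ev: "eventually (\<lambda>S. S ^ Suc (a + b) * \<bar>binomial_gram lam a b S - 1 / \<rho> * binomial_gram real a b S\<bar> \<le> \<epsilon>)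
      (at_right 0)" for a b
  proof -
    define I :: real where "I = 1 / fact a * (1 / fact b) * (LINT x:{0..}|lborel. x ^ (a + b) * exp (- x))"
    have "((\<lambda>S. S ^ Suc (a + b) * binomial_gram lam a b S) \<longlongrightarrow> I / \<rho>) (at_right 0)"
      unfolding binomial_gram_def I_def
      by (rule exp_sum_asymptotics[OF binomial_product_bound binomial_product_asymptotics])
    moreover have "((\<lambda>S. S ^ Suc (a + b) * binomial_gram real a b S) \<longlongrightarrow> I / 1) (at_right 0)"
      unfolding binomial_gram_def I_def
      by (rule N.exp_sum_asymptotics[OF binomial_product_bound binomial_product_asymptotics])
    ultimately have "((\<lambda>S. \<bar>S ^ Suc (a + b) * binomial_gram lam a b S
        - 1 / \<rho> * (S ^ Suc (a + b) * binomial_gram real a b S)\<bar>) \<longlongrightarrow> \<bar>I / \<rho> - 1 / \<rho> * (I / 1)\<bar>) (at_right 0)"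
      by (intro tendsto_intros)
    then have "eventually (\<lambda>S. \<bar>S ^ Suc (a + b) * binomial_gram lam a b S
        - 1 / \<rho> * (S ^ Suc (a + b) * binomial_gram real a b S)\<bar> < \<epsilon>) (at_right 0)"
      by (rule order_tendstoD) (use assms in simp)
    then show ?thesis using eventually_at_right_less[of 0]
    proof eventually_elim
      case (elim S)
      have "S ^ Suc (a + b) * binomial_gram lam a b S - 1 / \<rho> * (S ^ Suc (a + b) * binomial_gram real a b S)
        = S ^ Suc (a + b) * (binomial_gram lam a b S - 1 / \<rho> * binomial_gram real a b S)"
        by (simp add: algebra_simps)
      then show ?case using elim by (simp only: abs_mult abs_of_pos zero_less_power less_imp_le)
    qed
  qed
  have "eventually (\<lambda>S. \<forall>a\<in>{..<N}. \<forall>b\<in>{..<N}.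
      S ^ Suc (a + b) * \<bar>binomial_gram lam a b S - 1 / \<rho> * binomial_gram real a b S\<bar> \<le> \<epsilon>) (at_right 0)"
    by (intro eventually_ball_finite ballI ev) auto
  then obtain S1 where S1: "0 < S1" "\<And>S. 0 < S \<Longrightarrow> S < S1 \<Longrightarrow> \<forall>a\<in>{..<N}. \<forall>b\<in>{..<N}.
      S ^ Suc (a + b) * \<bar>binomial_gram lam a b S - 1 / \<rho> * binomial_gram real a b S\<bar> \<le> \<epsilon>"
    unfolding eventually_at_right_field by auto
  show ?thesis
    by (rule that[of "S1 / 2"]) (use S1 in auto)
qed

text \<open>Products of kernels depend on the exponent \<open>t\<close> only through a polynomial and \<open>exp (- S t)\<close> with
  \<open>S = - ln (x y)\<close>; so the Gram entries are the sums of the Abelian theorem.\<close>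
lemma carleson_kernel_mult:
  assumes "0 < x" "0 < y"
  shows "carleson_kernel a x t * carleson_kernel b y t =
    (1 - x\<^sup>2) ^ a * (1 - y\<^sup>2) ^ b / (x ^ a * y ^ b) * ((t gchoose a) * (t gchoose b) * exp (- (- ln (x * y)) * t))"
proof -
  have "x powr (t - real a) * y powr (t - real b) = exp (ln (x * y) * t) / (x ^ a * y ^ b)"
    using assms by (simp add: powr_diff powr_realpow) (simp add: powr_def ln_mult algebra_simps exp_add)
  moreover have "carleson_kernel a x t * carleson_kernel b y t = (1 - x\<^sup>2) ^ a * (1 - y\<^sup>2) ^ b *
      ((t gchoose a) * (t gchoose b)) * (x powr (t - real a) * y powr (t - real b))"
    by (simp only: carleson_kernel_def mult_ac)
  ultimately show ?thesis by simp
qed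

text \<open>The analytic data of a block diagonal Carleson frame, with one index \<open>m\<close> for each coordinate of \<open>\<ell>\<^sup>2\<close>:
  \<open>\<zeta> m\<close> is the eigenvalue of the block of \<open>m\<close>, and \<open>c m j\<close> is the coordinate \<open>m - j\<close> of the
  generator \<open>g\<close> if it lies in the same block, and 0 otherwise. The assumption \<open>positive_gram\<close> says that the matrix
  \<open>\<surd>(\<omega>\<^sub>m \<omega>\<^sub>l) / (1 - \<zeta>\<^sub>m \<zeta>\<^sub>l)\<close> is bounded on \<open>\<ell>\<^sup>2\<close>; it controls every error term, as all Gram entries are
  dominated by the entries of this matrix.\<close>
locale carleson_system =
  fixes \<zeta> :: "nat \<Rightarrow> real" and c :: "nat \<Rightarrow> nat \<Rightarrow> complex" and N :: nat and C B :: real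
  assumes zeta: "0 < \<zeta> m" "\<zeta> m < 1"
    and coeff_bound: "cmod (c m j) \<le> C * sqrt (1 - (\<zeta> m)\<^sup>2)"
    and B_pos: "0 < B"
    and positive_gram: "(\<And>m. 0 \<le> d m) \<Longrightarrow>
      (\<Sum>m<M. \<Sum>l<M. d m * d l * (sqrt (1 - (\<zeta> m)\<^sup>2) * sqrt (1 - (\<zeta> l)\<^sup>2) / (1 - \<zeta> m * \<zeta> l)))
        \<le> B * (\<Sum>m<M. (d m)\<^sup>2)"
begin

abbreviation \<omega> :: "nat \<Rightarrow> real" where "\<omega> m \<equiv> 1 - (\<zeta> m)\<^sup>2"

definition \<psi> :: "real \<Rightarrow> nat \<Rightarrow> complex" where
  "\<psi> t m = (\<Sum>j<N. c m j * of_real (carleson_kernel j (\<zeta> m) t))"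

lemma omega: "0 < \<omega> m" "\<omega> m \<le> 1"
  using zeta[of m] by (auto simp: abs_square_less_1)

lemma C_nonneg: "0 \<le> C"
proof -
  have "0 \<le> C * sqrt (\<omega> 0)" using norm_ge_zero coeff_bound order_trans by blast
  then show ?thesis using omega(1)[of 0] by (simp add: zero_le_mult_iff)
qed

lemma zeta_prod: "\<zeta> m * \<zeta> l < 1" "0 < \<zeta> m * \<zeta> l"
  using zeta mult_strict_mono'[of "\<zeta> m" 1 "\<zeta> l" 1] by (auto simp: less_imp_le)

text \<open>Testing the matrix on the vector \<open>\<surd>\<omega>\<close>: its entries are at least \<open>\<surd>(\<omega>\<^sub>m \<omega>\<^sub>l)\<close>, whence
  \<open>(\<Sum> \<omega>)\<^sup>2 \<le> B \<Sum> \<omega>\<close> for finite sums.\<close>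
lemma omega_summable: "summable \<omega>"
proof (rule summableI_nonneg_bounded)
  show "0 \<le> \<omega> m" for m using omega[of m] by simp
  show "(\<Sum>m<M. \<omega> m) \<le> B" for M
  proof -
    let ?s = "\<Sum>m<M. \<omega> m"
    have "?s * ?s = (\<Sum>m<M. \<Sum>l<M. sqrt (\<omega> m) * sqrt (\<omega> l) * (sqrt (\<omega> m) * sqrt (\<omega> l) / 1))"
      unfolding sum_product
    proof (intro sum.cong refl)
      fix m l
      have "x * y = sqrt x * sqrt y * (sqrt x * sqrt y / 1)" if "0 \<le> x" "0 \<le> y" for x y :: real
      proof -
        have "sqrt x * sqrt y * (sqrt x * sqrt y / 1) = (sqrt x * sqrt x) * (sqrt y * sqrt y)" by (simp only: mult_ac div_by_1)
        then show ?thesis using that by simp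
      qed
      then show "\<omega> m * \<omega> l = sqrt (\<omega> m) * sqrt (\<omega> l) * (sqrt (\<omega> m) * sqrt (\<omega> l) / 1)"
        using omega(1)[THEN less_imp_le] by blast
    qed
    also have "\<dots> \<le> (\<Sum>m<M. \<Sum>l<M. sqrt (\<omega> m) * sqrt (\<omega> l) * (sqrt (\<omega> m) * sqrt (\<omega> l) / (1 - \<zeta> m * \<zeta> l)))"
    proof (intro sum_mono mult_left_mono divide_left_mono)
      fix m l
      show "0 < 1 * (1 - \<zeta> m * \<zeta> l)" "1 - \<zeta> m * \<zeta> l \<le> 1" using zeta_prod[of m l] by auto
    qed (use omega in \<open>auto simp: less_imp_le\<close>)
    also have "\<dots> \<le> B * (\<Sum>m<M. (sqrt (\<omega> m))\<^sup>2)"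
      by (rule positive_gram) (use omega in \<open>auto simp: less_imp_le\<close>)
    also have "\<dots> = B * ?s" using omega by (simp add: less_imp_le)
    finally have "?s * ?s \<le> B * ?s" .
    moreover have "0 \<le> ?s" using omega by (intro sum_nonneg) (auto simp: less_imp_le)
    ultimately show ?thesis using B_pos by (cases "?s = 0") auto
  qed
qed

lemma zeta_tendsto: "\<zeta> \<longlonglongrightarrow> 1"
proof -
  have "(\<lambda>m. sqrt (1 - \<omega> m)) \<longlonglongrightarrow> sqrt (1 - 0)"
    by (intro tendsto_intros summable_LIMSEQ_zero[OF omega_summable])
  then show ?thesis using zeta by (simp add: less_imp_le)
qed

lemma zeta_lower_bound:
  obtains z0 where "0 < z0" "z0 \<le> 1" "\<And>m. z0 \<le> \<zeta> m"
proof -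
  have "eventually (\<lambda>m. 1 / 2 < \<zeta> m) sequentially" by (rule order_tendstoD[OF zeta_tendsto]) simp
  then obtain K where K: "\<And>m. m \<ge> K \<Longrightarrow> 1 / 2 < \<zeta> m" by (auto simp: eventually_sequentially)
  define z0 where "z0 = Min (insert (1 / 2) (\<zeta> ` {..<K}))"
  show ?thesis
  proof (rule that[of z0])
    show "0 < z0" unfolding z0_def using zeta by (subst Min_gr_iff) auto
    show "z0 \<le> 1" unfolding z0_def by (rule order_trans[OF Min_le[of _ "1/2"]]) auto
    show "z0 \<le> \<zeta> m" for m
    proof (cases "m < K")
      case True
      then show ?thesis unfolding z0_def by (intro Min_le) auto
    next
      case False
      then have "1 / 2 < \<zeta> m" using K by simp
      moreover have "z0 \<le> 1 / 2" unfolding z0_def by (rule Min_le) auto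
      ultimately show ?thesis by simp
    qed
  qed
qed

definition S :: "nat \<Rightarrow> nat \<Rightarrow> real" where "S m l = - ln (\<zeta> m * \<zeta> l)"

lemma S_bounds: "0 < S m l" "1 - \<zeta> m * \<zeta> l \<le> S m l" "\<omega> m \<le> 2 * S m l" "\<omega> l \<le> 2 * S m l"
proof -
  show "0 < S m l" using zeta_prod[of m l] by (simp add: S_def)
  show 1: "1 - \<zeta> m * \<zeta> l \<le> S m l"
    using ln_le_minus_one[OF zeta_prod(2)[of m l]] by (simp add: S_def)
  have "\<omega> m \<le> 2 * (1 - \<zeta> m)" for m
    using zero_le_power2[of "1 - \<zeta> m"] by (simp add: power2_eq_square algebra_simps)
  moreover have "\<zeta> m * \<zeta> l \<le> \<zeta> m" "\<zeta> m * \<zeta> l \<le> \<zeta> l"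
    using zeta[of m] zeta[of l] by (auto simp: mult_le_cancel_left1 mult_le_cancel_right1)
  ultimately show "\<omega> m \<le> 2 * S m l" "\<omega> l \<le> 2 * S m l" using 1
    by (smt (verit))+
qed

definition gram_entry :: "(nat \<Rightarrow> real) \<Rightarrow> nat \<Rightarrow> nat \<Rightarrow> nat \<Rightarrow> nat \<Rightarrow> real" where
  "gram_entry lam a b m l = (\<omega> m) ^ a * (\<omega> l) ^ b / (\<zeta> m ^ a * \<zeta> l ^ b) * binomial_gram lam a b (S m l)"

lemma gram_entry_sums:
  assumes "regular_growth lam \<rho>"
  shows "(\<lambda>k. carleson_kernel a (\<zeta> m) (lam k) * carleson_kernel b (\<zeta> l) (lam k)) sums gram_entry lam a b m l"
proof -
  interpret regular_growth lam \<rho> by fact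
  show ?thesis
    unfolding carleson_kernel_mult[OF zeta(1) zeta(1)] gram_entry_def binomial_gram_def S_def[symmetric]
    by (intro sums_mult summable_sums binomial_gram_summable S_bounds)
qed

text \<open>The factors \<open>\<omega>\<^sup>a\<close> and \<open>\<omega>\<^sup>b\<close> compensate for the powers \<open>S\<^sup>a\<close> and \<open>S\<^sup>b\<close>, as \<open>\<omega> \<le> 2 S\<close>, and the last power of
  \<open>S\<close> becomes the denominator of the positive matrix, as \<open>1 - \<zeta>\<^sub>m \<zeta>\<^sub>l \<le> S\<close>.\<close>
lemma gram_factor_bound:
  assumes z0: "0 < z0" "z0 \<le> 1" "\<And>m. z0 \<le> \<zeta> m" and ab: "a < N" "b < N"
    and x: "(S m l) ^ Suc (a + b) * \<bar>x\<bar> \<le> \<epsilon>"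
  shows "(\<omega> m) ^ a * (\<omega> l) ^ b / (\<zeta> m ^ a * \<zeta> l ^ b) * \<bar>x\<bar> \<le> (2 / z0) ^ (2 * N) * \<epsilon> / (1 - \<zeta> m * \<zeta> l)"
proof -
  let ?S = "S m l"
  have S: "0 < ?S" "1 - \<zeta> m * \<zeta> l \<le> ?S" by (fact S_bounds)+
  have e: "0 \<le> \<epsilon>" using x S by (smt (verit) mult_nonneg_nonneg zero_le_power abs_ge_zero)
  have om: "\<omega> m / \<zeta> m \<le> 2 / z0 * ?S" "\<omega> l / \<zeta> l \<le> 2 / z0 * ?S"
  proof -
    have "\<omega> m / \<zeta> m \<le> 2 * ?S / z0" by (intro frac_le S_bounds z0) (use S in auto)
    then show "\<omega> m / \<zeta> m \<le> 2 / z0 * ?S" by simp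
    have "\<omega> l / \<zeta> l \<le> 2 * ?S / z0" by (intro frac_le S_bounds z0) (use S in auto)
    then show "\<omega> l / \<zeta> l \<le> 2 / z0 * ?S" by simp
  qed
  have nn: "0 \<le> \<omega> m / \<zeta> m" "0 \<le> \<omega> l / \<zeta> l"
    using omega[of m] omega[of l] zeta[of m] zeta[of l] by (auto intro!: divide_nonneg_pos)
  have "(\<omega> m) ^ a * (\<omega> l) ^ b / (\<zeta> m ^ a * \<zeta> l ^ b) = (\<omega> m / \<zeta> m) ^ a * (\<omega> l / \<zeta> l) ^ b"
    by (simp add: power_divide)
  also have "\<dots> \<le> (2 / z0 * ?S) ^ a * (2 / z0 * ?S) ^ b"
    using om nn S z0 by (intro mult_mono power_mono) (auto intro!: mult_nonneg_nonneg zero_le_power)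
  also have "\<dots> = (2 / z0) ^ (a + b) * ?S ^ (a + b)"
    by (simp only: power_mult_distrib power_add mult_ac)
  also have "\<dots> \<le> (2 / z0) ^ (2 * N) * ?S ^ (a + b)"
    using z0 ab S by (intro mult_right_mono power_increasing) auto
  finally have "(\<omega> m) ^ a * (\<omega> l) ^ b / (\<zeta> m ^ a * \<zeta> l ^ b) * \<bar>x\<bar> \<le> (2 / z0) ^ (2 * N) * ?S ^ (a + b) * \<bar>x\<bar>"
    by (rule mult_right_mono) simp
  also have "\<dots> = (2 / z0) ^ (2 * N) * ((?S ^ Suc (a + b) * \<bar>x\<bar>) / ?S)"
    using S by simp
  also have "\<dots> \<le> (2 / z0) ^ (2 * N) * (\<epsilon> / (1 - \<zeta> m * \<zeta> l))"
    using x S z0 e zeta_prod[of m l] by (intro mult_left_mono frac_le) auto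
  finally show ?thesis by simp
qed

definition Q :: "(nat \<Rightarrow> real) \<Rightarrow> (nat \<Rightarrow> complex) \<Rightarrow> real" where
  "Q lam h = (\<Sum>k. (cmod (ell2_inner h (\<psi> (lam k))))\<^sup>2)"

lemma finite_energy_sums:
  assumes "regular_growth lam \<rho>" and h: "\<And>m. M \<le> m \<Longrightarrow> h m = 0"
  shows "(\<lambda>k. of_real ((cmod (ell2_inner h (\<psi> (lam k))))\<^sup>2) :: complex) sums
    (\<Sum>m<M. \<Sum>l<M. \<Sum>a<N. \<Sum>b<N. h m * cnj (c m a) * cnj (h l) * c l b * of_real (gram_entry lam a b m l))"
proof -
  have "of_real ((cmod (ell2_inner h (\<psi> (lam k))))\<^sup>2) = (\<Sum>m<M. \<Sum>l<M. \<Sum>a<N. \<Sum>b<N.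
     h m * cnj (c m a) * cnj (h l) * c l b *
       of_real (carleson_kernel a (\<zeta> m) (lam k) * carleson_kernel b (\<zeta> l) (lam k)))" for k
  proof -
    have i: "ell2_inner h (\<psi> (lam k)) = (\<Sum>m<M. h m * cnj (\<psi> (lam k) m))"
      by (rule ell2_finite_support(3)[OF h])
    have "complex_of_real ((cmod (ell2_inner h (\<psi> (lam k))))\<^sup>2) =
      (\<Sum>m<M. h m * cnj (\<psi> (lam k) m)) * (\<Sum>l<M. cnj (h l) * \<psi> (lam k) l)"
      by (subst complex_norm_square) (simp add: i)
    also have "\<dots> = (\<Sum>m<M. \<Sum>l<M. (h m * cnj (h l)) * (cnj (\<psi> (lam k) m) * \<psi> (lam k) l))"
      by (simp add: sum_product mult_ac)
    also have "\<dots> = (\<Sum>m<M. \<Sum>l<M. \<Sum>a<N. \<Sum>b<N. (h m * cnj (h l)) * (cnj (c m a) * of_real (carleson_kernel a (\<zeta> m) (lam k))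
        * (c l b * of_real (carleson_kernel b (\<zeta> l) (lam k)))))"
    proof -
      have "cnj (\<psi> t m) * \<psi> t l = (\<Sum>a<N. \<Sum>b<N. cnj (c m a) * of_real (carleson_kernel a (\<zeta> m) t)
          * (c l b * of_real (carleson_kernel b (\<zeta> l) t)))" for t m l
      proof -
        have "cnj (\<psi> t m) = (\<Sum>a<N. cnj (c m a) * of_real (carleson_kernel a (\<zeta> m) t))"
          by (simp add: \<psi>_def)
        then show ?thesis by (simp only:) (simp only: \<psi>_def sum_product)
      qed
      then show ?thesis by (simp only: sum_distrib_left)
    qed
    also have "\<dots> = (\<Sum>m<M. \<Sum>l<M. \<Sum>a<N. \<Sum>b<N.
     h m * cnj (c m a) * cnj (h l) * c l b *
       of_real (carleson_kernel a (\<zeta> m) (lam k) * carleson_kernel b (\<zeta> l) (lam k)))"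
      by (intro sum.cong refl) (simp add: mult_ac)
    finally show ?thesis .
  qed
  then show ?thesis
    by (simp only:) (intro sums_sum sums_mult sums_of_real gram_entry_sums[OF assms(1)])
qed

text \<open>If the Gram entries differ by at most \<open>\<delta>\<close> times those of the positive matrix, then the quadratic forms
  differ by at most a multiple of \<open>\<delta>\<close>. The case \<open>L = 0\<close> gives boundedness of the energy; the case of small
  \<open>\<delta>\<close>, for vectors supported far out, gives the comparison with the integers.\<close>
lemma finite_energy_comparison:
  assumes lam: "regular_growth lam \<rho>" and lam': "regular_growth lam' \<rho>'"
    and h: "\<And>m. M \<le> m \<Longrightarrow> h m = 0"
    and est: "\<And>m l a b. h m \<noteq> 0 \<Longrightarrow> h l \<noteq> 0 \<Longrightarrow> a < N \<Longrightarrow> b < N \<Longrightarrow>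
      \<bar>gram_entry lam a b m l - L * gram_entry lam' a b m l\<bar> \<le> \<delta> / (1 - \<zeta> m * \<zeta> l)"
    and \<delta>: "0 \<le> \<delta>"
  shows "\<bar>Q lam h - L * Q lam' h\<bar> \<le> (real N)\<^sup>2 * C\<^sup>2 * B * \<delta> * ell2_normsq h"
proof -
  let ?D = "\<lambda>a b m l. gram_entry lam a b m l - L * gram_entry lam' a b m l"
  have Q: "complex_of_real (Q \<mu> h) =
      (\<Sum>m<M. \<Sum>l<M. \<Sum>a<N. \<Sum>b<N. h m * cnj (c m a) * cnj (h l) * c l b * of_real (gram_entry \<mu> a b m l))"
    if "regular_growth \<mu> \<sigma>" for \<mu> \<sigma>
  proof -
    have s: "(\<lambda>k. of_real ((cmod (ell2_inner h (\<psi> (\<mu> k))))\<^sup>2) :: complex) sums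
      (\<Sum>m<M. \<Sum>l<M. \<Sum>a<N. \<Sum>b<N. h m * cnj (c m a) * cnj (h l) * c l b * of_real (gram_entry \<mu> a b m l))"
      by (rule finite_energy_sums[OF that h])
    have "summable (\<lambda>k. (cmod (ell2_inner h (\<psi> (\<mu> k))))\<^sup>2)"
      using sums_summable[OF s] by (simp only: summable_of_real_iff)
    then have "complex_of_real (Q \<mu> h) = (\<Sum>k. of_real ((cmod (ell2_inner h (\<psi> (\<mu> k))))\<^sup>2))"
      unfolding Q_def by (rule suminf_of_real)
    then show ?thesis using sums_unique[OF s] by simp
  qed
  have "complex_of_real (Q lam h - L * Q lam' h) =
     (\<Sum>m<M. \<Sum>l<M. \<Sum>a<N. \<Sum>b<N. h m * cnj (c m a) * cnj (h l) * c l b * of_real (?D a b m l))"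
    unfolding of_real_diff of_real_mult Q[OF lam] Q[OF lam'] sum_distrib_left sum_subtractf[symmetric]
    by (intro sum.cong refl) (simp add: right_diff_distrib mult_ac)
  then have "cmod (of_real (Q lam h - L * Q lam' h)) =
     cmod (\<Sum>m<M. \<Sum>l<M. \<Sum>a<N. \<Sum>b<N. h m * cnj (c m a) * cnj (h l) * c l b * of_real (?D a b m l))"
    by (rule arg_cong)
  then have "\<bar>Q lam h - L * Q lam' h\<bar> =
     cmod (\<Sum>m<M. \<Sum>l<M. \<Sum>a<N. \<Sum>b<N. h m * cnj (c m a) * cnj (h l) * c l b * of_real (?D a b m l))"
    by (simp only: norm_of_real)
  also have "\<dots> \<le> (\<Sum>m<M. \<Sum>l<M. \<Sum>a<N. \<Sum>b<N.
      C\<^sup>2 * \<delta> * (cmod (h m) * cmod (h l) * (sqrt (\<omega> m) * sqrt (\<omega> l) / (1 - \<zeta> m * \<zeta> l))))"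
  proof (intro sum_norm_le)
    fix m l a b assume ab: "a \<in> {..<N}" "b \<in> {..<N}"
    have h_part: "cmod (h m) * cmod (h l) * \<bar>?D a b m l\<bar> \<le> cmod (h m) * cmod (h l) * (\<delta> / (1 - \<zeta> m * \<zeta> l))"
    proof (cases "h m = 0 \<or> h l = 0")
      case False
      then show ?thesis using est[of m l a b] ab by (intro mult_left_mono) auto
    qed auto
    have c_part: "cmod (c m a) * cmod (c l b) \<le> (C * sqrt (\<omega> m)) * (C * sqrt (\<omega> l))"
      using C_nonneg omega[of m] by (intro mult_mono coeff_bound) (auto simp: less_imp_le)
    have "(cmod (c m a) * cmod (c l b)) * (cmod (h m) * cmod (h l) * \<bar>?D a b m l\<bar>) \<le>
       ((C * sqrt (\<omega> m)) * (C * sqrt (\<omega> l))) * (cmod (h m) * cmod (h l) * (\<delta> / (1 - \<zeta> m * \<zeta> l)))"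
    proof (rule mult_mono[OF c_part h_part])
      show "0 \<le> C * sqrt (\<omega> m) * (C * sqrt (\<omega> l))"
        using C_nonneg omega(1)[THEN less_imp_le] by (intro mult_nonneg_nonneg real_sqrt_ge_zero)
    qed auto
    then show "cmod (h m * cnj (c m a) * cnj (h l) * c l b * of_real (?D a b m l)) \<le>
        C\<^sup>2 * \<delta> * (cmod (h m) * cmod (h l) * (sqrt (\<omega> m) * sqrt (\<omega> l) / (1 - \<zeta> m * \<zeta> l)))"
      by (simp add: norm_mult power2_eq_square mult_ac del: of_real_diff of_real_mult)
  qed
  also have "\<dots> = (real N)\<^sup>2 * C\<^sup>2 * \<delta> * (\<Sum>m<M. \<Sum>l<M.
      cmod (h m) * cmod (h l) * (sqrt (\<omega> m) * sqrt (\<omega> l) / (1 - \<zeta> m * \<zeta> l)))"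
    by (simp add: sum_distrib_left power2_eq_square mult_ac)
  also have "\<dots> \<le> (real N)\<^sup>2 * C\<^sup>2 * \<delta> * (B * (\<Sum>m<M. (cmod (h m))\<^sup>2))"
    using \<delta> by (intro mult_left_mono positive_gram) auto
  also have "(\<Sum>m<M. (cmod (h m))\<^sup>2) = ell2_normsq h"
    by (rule ell2_finite_support(2)[OF h, symmetric])
  finally show ?thesis by (simp add: mult_ac)
qed

lemma gram_entry_diff:
  "\<bar>gram_entry lam a b m l - L * gram_entry lam' a b m l\<bar> =
    (\<omega> m) ^ a * (\<omega> l) ^ b / (\<zeta> m ^ a * \<zeta> l ^ b) * \<bar>binomial_gram lam a b (S m l) - L * binomial_gram lam' a b (S m l)\<bar>"
proof -
  have "0 \<le> (\<omega> m) ^ a * (\<omega> l) ^ b / (\<zeta> m ^ a * \<zeta> l ^ b)"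
    using omega(1)[THEN less_imp_le] zeta(1)[THEN less_imp_le]
    by (intro divide_nonneg_nonneg mult_nonneg_nonneg zero_le_power) auto
  then have "(\<omega> m) ^ a * (\<omega> l) ^ b / (\<zeta> m ^ a * \<zeta> l ^ b) * \<bar>x\<bar> = \<bar>(\<omega> m) ^ a * (\<omega> l) ^ b / (\<zeta> m ^ a * \<zeta> l ^ b) * x\<bar>" for x
    by (simp only: abs_mult abs_of_nonneg)
  then show ?thesis by (simp only: gram_entry_def right_diff_distrib mult.left_commute)
qed

lemma finite_energy_bound:
  assumes "regular_growth lam \<rho>"
  obtains K where "0 \<le> K" "\<And>M h. (\<And>m. M \<le> m \<Longrightarrow> h m = 0) \<Longrightarrow> Q lam h \<le> K * ell2_normsq h"
proof -
  interpret regular_growth lam \<rho> by fact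
  obtain z0 where z0: "0 < z0" "z0 \<le> 1" "\<And>m. z0 \<le> \<zeta> m" using zeta_lower_bound by metis
  have "S m l \<le> - ln (z0 * z0)" for m l
    unfolding S_def using z0 zeta by (simp add: mult_mono less_imp_le)
  moreover obtain D where D: "0 < D"
    "\<And>S a b. 0 < S \<Longrightarrow> S \<le> - ln (z0 * z0) \<Longrightarrow> a < N \<Longrightarrow> b < N \<Longrightarrow> S ^ Suc (a + b) * \<bar>binomial_gram lam a b S\<bar> \<le> D"
    using binomial_gram_bound by metis
  ultimately have est: "\<bar>gram_entry lam a b m l - 0 * gram_entry lam a b m l\<bar> \<le> (2 / z0) ^ (2 * N) * D / (1 - \<zeta> m * \<zeta> l)"
    if "a < N" "b < N" for a b m l
    unfolding gram_entry_diff using that S_bounds(1) by (intro gram_factor_bound[OF z0]) auto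
  show ?thesis
  proof (rule that[of "(real N)\<^sup>2 * C\<^sup>2 * B * ((2 / z0) ^ (2 * N) * D)"])
    show "0 \<le> (real N)\<^sup>2 * C\<^sup>2 * B * ((2 / z0) ^ (2 * N) * D)"
      using B_pos D z0 by (intro mult_nonneg_nonneg) auto
    fix M and h :: "nat \<Rightarrow> complex" assume h: "\<And>m. M \<le> m \<Longrightarrow> h m = (0::complex)"
    have "\<bar>Q lam h - 0 * Q lam h\<bar> \<le> (real N)\<^sup>2 * C\<^sup>2 * B * ((2 / z0) ^ (2 * N) * D) * ell2_normsq h"
      by (rule finite_energy_comparison[OF assms assms h est]) (use D z0 in auto)
    then show "Q lam h \<le> (real N)\<^sup>2 * C\<^sup>2 * B * ((2 / z0) ^ (2 * N) * D) * ell2_normsq h" by simp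
  qed
qed

text \<open>Far out, \<open>\<zeta>\<close> is close to 1, all exponents \<open>S m l\<close> are small, and the Gram entries over \<open>lam\<close> are close
  to \<open>1 / \<rho>\<close> times those over the integers.\<close>
lemma tail_energy_comparison:
  assumes "regular_growth lam \<rho>" "0 < \<epsilon>"
  obtains M0 where "\<And>M h. (\<And>m. M \<le> m \<Longrightarrow> h m = 0) \<Longrightarrow> (\<And>m. m < M0 \<Longrightarrow> h m = 0) \<Longrightarrow>
    \<bar>Q lam h - 1 / \<rho> * Q real h\<bar> \<le> \<epsilon> * ell2_normsq h"
proof -
  interpret regular_growth lam \<rho> by fact
  obtain z0 where z0: "0 < z0" "z0 \<le> 1" "\<And>m. z0 \<le> \<zeta> m" using zeta_lower_bound by metis
  \<comment> \<open>Adding 1 keeps \<open>K\<close> positive, as \<open>C\<close> may be 0.\<close>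
  define K where "K = (real N)\<^sup>2 * C\<^sup>2 * B * (2 / z0) ^ (2 * N) + 1"
  have K: "0 < K" unfolding K_def using B_pos z0 by (intro add_nonneg_pos mult_nonneg_nonneg) auto
  define \<eta> where "\<eta> = \<epsilon> / K"
  have \<eta>: "0 < \<eta>" using K assms by (simp add: \<eta>_def)
  \<comment> \<open>\<open>\<eta>\<close> makes up for the constant of \<open>finite_energy_comparison\<close>\<close>
  obtain S0 where S0: "0 < S0" "\<And>S a b. 0 < S \<Longrightarrow> S \<le> S0 \<Longrightarrow> a < N \<Longrightarrow> b < N \<Longrightarrow>
    S ^ Suc (a + b) * \<bar>binomial_gram lam a b S - 1 / \<rho> * binomial_gram real a b S\<bar> \<le> \<eta>"
    using binomial_gram_comparison[OF \<eta>] by metis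
  have "eventually (\<lambda>m. exp (- S0 / 2) < \<zeta> m) sequentially"
    by (rule order_tendstoD[OF zeta_tendsto]) (use S0 in simp)
  then obtain M0 where M0: "\<And>m. m \<ge> M0 \<Longrightarrow> exp (- S0 / 2) < \<zeta> m" by (auto simp: eventually_sequentially)
  have S_le: "S m l \<le> S0" if "m \<ge> M0" "l \<ge> M0" for m l
  proof -
    have "exp (- S0) = exp (- S0 / 2) * exp (- S0 / 2)" by (simp flip: exp_add)
    also have "\<dots> \<le> \<zeta> m * \<zeta> l" using M0[OF that(1)] M0[OF that(2)] zeta(1)[of m] by (intro mult_mono) auto
    finally have "- S0 \<le> ln (\<zeta> m * \<zeta> l)" using zeta_prod by (simp add: ln_ge_iff)
    then show ?thesis by (simp add: S_def)
  qed
  show ?thesis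
  proof (rule that[of M0])
    fix M and h :: "nat \<Rightarrow> complex" assume h: "\<And>m. M \<le> m \<Longrightarrow> h m = (0::complex)" "\<And>m. m < M0 \<Longrightarrow> h m = 0"
    have "\<bar>Q lam h - 1 / \<rho> * Q real h\<bar> \<le> (real N)\<^sup>2 * C\<^sup>2 * B * ((2 / z0) ^ (2 * N) * \<eta>) * ell2_normsq h"
    proof (rule finite_energy_comparison[OF assms(1) regular_growth_nat h(1)])
      fix m l a b assume "h m \<noteq> 0" "h l \<noteq> 0" and ab: "a < N" "b < N"
      then have "m \<ge> M0" "l \<ge> M0" using h(2) by (auto simp: not_less[symmetric])
      then show "\<bar>gram_entry lam a b m l - 1 / \<rho> * gram_entry real a b m l\<bar> \<le> (2 / z0) ^ (2 * N) * \<eta> / (1 - \<zeta> m * \<zeta> l)"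
        unfolding gram_entry_diff using ab S_bounds(1) by (intro gram_factor_bound[OF z0] S0(2) S_le) auto
    qed (use z0 \<eta> in auto)
    also have "\<dots> = (K - 1) * \<eta> * ell2_normsq h" by (simp add: K_def mult_ac)
    also have "\<dots> \<le> \<epsilon> * ell2_normsq h"
    proof (rule mult_right_mono)
      show "(K - 1) * \<eta> \<le> \<epsilon>" using K \<eta> by (simp add: \<eta>_def field_simps)
      show "0 \<le> ell2_normsq h" by (intro ell2_normsq_nonneg ell2_finite_support(1)[OF h(1)])
    qed
    finally show "\<bar>Q lam h - 1 / \<rho> * Q real h\<bar> \<le> \<epsilon> * ell2_normsq h" .
  qed
qed

end

section \<open>Energy bounds on the whole space\<close>

text \<open>The holomorphic extension of \<open>carleson_kernel\<close> in the exponent, with coinciding values on the real line.\<close>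
definition complex_kernel :: "nat \<Rightarrow> real \<Rightarrow> complex \<Rightarrow> complex" where
  "complex_kernel j z t = (t gchoose j) * of_real z powr (t - of_nat j) * of_real ((1 - z\<^sup>2) ^ j)"

lemma of_real_gbinomial: "of_real (t gchoose j) = (of_real t gchoose j :: complex)"
  by (simp add: gbinomial_prod_rev)

lemma complex_kernel_of_real:
  assumes "0 < z"
  shows "complex_kernel j z (of_real t) = of_real (carleson_kernel j z t)"
proof -
  have "complex_of_real z powr (of_real t - of_nat j) = of_real (z powr (t - real j))"
    using assms by (simp add: powr_of_real[symmetric])
  then show ?thesis by (simp add: complex_kernel_def carleson_kernel_def of_real_gbinomial)
qed

lemma complex_kernel_norm:
  assumes z: "0 < z0" "z0 \<le> z" "z < 1" and N: "j < N" and t: "- T \<le> Re t" "0 \<le> T"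
  shows "norm (complex_kernel j z t) \<le> (1 + norm t) ^ j * z0 powr (- (T + real N))"
proof -
  have "norm (complex_of_real z powr (t - of_nat j)) = z powr (Re t - real j)"
    using z by (subst norm_powr_real_powr) auto
  also have "\<dots> \<le> z powr (- (T + real N))"
    using z t N by (intro powr_mono') auto
  also have "\<dots> \<le> z0 powr (- (T + real N))"
    using z t by (intro powr_mono2') auto
  finally have "norm (complex_of_real z powr (t - of_nat j)) \<le> z0 powr (- (T + real N))" .
  moreover have "z\<^sup>2 \<le> 1" using z by (simp add: power_le_one abs_square_le_1)
  then have "norm (complex_of_real ((1 - z\<^sup>2) ^ j)) \<le> 1"
    unfolding norm_of_real using z by (simp add: power_abs power_le_one)
  ultimately have "norm (complex_kernel j z t) \<le> (1 + norm t) ^ j * z0 powr (- (T + real N)) * 1"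
    unfolding complex_kernel_def norm_mult by (intro mult_mono norm_gbinomial_le) auto
  then show ?thesis by simp
qed

lemma complex_kernel_holomorphic:
  assumes "0 < z"
  shows "complex_kernel j z holomorphic_on A"
  unfolding complex_kernel_def gbinomial_prod_rev
  by (intro holomorphic_intros) (use assms in auto)

context carleson_system begin

text \<open>The coefficients contribute the factor \<open>\<surd>\<omega>\<close>, which is square summable; hence \<open>\<psi> t\<close> lies in \<open>\<ell>\<^sup>2\<close>.\<close>
lemma psi_bound:
  obtains K where "0 \<le> K" "\<And>m. cmod (\<psi> t m) \<le> K * sqrt (\<omega> m)"
proof -
  obtain z0 where z0: "0 < z0" "z0 \<le> 1" "\<And>m. z0 \<le> \<zeta> m" using zeta_lower_bound by metis
  let ?K = "\<Sum>j<N. C * ((1 + norm (complex_of_real t)) ^ j * z0 powr (- (\<bar>t\<bar> + real N)))"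
  show ?thesis
  proof (rule that[of ?K])
    show "0 \<le> ?K" using C_nonneg by (intro sum_nonneg) auto
    show "cmod (\<psi> t m) \<le> ?K * sqrt (\<omega> m)" for m
      unfolding \<psi>_def sum_distrib_right
    proof (intro sum_norm_le)
      fix j assume j: "j \<in> {..<N}"
      have "norm (complex_kernel j (\<zeta> m) (of_real t)) \<le> (1 + norm (complex_of_real t)) ^ j * z0 powr (- (\<bar>t\<bar> + real N))"
        by (rule complex_kernel_norm) (use z0 zeta j in auto)
      then have "cmod (c m j) * norm (complex_kernel j (\<zeta> m) (of_real t))
          \<le> (C * sqrt (\<omega> m)) * ((1 + norm (complex_of_real t)) ^ j * z0 powr (- (\<bar>t\<bar> + real N)))"
        using C_nonneg omega(1)[of m] by (intro mult_mono coeff_bound) auto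
      then show "cmod (c m j * of_real (carleson_kernel j (\<zeta> m) t))
          \<le> C * ((1 + norm (complex_of_real t)) ^ j * z0 powr (- (\<bar>t\<bar> + real N))) * sqrt (\<omega> m)"
        unfolding norm_mult complex_kernel_of_real[OF zeta(1)] by (simp only: mult_ac)
    qed
  qed
qed

lemma psi_ell2: "\<psi> t \<in> ell2"
proof -
  obtain K where K: "0 \<le> K" "\<And>m. cmod (\<psi> t m) \<le> K * sqrt (\<omega> m)" using psi_bound by metis
  have "summable (\<lambda>m. (cmod (\<psi> t m))\<^sup>2)"
  proof (rule summable_comparison_test')
    show "summable (\<lambda>m. K\<^sup>2 * \<omega> m)" by (intro summable_mult omega_summable)
    fix m
    have "(cmod (\<psi> t m))\<^sup>2 \<le> (K * sqrt (\<omega> m))\<^sup>2" by (intro power_mono K) auto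
    then show "norm ((cmod (\<psi> t m))\<^sup>2) \<le> K\<^sup>2 * \<omega> m"
      using omega(1)[of m] by (simp add: power_mult_distrib)
  qed
  then show ?thesis by (simp add: ell2_def)
qed

lemma inner_cutoff_tendsto:
  assumes "h \<in> ell2"
  shows "(\<lambda>M. ell2_inner (cutoff M h) (\<psi> t)) \<longlonglongrightarrow> ell2_inner h (\<psi> t)"
  unfolding cutoff(3)[OF assms] unfolding ell2_inner_def
  by (intro summable_LIMSEQ ell2_inner_summable assms psi_ell2)

text \<open>The bound for finitely supported vectors passes to the limit in each partial sum of the energy.\<close>
theorem energy_bound:
  assumes "regular_growth lam \<rho>"
  obtains K where "0 \<le> K" "\<And>h. h \<in> ell2 \<Longrightarrow> summable (\<lambda>k. (cmod (ell2_inner h (\<psi> (lam k))))\<^sup>2)"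
    "\<And>h. h \<in> ell2 \<Longrightarrow> Q lam h \<le> K * ell2_normsq h"
proof -
  obtain K where K: "0 \<le> K" "\<And>M h. (\<And>m. M \<le> m \<Longrightarrow> h m = 0) \<Longrightarrow> Q lam h \<le> K * ell2_normsq h"
    using finite_energy_bound[OF assms] by metis
  have part: "(\<Sum>k<n. (cmod (ell2_inner h (\<psi> (lam k))))\<^sup>2) \<le> K * ell2_normsq h" if h: "h \<in> ell2" for h n
  proof (rule LIMSEQ_le_const2)
    show "(\<lambda>M. \<Sum>k<n. (cmod (ell2_inner (cutoff M h) (\<psi> (lam k))))\<^sup>2)
        \<longlonglongrightarrow> (\<Sum>k<n. (cmod (ell2_inner h (\<psi> (lam k))))\<^sup>2)"
      by (intro tendsto_intros inner_cutoff_tendsto h)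
    have "(\<Sum>k<n. (cmod (ell2_inner (cutoff M h) (\<psi> (lam k))))\<^sup>2) \<le> K * ell2_normsq h" for M
    proof -
      have z: "\<And>m. M \<le> m \<Longrightarrow> cutoff M h m = 0" by (simp add: cutoff_def)
      have "summable (\<lambda>k. (cmod (ell2_inner (cutoff M h) (\<psi> (lam k))))\<^sup>2)"
        using sums_summable[OF finite_energy_sums[OF assms z]] by (simp only: summable_of_real_iff)
      then have "(\<Sum>k<n. (cmod (ell2_inner (cutoff M h) (\<psi> (lam k))))\<^sup>2) \<le> Q lam (cutoff M h)"
        unfolding Q_def by (intro sum_le_suminf) auto
      also have "\<dots> \<le> K * ell2_normsq (cutoff M h)" by (rule K(2)[OF z])
      also have "\<dots> \<le> K * ell2_normsq h" by (intro mult_left_mono cutoff(4) h K)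
      finally show ?thesis .
    qed
    then show "\<exists>M0. \<forall>M\<ge>M0. (\<Sum>k<n. (cmod (ell2_inner (cutoff M h) (\<psi> (lam k))))\<^sup>2) \<le> K * ell2_normsq h" by blast
  qed
  have sm: "summable (\<lambda>k. (cmod (ell2_inner h (\<psi> (lam k))))\<^sup>2)" if "h \<in> ell2" for h
    by (rule summableI_nonneg_bounded[of _ "K * ell2_normsq h"]) (use part[OF that] in auto)
  show ?thesis
  proof (rule that[OF K(1) sm])
    show "Q lam h \<le> K * ell2_normsq h" if "h \<in> ell2" for h
      unfolding Q_def by (rule suminf_le_const[OF sm[OF that] part[OF that]])
  qed
qed

lemma energy_summable:
  assumes "regular_growth lam \<rho>" "h \<in> ell2"
  shows "summable (\<lambda>k. (cmod (ell2_inner h (\<psi> (lam k))))\<^sup>2)"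
  using energy_bound[OF assms(1)] assms(2) by blast

lemma energy_diff:
  assumes "regular_growth lam \<rho>" "f \<in> ell2" "g \<in> ell2"
  shows "Q lam (\<lambda>m. f m - g m) \<le> 2 * Q lam f + 2 * Q lam g"
proof -
  note s = energy_summable[OF assms(1)]
  have "Q lam (\<lambda>m. f m - g m) \<le> (\<Sum>k. 2 * (cmod (ell2_inner f (\<psi> (lam k))))\<^sup>2 + 2 * (cmod (ell2_inner g (\<psi> (lam k))))\<^sup>2)"
    unfolding Q_def
  proof (rule suminf_le)
    show "(cmod (ell2_inner (\<lambda>m. f m - g m) (\<psi> (lam k))))\<^sup>2 \<le>
       2 * (cmod (ell2_inner f (\<psi> (lam k))))\<^sup>2 + 2 * (cmod (ell2_inner g (\<psi> (lam k))))\<^sup>2" for k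
      unfolding ell2_inner_diff[OF assms(2,3) psi_ell2] by (rule cmod_diff_square_le)
  qed (intro s summable_add summable_mult ell2_diff assms)+
  also have "\<dots> = 2 * Q lam f + 2 * Q lam g"
    unfolding Q_def using s[OF assms(2)] s[OF assms(3)]
    by (simp add: suminf_add[symmetric] suminf_mult summable_mult)
  finally show ?thesis .
qed

text \<open>Finitely supported vectors inherit half of the lower bound of the integers, divided by \<open>\<rho>\<close>. The further
  factor 2 is lost in the quasi-triangle inequality of \<open>energy_diff\<close>, when a vector is cut off.\<close>
lemma tail_lower_bound:
  assumes "regular_growth lam \<rho>" "0 < A" and A: "\<And>h. h \<in> ell2 \<Longrightarrow> A * ell2_normsq h \<le> Q real h"
  obtains M0 where "\<And>h. h \<in> ell2 \<Longrightarrow> (\<And>m. m < M0 \<Longrightarrow> h m = 0) \<Longrightarrow> A / (4 * \<rho>) * ell2_normsq h \<le> Q lam h"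
proof -
  have \<rho>: "0 < \<rho>" using assms(1) by (simp add: regular_growth_def)
  obtain K where K: "0 \<le> K" "\<And>h. h \<in> ell2 \<Longrightarrow> Q lam h \<le> K * ell2_normsq h"
    using energy_bound[OF assms(1)] by metis
  have "0 < A / (2 * \<rho>)" using assms \<rho> by simp
  then obtain M0 where M0: "\<And>M h. (\<And>m. M \<le> m \<Longrightarrow> h m = 0) \<Longrightarrow> (\<And>m. m < M0 \<Longrightarrow> h m = 0) \<Longrightarrow>
    \<bar>Q lam h - 1 / \<rho> * Q real h\<bar> \<le> A / (2 * \<rho>) * ell2_normsq h"
    using tail_energy_comparison[OF assms(1)] by metis
  show ?thesis
  proof (rule that)
    fix h assume h: "h \<in> ell2" "\<And>m. m < M0 \<Longrightarrow> h m = 0"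
    have le: "A / (2 * \<rho>) * (\<Sum>m<M. (cmod (h m))\<^sup>2) \<le> 2 * Q lam h + 2 * (K * ell2_normsq (\<lambda>m. h m - cutoff M h m))" for M
    proof -
      let ?f = "cutoff M h" and ?g = "\<lambda>m. h m - cutoff M h m"
      have f: "?f \<in> ell2" and g: "?g \<in> ell2" by (intro cutoff h ell2_diff)+
      have "\<bar>Q lam ?f - 1 / \<rho> * Q real ?f\<bar> \<le> A / (2 * \<rho>) * ell2_normsq ?f"
        by (rule M0[where M = M]) (use h(2) in \<open>auto simp: cutoff_def\<close>)
      moreover have "1 / \<rho> * (A * ell2_normsq ?f) \<le> 1 / \<rho> * Q real ?f"
        using \<rho> by (intro mult_left_mono A f) auto
      moreover have "1 / \<rho> * (A * ell2_normsq ?f) = A / (2 * \<rho>) * ell2_normsq ?f + A / (2 * \<rho>) * ell2_normsq ?f"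
        using \<rho> by (simp add: field_simps)
      ultimately have "A / (2 * \<rho>) * ell2_normsq ?f \<le> Q lam ?f" by linarith
      also have "Q lam ?f = Q lam (\<lambda>m. h m - ?g m)" by simp
      also have "\<dots> \<le> 2 * Q lam h + 2 * Q lam ?g" by (rule energy_diff[OF assms(1) h(1) g])
      also have "\<dots> \<le> 2 * Q lam h + 2 * (K * ell2_normsq ?g)" using K(2)[OF g] by simp
      finally show ?thesis by (simp add: cutoff(2)[OF h(1)])
    qed
    have "A / (2 * \<rho>) * ell2_normsq h \<le> 2 * Q lam h + 2 * (K * 0)"
    proof (rule LIMSEQ_le)
      show "(\<lambda>M. A / (2 * \<rho>) * (\<Sum>m<M. (cmod (h m))\<^sup>2)) \<longlonglongrightarrow> A / (2 * \<rho>) * ell2_normsq h"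
        unfolding ell2_normsq_def using h(1) by (intro tendsto_intros summable_LIMSEQ) (simp add: ell2_def)
      show "(\<lambda>M. 2 * Q lam h + 2 * (K * ell2_normsq (\<lambda>m. h m - cutoff M h m))) \<longlonglongrightarrow> 2 * Q lam h + 2 * (K * 0)"
        by (intro tendsto_intros cutoff_tendsto h)
    qed (use le in blast)
    then show "A / (4 * \<rho>) * ell2_normsq h \<le> Q lam h" by simp
  qed
qed

text \<open>The function \<open>t \<mapsto> \<langle>h, \<psi> t\<rangle>\<close> extends to a holomorphic function on \<open>Re t > -1\<close> by replacing each kernel with
  its complex extension. It grows at most like \<open>|t|\<^sup>N\<close>, so that division by \<open>(t + 2)\<^sup>N\<close> makes it bounded, and its
  zeros \<open>lam k\<close> are too dense for the Blaschke condition.\<close>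
lemma zero_on_sequence_imp_zero:
  assumes "regular_growth lam \<rho>" "inj lam" and h: "h \<in> ell2"
    and zero: "\<And>k. ell2_inner h (\<psi> (lam k)) = 0" and t: "- 1 < t"
  shows "ell2_inner h (\<psi> t) = 0"
proof -
  interpret regular_growth lam \<rho> by fact
  obtain U where U: "0 < U" "\<And>k. lam k \<le> U * real (Suc k)" using linear_upper_bound by metis
  obtain z0 where z0: "0 < z0" "z0 \<le> 1" "\<And>m. z0 \<le> \<zeta> m" using zeta_lower_bound by metis
  define H where "H = {s. - 1 < Re s}"
  define \<phi> where "\<phi> = (\<lambda>m s. h m * (\<Sum>j<N. cnj (c m j) * complex_kernel j (\<zeta> m) s) / (s + 2) ^ N)"
  \<comment> \<open>\<open>4\<close> comes from \<open>1 + |s| \<le> 4 |s + 2|\<close>, and \<open>1 + N\<close> bounds \<open>j - Re s\<close>\<close>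
  define W where "W = real N * (C * (4 ^ N * z0 powr (- (1 + real N))))"
  define F where "F = (\<lambda>s. \<Sum>m. \<phi> m s)"
  have real: "\<phi> m (of_real r) = h m * cnj (\<psi> r m) / (of_real r + 2) ^ N" for m r
    by (simp add: \<phi>_def \<psi>_def complex_kernel_of_real[OF zeta(1)])
  have F_real: "F (of_real r) = ell2_inner h (\<psi> r) / (of_real r + 2) ^ N" for r
    unfolding F_def real ell2_inner_def
    by (rule suminf_divide[OF ell2_inner_summable[OF h psi_ell2]])
  have bound: "norm (\<phi> m s) \<le> cmod (h m) * sqrt (\<omega> m) * W" if s: "s \<in> H" for m s
  proof -
    have "1 \<le> Re (s + 2)" using s by (simp add: H_def)
    then have one: "1 \<le> norm (s + 2)" using complex_Re_le_cmod[of "s + 2"] by linarith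
    have "norm s \<le> norm (s + 2) + norm (2::complex)" using norm_triangle_ineq4[of "s + 2" 2] by simp
    then have le4: "1 + norm s \<le> 4 * norm (s + 2)" using one by simp
    have "norm (\<Sum>j<N. cnj (c m j) * complex_kernel j (\<zeta> m) s) \<le>
        (\<Sum>j<N. (C * sqrt (\<omega> m)) * (4 ^ N * norm (s + 2) ^ N * z0 powr (- (1 + real N))))"
    proof (intro sum_norm_le)
      fix j assume j: "j \<in> {..<N}"
      have "norm (complex_kernel j (\<zeta> m) s) \<le> (1 + norm s) ^ j * z0 powr (- (1 + real N))"
        by (rule complex_kernel_norm) (use z0 zeta j s in \<open>auto simp: H_def\<close>)
      also have "\<dots> \<le> (4 * norm (s + 2)) ^ N * z0 powr (- (1 + real N))"
      proof (rule mult_right_mono)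
        have "(1 + norm s) ^ j \<le> (4 * norm (s + 2)) ^ j" by (intro power_mono le4) simp
        also have "\<dots> \<le> (4 * norm (s + 2)) ^ N"
          using one j by (intro power_increasing) auto
        finally show "(1 + norm s) ^ j \<le> (4 * norm (s + 2)) ^ N" .
      qed simp
      also have "(4 * norm (s + 2)) ^ N = 4 ^ N * norm (s + 2) ^ N" by (rule power_mult_distrib)
      finally have "norm (complex_kernel j (\<zeta> m) s) \<le> 4 ^ N * norm (s + 2) ^ N * z0 powr (- (1 + real N))" .
      then show "norm (cnj (c m j) * complex_kernel j (\<zeta> m) s) \<le> (C * sqrt (\<omega> m)) * (4 ^ N * norm (s + 2) ^ N * z0 powr (- (1 + real N)))"
        unfolding norm_mult complex_mod_cnj using C_nonneg omega(1)[of m] by (intro mult_mono coeff_bound) auto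
    qed
    then have "norm (\<phi> m s) \<le> cmod (h m) * (real N * ((C * sqrt (\<omega> m)) * (4 ^ N * norm (s + 2) ^ N * z0 powr (- (1 + real N))))) / norm (s + 2) ^ N"
      unfolding \<phi>_def norm_divide norm_mult norm_power by (intro divide_right_mono mult_left_mono) auto
    also have "\<dots> = cmod (h m) * sqrt (\<omega> m) * W"
    proof -
      have "norm (s + 2) ^ N \<noteq> 0" using one by auto
      then show ?thesis by (simp add: W_def)
    qed
    finally show ?thesis .
  qed
  have sm: "summable (\<lambda>m. cmod (h m) * sqrt (\<omega> m) * W)"
  proof -
    have "(\<lambda>m. complex_of_real (sqrt (\<omega> m))) \<in> ell2"
      using omega_summable omega(1)[THEN less_imp_le] by (simp add: ell2_def)
    from ell2_summable_mult[OF h this] show ?thesis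
      using omega(1)[THEN less_imp_le] by (intro summable_mult2) simp
  qed
  have unif: "uniform_limit H (\<lambda>n s. \<Sum>m<n. \<phi> m s) F sequentially"
    unfolding F_def by (rule Weierstrass_m_test[OF bound sm])
  have openH: "open H" unfolding H_def by (rule open_halfspace_Re_gt)
  have hol: "F holomorphic_on H"
  proof (rule holomorphic_uniform_sequence[OF openH])
    show "(\<lambda>s. \<Sum>m<n. \<phi> m s) holomorphic_on H" for n
      unfolding \<phi>_def
    proof (intro holomorphic_intros complex_kernel_holomorphic zeta)
      fix s assume "s \<in> H"
      then have "s + 2 \<noteq> 0" by (auto simp: H_def complex_eq_iff)
      then show "(s + 2) ^ N \<noteq> 0" by simp
    qed
    fix s assume "s \<in> H"
    then obtain d where d: "0 < d" "cball s d \<subseteq> H" using openH unfolding open_contains_cball by blast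
    have "uniform_limit (cball s d) (\<lambda>n s. \<Sum>m<n. \<phi> m s) F sequentially"
      by (rule uniform_limit_on_subset[OF unif d(2)])
    with d show "\<exists>d>0. cball s d \<subseteq> H \<and> uniform_limit (cball s d) (\<lambda>n s. \<Sum>m<n. \<phi> m s) F sequentially"
      by blast
  qed
  have bd: "norm (F s) \<le> (\<Sum>m. cmod (h m) * sqrt (\<omega> m) * W)" if "- 1 < Re s" for s
    unfolding F_def by (rule norm_suminf_le[OF bound sm]) (use that in \<open>simp add: H_def\<close>)
  have "F (of_real t) = 0"
    by (rule half_plane_uniqueness[OF hol[unfolded H_def] bd lam_nonneg assms(2) U(2)])
       (use t zero in \<open>auto simp: F_real\<close>)
  moreover have "complex_of_real t + 2 \<noteq> 0" using t by (auto simp: complex_eq_iff)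
  ultimately show ?thesis by (simp add: F_real)
qed

lemma energy_scale:
  assumes "regular_growth lam \<rho>" "h \<in> ell2"
  shows "(\<lambda>m. of_real a * h m) \<in> ell2" "ell2_normsq (\<lambda>m. of_real a * h m) = a\<^sup>2 * ell2_normsq h"
    "Q lam (\<lambda>m. of_real a * h m) = a\<^sup>2 * Q lam h"
proof -
  have s: "summable (\<lambda>m. (cmod (h m))\<^sup>2)" using assms(2) by (simp add: ell2_def)
  show "(\<lambda>m. of_real a * h m) \<in> ell2"
    using summable_mult[OF s, of "a\<^sup>2"] by (simp add: ell2_def norm_mult power_mult_distrib)
  show "ell2_normsq (\<lambda>m. of_real a * h m) = a\<^sup>2 * ell2_normsq h"
    unfolding ell2_normsq_def using suminf_mult[OF s, of "a\<^sup>2"] by (simp add: norm_mult power_mult_distrib)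
  have i: "ell2_inner (\<lambda>m. of_real a * h m) (\<psi> t) = of_real a * ell2_inner h (\<psi> t)" for t
    unfolding ell2_inner_def using suminf_mult[OF ell2_inner_summable[OF assms(2) psi_ell2], of "of_real a"]
    by (simp add: mult.assoc)
  show "Q lam (\<lambda>m. of_real a * h m) = a\<^sup>2 * Q lam h"
    unfolding Q_def i using suminf_mult[OF energy_summable[OF assms], of "a\<^sup>2"]
    by (simp add: norm_mult power_mult_distrib)
qed

lemma Q_nonneg: "regular_growth lam \<rho> \<Longrightarrow> h \<in> ell2 \<Longrightarrow> 0 \<le> Q lam h"
  unfolding Q_def by (intro suminf_nonneg energy_summable) auto

lemma inner_le_Q:
  assumes "regular_growth lam \<rho>" "h \<in> ell2"
  shows "(cmod (ell2_inner h (\<psi> (lam k))))\<^sup>2 \<le> Q lam h"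
proof -
  have "(cmod (ell2_inner h (\<psi> (lam k))))\<^sup>2 = (\<Sum>k\<in>{k}. (cmod (ell2_inner h (\<psi> (lam k))))\<^sup>2)" by simp
  also have "\<dots> \<le> Q lam h" unfolding Q_def by (intro sum_le_suminf energy_summable[OF assms]) auto
  finally show ?thesis .
qed

text \<open>Unit vectors of vanishing energy have a weak limit with energy 0, which is 0 because \<open>\<langle>k, \<psi> t\<rangle>\<close>
  vanishes first on \<open>lam\<close> and then on the integers. So their first coordinates tend to 0, and
  the energy of the remaining part violates \<open>tail_lower_bound\<close>.\<close>
theorem energy_lower_bound:
  assumes reg: "regular_growth lam \<rho>" "inj lam" "0 < A" and A: "\<And>h. h \<in> ell2 \<Longrightarrow> A * ell2_normsq h \<le> Q real h"
  shows "\<exists>A'>0. \<forall>h\<in>ell2. A' * ell2_normsq h \<le> Q lam h"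
proof (rule ccontr)
  assume no: "\<not> ?thesis"
  have \<rho>: "0 < \<rho>" using reg(1) by (simp add: regular_growth_def)
  obtain K where K: "0 \<le> K" "\<And>h. h \<in> ell2 \<Longrightarrow> Q lam h \<le> K * ell2_normsq h"
    using energy_bound[OF reg(1)] by metis
  obtain M0 where M0: "\<And>h. h \<in> ell2 \<Longrightarrow> (\<And>m. m < M0 \<Longrightarrow> h m = 0) \<Longrightarrow> A / (4 * \<rho>) * ell2_normsq h \<le> Q lam h"
    using tail_lower_bound[OF reg(1,3) A] by metis
  have "\<exists>h\<in>ell2. ell2_normsq h = 1 \<and> Q lam h \<le> 1 / real (Suc r)" for r
  proof -
    have "0 < 1 / real (Suc r)" by simp
    then obtain h where h: "h \<in> ell2" "Q lam h < 1 / real (Suc r) * ell2_normsq h"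
      using no by (meson not_less)
    have pos: "0 < ell2_normsq h"
    proof (rule ccontr)
      assume "\<not> 0 < ell2_normsq h"
      then have "1 / real (Suc r) * ell2_normsq h \<le> 0" by (intro mult_nonneg_nonpos) auto
      then show False using h(2) Q_nonneg[OF reg(1) h(1)] by linarith
    qed
    \<comment> \<open>normalization to a unit vector\<close>
    define a where "a = 1 / sqrt (ell2_normsq h)"
    have a2: "a\<^sup>2 = 1 / ell2_normsq h" using pos by (simp add: a_def power_divide)
    note sc = energy_scale[OF reg(1) h(1), of a]
    show ?thesis
    proof (intro bexI[OF _ sc(1)] conjI)
      show "ell2_normsq (\<lambda>m. of_real a * h m) = 1" unfolding sc(2) a2 using pos by simp
      show "Q lam (\<lambda>m. of_real a * h m) \<le> 1 / real (Suc r)"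
        unfolding sc(3) a2 using pos h(2) by (simp add: pos_divide_le_eq del: of_nat_Suc)
    qed
  qed
  then obtain f where f: "\<And>r. f r \<in> ell2" "\<And>r. ell2_normsq (f r) = 1" "\<And>r. Q lam (f r) \<le> 1 / real (Suc r)"
    by metis
  obtain \<sigma> k where \<sigma>: "strict_mono \<sigma>" and k: "k \<in> ell2" "ell2_normsq k \<le> 1" and lim: "\<And>m. (\<lambda>r. f (\<sigma> r) m) \<longlonglongrightarrow> k m"
    using ell2_weak_compactness[of f] f(1,2) by (metis order_refl)
  have Q0: "(\<lambda>r. Q lam (f (\<sigma> r))) \<longlonglongrightarrow> 0"
  proof (rule tendsto_sandwich[OF _ _ tendsto_const])
    show "(\<lambda>r. 1 / real (Suc (\<sigma> r))) \<longlonglongrightarrow> 0"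
      using LIMSEQ_subseq_LIMSEQ[OF LIMSEQ_inverse_real_of_nat \<sigma>] by (simp add: o_def inverse_eq_divide del: of_nat_Suc)
  qed (use f Q_nonneg[OF reg(1)] in auto)
  have zero: "ell2_inner k (\<psi> (lam j)) = 0" for j
  proof -
    have "(\<lambda>r. ell2_inner (f (\<sigma> r)) (\<psi> (lam j))) \<longlonglongrightarrow> ell2_inner k (\<psi> (lam j))"
      by (rule ell2_inner_weak_limit[OF _ _ k lim psi_ell2]) (use f in auto)
    then have "(\<lambda>r. (cmod (ell2_inner (f (\<sigma> r)) (\<psi> (lam j))))\<^sup>2) \<longlonglongrightarrow> (cmod (ell2_inner k (\<psi> (lam j))))\<^sup>2"
      by (intro tendsto_intros)
    then have "(cmod (ell2_inner k (\<psi> (lam j))))\<^sup>2 \<le> 0"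
      by (rule LIMSEQ_le[OF _ Q0]) (use inner_le_Q[OF reg(1) f(1)] in auto)
    then show ?thesis by simp
  qed
  have "ell2_inner k (\<psi> (real j)) = 0" for j
    by (rule zero_on_sequence_imp_zero[OF reg(1,2) k(1) zero]) simp
  then have "Q real k = 0" by (simp add: Q_def)
  then have "A * ell2_normsq k \<le> 0" using A[OF k(1)] by simp
  then have "ell2_normsq k \<le> 0" using reg(3) by (simp add: mult_le_0_iff)
  then have k0: "k m = 0" for m using ell2_eq_zero[OF k(1)] by blast
  define u where "u = (\<lambda>r. \<Sum>m<M0. (cmod (f (\<sigma> r) m))\<^sup>2)"
  have u: "u \<longlonglongrightarrow> 0"
  proof -
    have "u \<longlonglongrightarrow> (\<Sum>m<M0. (cmod (k m))\<^sup>2)" unfolding u_def by (intro tendsto_intros lim)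
    then show ?thesis by (simp add: k0)
  qed
  have le: "A / (4 * \<rho>) * (1 - u r) \<le> 2 * Q lam (f (\<sigma> r)) + 2 * (K * u r)" for r
  proof -
    let ?f = "f (\<sigma> r)"
    let ?g = "\<lambda>m. ?f m - cutoff M0 ?f m"
    have c: "cutoff M0 ?f \<in> ell2" "ell2_normsq (cutoff M0 ?f) = u r" using cutoff(1,2)[OF f(1)] by (auto simp: u_def)
    have "ell2_normsq ?g = 1 - u r" using cutoff_normsq[OF f(1)] by (simp add: f(2) u_def)
    then have "A / (4 * \<rho>) * (1 - u r) = A / (4 * \<rho>) * ell2_normsq ?g" by simp
    also have "\<dots> \<le> Q lam ?g"
    proof (rule M0)
      show "?g \<in> ell2" by (intro ell2_diff f c)
    qed (simp add: cutoff_def)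
    also have "\<dots> \<le> 2 * Q lam ?f + 2 * Q lam (cutoff M0 ?f)" by (rule energy_diff[OF reg(1) f(1) c(1)])
    also have "\<dots> \<le> 2 * Q lam ?f + 2 * (K * u r)" using K(2)[OF c(1)] c(2) by simp
    finally show ?thesis .
  qed
  have "A / (4 * \<rho>) * (1 - 0) \<le> 2 * 0 + 2 * (K * 0)"
  proof (rule LIMSEQ_le)
    show "(\<lambda>r. A / (4 * \<rho>) * (1 - u r)) \<longlonglongrightarrow> A / (4 * \<rho>) * (1 - 0)" by (intro tendsto_intros u)
    show "(\<lambda>r. 2 * Q lam (f (\<sigma> r)) + 2 * (K * u r)) \<longlonglongrightarrow> 2 * 0 + 2 * (K * 0)" by (intro tendsto_intros u Q0)
  qed (use le in blast)
  moreover have "0 < A / (4 * \<rho>)" using reg(3) \<rho> by simp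
  ultimately show False by simp
qed

end

section \<open>Powers of block diagonal operators\<close>

definition block_offset :: "(nat \<Rightarrow> nat) \<Rightarrow> nat \<Rightarrow> nat" where
  "block_offset n m = m - block_start n (block_index n m)"

lemma block_start_Suc: "block_start n (Suc i) = block_start n i + n i"
  by (simp add: block_start_def)

lemma sum_blocks: "(\<Sum>m<block_start n M. f m) = (\<Sum>i<M. \<Sum>j<n i. f (block_start n i + j))"
proof (induction M)
  case (Suc M)
  have "(\<Sum>m<b + k. f m) = (\<Sum>m<b. f m) + (\<Sum>j<k. f (b + j))" for b k
    by (induction k) (auto simp: add.assoc)
  then show ?case using Suc by (simp add: block_start_Suc)
qed (simp add: block_start_def)

lemma block_decomposition:
  assumes "\<And>i. 0 < n i"
  obtains i j where "j < n i" "m = block_start n i + j"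
proof -
  have ge: "i \<le> block_start n i" for i
  proof (induction i)
    case (Suc i)
    then show ?case using assms[of i] by (simp add: block_start_Suc)
  qed simp
  have "\<exists>i j. j < n i \<and> m = block_start n i + j" if "m < block_start n M" for M
    using that
  proof (induction M)
    case (Suc M)
    show ?case
    proof (cases "m < block_start n M")
      case False
      then show ?thesis using Suc.prems
        by (intro exI[of _ M] exI[of _ "m - block_start n M"]) (auto simp: block_start_Suc)
    qed (use Suc.IH in blast)
  qed (simp add: block_start_def)
  from this[of "Suc m"] ge[of "Suc m"] that show ?thesis by fastforce
qed

lemma block_position:
  assumes "\<And>i. 0 < n i"
  shows "block_offset n m < n (block_index n m)" "m = block_start n (block_index n m) + block_offset n m"
proof -
  obtain i j where ij: "j < n i" "m = block_start n i + j" using block_decomposition[of n m] assms by blast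
  then have "block_index n m = i" using block_index_eq[of j n i] by simp
  then show "block_offset n m < n (block_index n m)" "m = block_start n (block_index n m) + block_offset n m"
    using ij by (auto simp: block_offset_def)
qed

lemma block_offset_eq: "j < n i \<Longrightarrow> block_offset n (block_start n i + j) = j"
  by (simp add: block_offset_def block_index_eq)

lemma block_predecessor:
  assumes "\<And>i. 0 < n i" "0 < block_offset n m"
  shows "block_index n (m - 1) = block_index n m" "block_offset n (m - 1) = block_offset n m - 1"
proof -
  let ?i = "block_index n m" and ?j = "block_offset n m - 1"
  have "?j < n ?i" "m - 1 = block_start n ?i + ?j"
    using block_position[where n = n and m = m] assms by auto
  then show "block_index n (m - 1) = ?i" "block_offset n (m - 1) = ?j"
    using block_index_eq[of ?j n ?i] block_offset_eq[of ?j n ?i] by simp_all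
qed

text \<open>Both \<open>J\<close> and its powers have lower triangular Toeplitz blocks, so that one convolution formula serves
  for both. A term \<open>m - j\<close> with \<open>j \<le> block_offset n m\<close> stays in the block of \<open>m\<close>.\<close>
lemma block_diagonal_toeplitz:
  assumes n: "\<And>i. 0 < n i"
    and A: "\<And>i. A i = Matrix.mat (n i) (n i) (\<lambda>(p, l). if l \<le> p then a i (p - l) else 0)"
  shows "block_diagonal n A f m = (\<Sum>j\<le>block_offset n m. a (block_index n m) j * f (m - j))"
proof -
  let ?i = "block_index n m" and ?q = "block_offset n m"
  note pos = block_position[where n = n and m = m, OF n]
  have "block_diagonal n A f m = (\<Sum>l<n ?i. (if l \<le> ?q then a ?i (?q - l) else 0) * f (block_start n ?i + l))"
    unfolding block_diagonal_def Let_def block_offset_def[symmetric] using pos(1)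
    by (simp add: A scalar_prod_def block_component_def atLeast0LessThan)
  also have "\<dots> = (\<Sum>l\<le>?q. a ?i (?q - l) * f (block_start n ?i + l))"
    using pos(1) by (intro sum.mono_neutral_cong_right) auto
  also have "\<dots> = (\<Sum>j\<le>?q. a ?i j * f (m - j))"
  proof (rule sum.reindex_bij_witness[of _ "\<lambda>j. ?q - j" "\<lambda>l. ?q - l"])
    fix l assume "l \<in> {..?q}"
    moreover have "m - (?q - l) = block_start n ?i + l" if "l \<le> ?q" using pos(2) that by linarith
    ultimately show "a ?i (?q - l) * f (m - (?q - l)) = a ?i (?q - l) * f (block_start n ?i + l)" by simp
  qed auto
  finally show ?thesis .
qed

lemma carleson_op_apply:
  assumes n: "\<And>i. 0 < n i"
  shows "carleson_op n z f m = z (block_index n m) * f m +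
    (if 0 < block_offset n m then (1 - of_real ((cmod (z (block_index n m)))\<^sup>2)) * f (m - 1) else 0)"
proof -
  let ?w = "\<lambda>i. 1 - of_real ((cmod (z i))\<^sup>2)"
  define a where "a = (\<lambda>i j::nat. if j = 0 then z i else if j = 1 then ?w i else 0)"
  have A: "carleson_block (n i) (z i) = Matrix.mat (n i) (n i) (\<lambda>(p, l). if l \<le> p then a i (p - l) else 0)" for i
    unfolding carleson_block_def by (intro cong_mat refl) (auto simp: a_def)
  have "carleson_op n z f m = (\<Sum>j\<le>block_offset n m. a (block_index n m) j * f (m - j))"
    unfolding carleson_op_def by (rule block_diagonal_toeplitz[OF n A])
  also have "\<dots> = (\<Sum>j\<in>{..block_offset n m} \<inter> {0, 1}. a (block_index n m) j * f (m - j))"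
    by (intro sum.mono_neutral_right) (auto simp: a_def)
  also have "\<dots> = z (block_index n m) * f m + (if 0 < block_offset n m then ?w (block_index n m) * f (m - 1) else 0)"
  proof (cases "block_offset n m = 0")
    case False
    then have "{..block_offset n m} \<inter> {0, 1} = {0, 1}" by auto
    then show ?thesis using False by (simp add: a_def)
  qed (simp add: a_def)
  finally show ?thesis .
qed

lemma subdiag_mat_power:
  assumes "p < n" "l < n"
  shows "index_mat (pow_mat (subdiag_mat n) j) (p, l) = (if p = l + j then 1 else 0)"
  using assms
proof (induction j arbitrary: l)
  case 0
  then show ?case by (simp add: subdiag_mat_def)
next
  case (Suc j)
  have dim: "pow_mat (subdiag_mat n) j \<in> carrier_mat n n"
    by (intro pow_carrier_mat) (simp add: subdiag_mat_def)
  have "index_mat (pow_mat (subdiag_mat n) (Suc j)) (p, l) =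
     (\<Sum>r<n. index_mat (pow_mat (subdiag_mat n) j) (p, r) * (if r = Suc l then 1 else 0))"
    using dim Suc.prems by (auto simp: scalar_prod_def subdiag_mat_def atLeast0LessThan intro!: sum.cong)
  also have "\<dots> = (\<Sum>r<n. if r = Suc l then (if p = r + j then 1 else 0) else 0)"
    using Suc by (intro sum.cong) auto
  also have "\<dots> = (if p = l + Suc j then 1 else 0)"
    using Suc.prems by auto
  finally show ?case .
qed

text \<open>The vector \<open>J\<^sup>t g\<close> in coordinates, for a real exponent \<open>t\<close> and real eigenvalues \<open>x i\<close>. For natural \<open>t\<close> it agrees with
  the iterates of \<open>J\<close>, so that integer and noninteger powers are treated alike.\<close>
definition orbit :: "(nat \<Rightarrow> nat) \<Rightarrow> (nat \<Rightarrow> real) \<Rightarrow> (nat \<Rightarrow> complex) \<Rightarrow> real \<Rightarrow> nat \<Rightarrow> complex" where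
  "orbit n x g t m = (\<Sum>j\<le>block_offset n m. of_real (carleson_kernel j (x (block_index n m)) t) * g (m - j))"

lemma carleson_op_powr_eq_orbit:
  assumes n: "\<And>i. 0 < n i" and x: "\<And>i. 0 < x i"
  shows "carleson_op_powr n (\<lambda>i. of_real (x i)) (of_real t) g = orbit n x g t"
proof
  fix m
  define a where "a = (\<lambda>i j. complex_of_real (carleson_kernel j (x i) t))"
  have A: "carleson_block_powr (n i) (of_real (x i)) (of_real t) =
    Matrix.mat (n i) (n i) (\<lambda>(p, l). if l \<le> p then a i (p - l) else 0)" for i
    unfolding carleson_block_powr_def
  proof (intro cong_mat refl)
    fix p l assume pl: "p < n i" "l < n i"
    let ?c = "\<lambda>j. (of_real t gchoose j) * of_real (x i) powr (of_real t - of_nat j) * (1 - of_real ((cmod (of_real (x i)))\<^sup>2)) ^ j :: complex"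
    have c: "?c j = a i j" for j
      unfolding a_def complex_kernel_of_real[OF x, symmetric] complex_kernel_def by simp
    have "(\<Sum>j<n i. ?c j * index_mat (pow_mat (subdiag_mat (n i)) j) (p, l)) = (\<Sum>j<n i. if p = l + j then a i j else 0)"
      by (intro sum.cong refl) (simp only: subdiag_mat_power[OF pl] c, simp)
    also have "\<dots> = (if l \<le> p then a i (p - l) else 0)"
    proof (cases "l \<le> p")
      case True
      then have "(\<Sum>j<n i. if p = l + j then a i j else 0) = (\<Sum>j<n i. if j = p - l then a i j else 0)"
        by (intro sum.cong) auto
      then show ?thesis using True pl by simp
    qed auto
    finally show "(case (p, l) of (p, l) \<Rightarrow> \<Sum>j<n i. ?c j * index_mat (pow_mat (subdiag_mat (n i)) j) (p, l)) =
      (case (p, l) of (p, l) \<Rightarrow> if l \<le> p then a i (p - l) else 0)" by simp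
  qed
  show "carleson_op_powr n (\<lambda>i. of_real (x i)) (of_real t) g m = orbit n x g t m"
    unfolding carleson_op_powr_def block_diagonal_toeplitz[OF n A] by (simp add: orbit_def a_def)
qed

lemma carleson_kernel_zero: "0 < z \<Longrightarrow> carleson_kernel j z 0 = (if j = 0 then 1 else 0)"
  by (cases j) (auto simp: carleson_kernel_def)

lemma carleson_kernel_Suc:
  assumes "0 < z"
  shows "carleson_kernel (Suc j) z (t + 1) = z * carleson_kernel (Suc j) z t + (1 - z\<^sup>2) * carleson_kernel j z t"
proof -
  have 1: "z powr (t + 1 - real (Suc j)) = z * z powr (t - real (Suc j))"
    using assms by (simp add: powr_mult_base algebra_simps)
  have 2: "z powr (t - real j) = z * z powr (t - real (Suc j))"
    using assms by (simp add: powr_mult_base algebra_simps)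
  show ?thesis
    unfolding carleson_kernel_def gbinomial_Suc_Suc 1 2 by (simp add: algebra_simps)
qed

lemma carleson_kernel_0_plus1: "0 < z \<Longrightarrow> carleson_kernel 0 z (t + 1) = z * carleson_kernel 0 z t"
  by (simp add: carleson_kernel_def powr_mult_base add.commute)

text \<open>Applying \<open>J\<close> once more raises the exponent by 1; this is Pascal's rule for the kernels.\<close>
lemma orbit_step:
  assumes n: "\<And>i. 0 < n i" and x: "\<And>i. 0 < x i"
  shows "orbit n x g (t + 1) m = of_real (x (block_index n m)) * orbit n x g t m +
    (if 0 < block_offset n m then of_real (1 - (x (block_index n m))\<^sup>2) * orbit n x g t (m - 1) else 0)"
proof (cases "block_offset n m")
  case 0
  then show ?thesis by (simp add: orbit_def carleson_kernel_0_plus1[OF x])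
next
  case (Suc q)
  let ?i = "block_index n m"
  have pred: "block_index n (m - 1) = ?i" "block_offset n (m - 1) = q"
    using block_predecessor[where n = n and m = m, OF n] Suc by auto
  let ?K = "\<lambda>j t. complex_of_real (carleson_kernel j (x ?i) t)"
  have "orbit n x g (t + 1) m = ?K 0 (t + 1) * g m + (\<Sum>j\<le>q. ?K (Suc j) (t + 1) * g (m - Suc j))"
    unfolding orbit_def Suc by (subst sum.atMost_Suc_shift) simp
  also have "\<dots> = of_real (x ?i) * (?K 0 t * g m + (\<Sum>j\<le>q. ?K (Suc j) t * g (m - Suc j))) +
      of_real (1 - (x ?i)\<^sup>2) * (\<Sum>j\<le>q. ?K j t * g (m - 1 - j))"
    unfolding carleson_kernel_0_plus1[OF x] carleson_kernel_Suc[OF x]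
    by (simp add: sum_distrib_left sum.distrib[symmetric] algebra_simps)
  also have "?K 0 t * g m + (\<Sum>j\<le>q. ?K (Suc j) t * g (m - Suc j)) = orbit n x g t m"
    unfolding orbit_def Suc by (subst sum.atMost_Suc_shift) simp
  also have "(\<Sum>j\<le>q. ?K j t * g (m - 1 - j)) = orbit n x g t (m - 1)"
    unfolding orbit_def pred ..
  finally show ?thesis using Suc by simp
qed

lemma carleson_op_power_eq_orbit:
  assumes n: "\<And>i. 0 < n i" and x: "\<And>i. 0 < x i"
  shows "(carleson_op n (\<lambda>i. of_real (x i)) ^^ k) g = orbit n x g (real k)"
proof (induction k)
  case 0
  have "orbit n x g 0 m = g m" for m
    unfolding orbit_def carleson_kernel_zero[OF x] by (simp add: if_distrib[of "\<lambda>y. of_real y * _"] cong: if_cong)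
  then show ?case by auto
next
  case (Suc k)
  have "carleson_op n (\<lambda>i. of_real (x i)) (orbit n x g (real k)) m = orbit n x g (real k + 1) m" for m
    unfolding carleson_op_apply[OF n] orbit_step[OF n x] by simp
  then show ?case using Suc by (auto simp: add.commute)
qed

text \<open>The last basis vector of a block is an eigenvector.\<close>
lemma block_value_in_point_spectrum:
  assumes n: "\<And>i. 0 < n i"
  shows "z i \<in> point_spectrum (carleson_op n z)"
proof -
  define p where "p = block_start n i + (n i - 1)"
  define f :: "nat \<Rightarrow> complex" where "f = (\<lambda>m. if m = p then 1 else 0)"
  have p: "block_index n p = i" unfolding p_def by (rule block_index_eq) (use n[of i] in simp)
  have "carleson_op n z f m = z i * f m" for m
  proof (cases "m = p")
    case True
    moreover have "block_offset n p \<le> p" by (simp add: block_offset_def)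
    ultimately show ?thesis unfolding carleson_op_apply[OF n] using p by (auto simp: f_def)
  next
    case False
    have "m - 1 \<noteq> p" if "0 < block_offset n m"
    proof
      assume "m - 1 = p"
      moreover have "0 < m" using that by (simp add: block_offset_def)
      ultimately have "m = block_start n (Suc i) + 0" using n[of i] by (simp add: p_def block_start_Suc)
      then show False using that block_offset_eq[of 0 n "Suc i"] n[of "Suc i"] by simp
    qed
    then show ?thesis unfolding carleson_op_apply[OF n] using False by (auto simp: f_def)
  qed
  moreover have "f \<in> ell2" by (rule ell2_finite_support(1)[of "Suc p"]) (simp add: f_def)
  moreover have "f \<noteq> (\<lambda>m. 0)" by (auto simp: f_def fun_eq_iff)
  ultimately show ?thesis unfolding point_spectrum_def by (auto intro!: bexI[of _ f])
qed

section \<open>Consequences of the frame property of the integer orbit\<close>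

text \<open>The hypothesis that the integer orbit is a frame, for real eigenvalues in \<open>(0, 1)\<close>.\<close>
locale orbit_frame =
  fixes n :: "nat \<Rightarrow> nat" and x :: "nat \<Rightarrow> real" and g :: "nat \<Rightarrow> complex"
    and N :: nat and A B :: real
  assumes n_pos: "0 < n i" and n_le: "n i \<le> N"
    and x: "0 < x i" "x i < 1"
    and A_pos: "0 < A" and A_le: "A \<le> B"
    and frame_summable: "h \<in> ell2 \<Longrightarrow> summable (\<lambda>k. (cmod (ell2_inner h (orbit n x g (real k))))\<^sup>2)"
    and frame_lower: "h \<in> ell2 \<Longrightarrow> A * ell2_normsq h \<le> (\<Sum>k. (cmod (ell2_inner h (orbit n x g (real k))))\<^sup>2)"
    and frame_upper: "h \<in> ell2 \<Longrightarrow> (\<Sum>k. (cmod (ell2_inner h (orbit n x g (real k))))\<^sup>2) \<le> B * ell2_normsq h"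
begin

definition xi :: "nat \<Rightarrow> real" where "xi m = x (block_index n m)"

definition w :: "nat \<Rightarrow> real" where "w i = 1 - (x i)\<^sup>2"

lemma w: "0 < w i" "w i \<le> 1"
  using x[of i] by (auto simp: w_def abs_square_less_1)

lemma B_pos: "0 < B" using A_pos A_le by simp

definition unit :: "nat \<Rightarrow> nat \<Rightarrow> complex" where "unit p = (\<lambda>m. if m = p then 1 else 0)"

lemma unit: "unit p \<in> ell2" "ell2_normsq (unit p) = 1" "ell2_inner (unit p) f = cnj (f p)"
proof -
  have z: "\<And>m. Suc p \<le> m \<Longrightarrow> unit p m = 0" by (simp add: unit_def)
  show "unit p \<in> ell2" by (rule ell2_finite_support(1)[OF z])
  show "ell2_normsq (unit p) = 1"
  proof -
    have "ell2_normsq (unit p) = (\<Sum>m<Suc p. (cmod (unit p m))\<^sup>2)" by (rule ell2_finite_support(2)[OF z])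
    also have "\<dots> = 1" unfolding sum.lessThan_Suc by (subst sum.neutral) (auto simp: unit_def)
    finally show ?thesis .
  qed
  show "ell2_inner (unit p) f = cnj (f p)"
  proof -
    have "ell2_inner (unit p) f = (\<Sum>m<Suc p. unit p m * cnj (f m))" by (rule ell2_finite_support(3)[OF z])
    also have "\<dots> = cnj (f p)" unfolding sum.lessThan_Suc by (subst sum.neutral) (auto simp: unit_def)
    finally show ?thesis .
  qed
qed

lemma geometric_sum: "0 < y \<Longrightarrow> y < 1 \<Longrightarrow> (\<lambda>k. y ^ k) sums (1 / (1 - y :: real))"
  by (rule geometric_sums) simp

lemma block_start_pos: "block_index n (block_start n i) = i" "block_offset n (block_start n i) = 0"
  using block_index_eq[of 0 n i] block_offset_eq[of 0 n i] n_pos[of i] by simp_all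

lemma orbit_block_start: "orbit n x g t (block_start n i) = of_real (x i powr t) * g (block_start n i)"
  by (simp add: orbit_def block_start_pos carleson_kernel_def)

text \<open>On the first basis vector of a block the frame coefficients are a geometric
  sequence, with energy \<open>|g|\<^sup>2 / w\<close>.\<close>
lemma block_start_lower: "A * w i \<le> (cmod (g (block_start n i)))\<^sup>2"
proof -
  have x2: "0 < (x i)\<^sup>2" "(x i)\<^sup>2 < 1" using x[of i] by (auto simp: abs_square_less_1)
  have t: "(cmod (ell2_inner (unit (block_start n i)) (orbit n x g (real k))))\<^sup>2 =
      ((x i)\<^sup>2) ^ k * (cmod (g (block_start n i)))\<^sup>2" for k
    unfolding unit(3) orbit_block_start complex_mod_cnj norm_mult power_mult_distrib norm_of_real power2_abs
    using x(1)[of i] by (simp add: powr_realpow power_mult[symmetric] mult.commute)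
  have "(\<lambda>k. ((x i)\<^sup>2) ^ k * (cmod (g (block_start n i)))\<^sup>2) sums (1 / (1 - (x i)\<^sup>2) * (cmod (g (block_start n i)))\<^sup>2)"
    by (intro sums_mult2 geometric_sum x2)
  then have "A * 1 \<le> 1 / w i * (cmod (g (block_start n i)))\<^sup>2"
    using frame_lower[OF unit(1), of "block_start n i"] unfolding t unit(2) w_def by (simp only: sums_iff)
  then show ?thesis using w(1)[of i] by (simp add: field_simps)
qed

text \<open>Let \<open>a\<^sub>m(k)\<close> be the coordinate \<open>m\<close> of \<open>J\<^sup>k g\<close>. The frame bound at the unit vector \<open>m\<close> gives
  \<open>\<Sum>\<^sub>k |a\<^sub>m(k)|\<^sup>2 \<le> B\<close>. The generating value \<open>S\<^sub>m = \<Sum>\<^sub>k a\<^sub>m(k) \<xi>\<^sup>k\<close> is then at most \<open>\<surd>(B / \<omega>)\<close> by Cauchy-Schwarz. The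
  recursion \<open>a\<^sub>m(k + 1) = \<xi> a\<^sub>m(k) + \<omega> a\<^sub>m\<^sub>-\<^sub>1(k)\<close> gives \<open>g m = a\<^sub>m(0) = \<omega> S\<^sub>m - \<xi> \<omega> S\<^sub>m\<^sub>-\<^sub>1\<close>, the second
  term being absent at the start of a block.\<close>
lemma generator_upper: "cmod (g m) \<le> 2 * sqrt B * sqrt (1 - (xi m)\<^sup>2)"
proof -
  let ?i = "block_index n m"
  let ?\<omega> = "1 - (xi m)\<^sup>2"
  have X: "0 < xi m" "xi m < 1" using x by (auto simp: xi_def)
  have X2: "0 < (xi m)\<^sup>2" "(xi m)\<^sup>2 < 1" using X by (auto simp: abs_square_less_1)
  define a where "a = (\<lambda>p k. orbit n x g (real k) p)"
  define G where "G = (\<lambda>k. complex_of_real (xi m ^ k))"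
  have G: "G \<in> ell2" "ell2_normsq G = 1 / ?\<omega>"
  proof -
    have "(\<lambda>k. (cmod (G k))\<^sup>2) = (\<lambda>k. ((xi m)\<^sup>2) ^ k)"
      unfolding G_def norm_of_real power2_abs by (simp only: power_mult[symmetric] mult.commute)
    then show "G \<in> ell2" "ell2_normsq G = 1 / ?\<omega>"
      using geometric_sum[OF X2] by (auto simp: ell2_def ell2_normsq_def sums_iff)
  qed
  have a: "a p \<in> ell2" "ell2_normsq (a p) \<le> B" for p
  proof -
    have "(\<lambda>k. (cmod (ell2_inner (unit p) (orbit n x g (real k))))\<^sup>2) = (\<lambda>k. (cmod (a p k))\<^sup>2)"
      by (simp add: unit(3) a_def)
    then show "a p \<in> ell2" "ell2_normsq (a p) \<le> B"
      using frame_summable[OF unit(1), of p] frame_upper[OF unit(1), of p] unfolding unit(2)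
      by (simp_all add: ell2_def ell2_normsq_def)
  qed
  define S where "S = (\<lambda>p. ell2_inner (a p) G)"
  have S_bound: "?\<omega> * cmod (S p) \<le> sqrt B * sqrt ?\<omega>" for p
  proof -
    have "(cmod (S p))\<^sup>2 \<le> ell2_normsq (a p) * ell2_normsq G" unfolding S_def by (rule ell2_Cauchy_Schwarz[OF a(1) G(1)])
    also have "\<dots> \<le> B * (1 / ?\<omega>)" unfolding G(2) using a X2 by (intro mult_right_mono) auto
    finally have "cmod (S p) \<le> sqrt (B / ?\<omega>)" by (simp add: real_le_rsqrt)
    then have "?\<omega> * cmod (S p) \<le> ?\<omega> * sqrt (B / ?\<omega>)" using X2 by (intro mult_left_mono) auto
    also have "\<dots> = sqrt B * (?\<omega> / sqrt ?\<omega>)" by (simp add: real_sqrt_divide)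
    also have "?\<omega> / sqrt ?\<omega> = sqrt ?\<omega>" using X2 by (intro real_div_sqrt) simp
    finally show ?thesis .
  qed
  \<comment> \<open>\<open>e\<close> switches the subdiagonal term off at the start of a block\<close>
  define e where "e = (if 0 < block_offset n m then (1::complex) else 0)"
  have e: "cmod e \<le> 1" by (simp add: e_def)
  have S_sums: "(\<lambda>k. a p k * G k) sums S p" for p
    using summable_sums[OF ell2_inner_summable[OF a(1) G(1)]]
    by (simp add: S_def ell2_inner_def G_def)
  have shifted: "(\<lambda>k. a m (Suc k) * G (Suc k)) sums (S m - a m 0 * G 0)"
    using S_sums[of m] sums_Suc_iff[of "\<lambda>k. a m k * G k"] by simp
  have step: "a m (Suc k) * G (Suc k) = of_real ((xi m)\<^sup>2) * (a m k * G k) + e * of_real (?\<omega> * xi m) * (a (m - 1) k * G k)" for k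
  proof -
    have Suc: "real (Suc k) = real k + 1" by simp
    have os: "a m (Suc k) = of_real (xi m) * a m k + e * of_real ?\<omega> * a (m - 1) k"
      unfolding a_def e_def xi_def Suc
      by (subst orbit_step[where n = n and x = x, OF n_pos x(1)]) simp
    show ?thesis unfolding os by (simp add: G_def power2_eq_square algebra_simps)
  qed
  have "(\<lambda>k. of_real ((xi m)\<^sup>2) * (a m k * G k) + e * of_real (?\<omega> * xi m) * (a (m - 1) k * G k)) sums
     (of_real ((xi m)\<^sup>2) * S m + e * of_real (?\<omega> * xi m) * S (m - 1))"
    by (intro sums_add sums_mult S_sums)
  from sums_unique2[OF shifted[unfolded step] this]
  have "S m - a m 0 * G 0 = of_real ((xi m)\<^sup>2) * S m + e * of_real (?\<omega> * xi m) * S (m - 1)" .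
  moreover have "a m 0 * G 0 = g m"
    using fun_cong[OF carleson_op_power_eq_orbit[where n = n and x = x and k = 0 and g = g, OF n_pos x(1)], of m]
    by (simp add: a_def G_def)
  ultimately have "g m = of_real ?\<omega> * S m - e * of_real (xi m) * (of_real ?\<omega> * S (m - 1))"
    by (simp add: algebra_simps)
  also have "cmod \<dots> \<le> ?\<omega> * cmod (S m) + cmod e * xi m * (?\<omega> * cmod (S (m - 1)))"
    using X X2 by (intro order_trans[OF norm_triangle_ineq4]) (simp add: norm_mult del: of_real_diff of_real_power)
  also have "cmod e * xi m * (?\<omega> * cmod (S (m - 1))) \<le> 1 * (?\<omega> * cmod (S (m - 1)))"
  proof (rule mult_right_mono)
    have "cmod e * xi m \<le> 1 * 1" using e X by (intro mult_mono) auto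
    then show "cmod e * xi m \<le> 1" by simp
  qed (use X2 in auto)
  finally have "cmod (g m) \<le> ?\<omega> * cmod (S m) + ?\<omega> * cmod (S (m - 1))" by simp
  then show ?thesis using S_bound[of m] S_bound[of "m - 1"] by simp
qed

text \<open>The upper frame bound is applied to a combination of the first basis vectors of the blocks, with phases
  chosen such that the frame coefficients are the positive numbers \<open>\<Sum>\<^sub>i d\<^sub>i |\<gamma>\<^sub>i| x\<^sub>i\<^sup>k\<close>. Their energy is a sum of positive
  terms, and \<open>|\<gamma>\<^sub>i|\<^sup>2 \<ge> A w\<^sub>i\<close>.\<close>
lemma block_gram_bound:
  assumes d: "\<And>i. 0 \<le> d i"
  shows "(\<Sum>i<M. \<Sum>l<M. d i * d l * (sqrt (w i) * sqrt (w l) / (1 - x i * x l))) \<le> B / A * (\<Sum>i<M. (d i)\<^sup>2)"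
proof -
  define \<gamma> where "\<gamma> = (\<lambda>i. g (block_start n i))"
  \<comment> \<open>\<open>sgn\<close> cancels the phase of the generator\<close>
  define h where "h = (\<lambda>m. if block_offset n m = 0 \<and> m < block_start n M
     then of_real (d (block_index n m)) * sgn (\<gamma> (block_index n m)) else 0)"
  have z: "\<And>m. block_start n M \<le> m \<Longrightarrow> h m = 0" by (simp add: h_def)
  have hsum: "(\<Sum>m<block_start n M. F m (h m)) = (\<Sum>i<M. F (block_start n i) (of_real (d i) * sgn (\<gamma> i)))"
    if F: "\<And>m. F m 0 = 0" for F :: "nat \<Rightarrow> complex \<Rightarrow> 'b::comm_monoid_add"
  proof -
    have "(\<Sum>m<block_start n M. F m (h m)) = (\<Sum>m<block_start n M. F m (if block_offset n m = 0
       then of_real (d (block_index n m)) * sgn (\<gamma> (block_index n m)) else 0))"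
      by (intro sum.cong) (auto simp: h_def)
    also have "\<dots> = (\<Sum>i<M. \<Sum>j<n i. if j = 0 then F (block_start n i) (of_real (d i) * sgn (\<gamma> i)) else 0)"
      unfolding sum_blocks by (intro sum.cong refl) (auto simp: block_offset_eq block_index_eq block_start_pos F)
    also have "\<dots> = (\<Sum>i<M. F (block_start n i) (of_real (d i) * sgn (\<gamma> i)))"
      by (intro sum.cong refl) (use n_pos in simp)
    finally show ?thesis .
  qed
  have \<gamma>0: "\<gamma> i \<noteq> 0" for i
  proof -
    have "0 < A * w i" using A_pos w by simp
    then show ?thesis using block_start_lower[of i] by (auto simp: \<gamma>_def)
  qed
  have h_ell2: "h \<in> ell2" by (rule ell2_finite_support(1)[OF z])
  have "ell2_normsq h = (\<Sum>m<block_start n M. (cmod (h m))\<^sup>2)" by (rule ell2_finite_support(2)[OF z])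
  also have "\<dots> = (\<Sum>i<M. (cmod (of_real (d i) * sgn (\<gamma> i)))\<^sup>2)"
    by (rule hsum) simp
  also have "\<dots> = (\<Sum>i<M. (d i)\<^sup>2)" using \<gamma>0 d by (simp add: norm_mult norm_sgn)
  finally have norm: "ell2_normsq h = (\<Sum>i<M. (d i)\<^sup>2)" .
  have inner: "ell2_inner h (orbit n x g (real k)) = of_real (\<Sum>i<M. d i * cmod (\<gamma> i) * x i ^ k)" for k
  proof -
    have "ell2_inner h (orbit n x g (real k)) = (\<Sum>m<block_start n M. h m * cnj (orbit n x g (real k) m))"
      by (rule ell2_finite_support(3)[OF z])
    also have "\<dots> = (\<Sum>i<M. of_real (d i) * sgn (\<gamma> i) * cnj (orbit n x g (real k) (block_start n i)))"
      by (rule hsum) simp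
    also have "\<dots> = (\<Sum>i<M. of_real (d i * cmod (\<gamma> i) * x i ^ k))"
    proof (intro sum.cong refl)
      fix i
      have "sgn (\<gamma> i) * cnj (\<gamma> i) = of_real (cmod (\<gamma> i))"
        using \<gamma>0[of i] by (simp add: sgn_div_norm scaleR_conv_of_real complex_norm_square[symmetric] mult.assoc power2_eq_square)
      moreover have "of_real (d i) * sgn (\<gamma> i) * cnj (orbit n x g (real k) (block_start n i)) =
          of_real (d i * x i ^ k) * (sgn (\<gamma> i) * cnj (\<gamma> i))"
        unfolding orbit_block_start using x(1)[of i] by (simp add: powr_realpow \<gamma>_def)
      ultimately show "of_real (d i) * sgn (\<gamma> i) * cnj (orbit n x g (real k) (block_start n i)) = of_real (d i * cmod (\<gamma> i) * x i ^ k)"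
        by (simp add: mult_ac)
    qed
    finally show ?thesis by simp
  qed
  have xx: "0 < x i * x l" "x i * x l < 1" for i l
    using x mult_strict_mono'[of "x i" 1 "x l" 1] by (auto simp: less_imp_le)
  have "(\<lambda>k. \<Sum>i<M. \<Sum>l<M. d i * cmod (\<gamma> i) * (d l * cmod (\<gamma> l)) * (x i * x l) ^ k) sums
     (\<Sum>i<M. \<Sum>l<M. d i * cmod (\<gamma> i) * (d l * cmod (\<gamma> l)) * (1 / (1 - x i * x l)))"
    by (intro sums_sum sums_mult geometric_sum xx)
  moreover have "(\<Sum>i<M. \<Sum>l<M. d i * cmod (\<gamma> i) * (d l * cmod (\<gamma> l)) * (x i * x l) ^ k) =
      (cmod (ell2_inner h (orbit n x g (real k))))\<^sup>2" for k
    unfolding inner norm_of_real power2_abs unfolding power2_eq_square sum_product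
    by (intro sum.cong refl) (simp add: power_mult_distrib)
  ultimately have "(\<Sum>i<M. \<Sum>l<M. d i * cmod (\<gamma> i) * (d l * cmod (\<gamma> l)) * (1 / (1 - x i * x l))) \<le> B * (\<Sum>i<M. (d i)\<^sup>2)"
    using frame_upper[OF h_ell2] by (simp add: norm sums_iff)
  moreover have "A * (\<Sum>i<M. \<Sum>l<M. d i * d l * (sqrt (w i) * sqrt (w l) / (1 - x i * x l))) \<le>
      (\<Sum>i<M. \<Sum>l<M. d i * cmod (\<gamma> i) * (d l * cmod (\<gamma> l)) * (1 / (1 - x i * x l)))"
    unfolding sum_distrib_left[of A]
  proof (intro sum_mono)
    fix i l
    have le: "sqrt A * sqrt (w i) \<le> cmod (\<gamma> i)" for i
    proof -
      have "sqrt (A * w i) \<le> sqrt ((cmod (\<gamma> i))\<^sup>2)" using block_start_lower[of i] unfolding \<gamma>_def by (rule real_sqrt_le_mono)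
      then show ?thesis by (simp add: real_sqrt_mult)
    qed
    have "(sqrt A * sqrt (w i)) * (sqrt A * sqrt (w l)) \<le> cmod (\<gamma> i) * cmod (\<gamma> l)"
      using A_pos w(1)[of l] by (intro mult_mono le) auto
    moreover have "(sqrt A * sqrt (w i)) * (sqrt A * sqrt (w l)) = A * (sqrt (w i) * sqrt (w l))"
    proof -
      have "(sqrt A * sqrt (w i)) * (sqrt A * sqrt (w l)) = (sqrt A * sqrt A) * (sqrt (w i) * sqrt (w l))" by (simp only: mult_ac)
      then show ?thesis using A_pos by simp
    qed
    ultimately have "(d i * d l) * (A * (sqrt (w i) * sqrt (w l))) / (1 - x i * x l) \<le> (d i * d l) * (cmod (\<gamma> i) * cmod (\<gamma> l)) / (1 - x i * x l)"
      using d xx[of i l] by (intro divide_right_mono mult_left_mono) auto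
    then show "A * (d i * d l * (sqrt (w i) * sqrt (w l) / (1 - x i * x l))) \<le> d i * cmod (\<gamma> i) * (d l * cmod (\<gamma> l)) * (1 / (1 - x i * x l))"
      by (simp add: mult_ac)
  qed
  ultimately show ?thesis using A_pos by (simp add: field_simps)
qed

text \<open>Passing from blocks to coordinates costs the factor \<open>N\<close>, by the Cauchy-Schwarz inequality in each block.\<close>
lemma flat_gram_bound:
  assumes d: "\<And>m. 0 \<le> d m"
  shows "(\<Sum>m<M. \<Sum>l<M. d m * d l * (sqrt (1 - (xi m)\<^sup>2) * sqrt (1 - (xi l)\<^sup>2) / (1 - xi m * xi l)))
    \<le> (real N * (B / A)) * (\<Sum>m<M. (d m)\<^sup>2)"
proof -
  define K where "K = (\<lambda>i l. sqrt (w i) * sqrt (w l) / (1 - x i * x l))"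
  \<comment> \<open>extension by zero up to the end of a block, as \<open>M\<close> may lie inside one\<close>
  define d' where "d' = (\<lambda>m. if m < M then d m else 0)"
  define D where "D = (\<lambda>i. \<Sum>j<n i. d' (block_start n i + j))"
  have M_le: "M \<le> block_start n M"
  proof -
    have "(\<Sum>i<M. 1) \<le> (\<Sum>i<M. n i)" using n_pos by (intro sum_mono) (simp add: Suc_le_eq)
    then show ?thesis by (simp add: block_start_def)
  qed
  have ext: "(\<Sum>m<block_start n M. if m < M then f m else 0) = (\<Sum>m<M. f m)" for f :: "nat \<Rightarrow> real"
    using M_le by (intro sum.mono_neutral_cong_right) auto
  have "(\<Sum>m<M. \<Sum>l<M. d m * d l * (sqrt (1 - (xi m)\<^sup>2) * sqrt (1 - (xi l)\<^sup>2) / (1 - xi m * xi l)))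
     = (\<Sum>m<block_start n M. \<Sum>l<block_start n M. d' m * d' l * K (block_index n m) (block_index n l))"
    unfolding ext[symmetric]
    by (intro sum.cong refl) (auto simp: d'_def K_def w_def xi_def intro!: sum.cong)
  also have "\<dots> = (\<Sum>i<M. \<Sum>l<M. D i * D l * K i l)"
  proof -
    have "(\<Sum>l<block_start n M. d' m * d' l * K (block_index n m) (block_index n l)) =
       d' m * (\<Sum>l<M. D l * K (block_index n m) l)" for m
      unfolding sum_blocks D_def sum_distrib_left sum_distrib_right
      by (intro sum.cong refl) (simp add: block_index_eq mult_ac)
    then have "(\<Sum>m<block_start n M. \<Sum>l<block_start n M. d' m * d' l * K (block_index n m) (block_index n l)) =
      (\<Sum>m<block_start n M. d' m * (\<Sum>l<M. D l * K (block_index n m) l))" by simp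
    also have "\<dots> = (\<Sum>i<M. D i * (\<Sum>l<M. D l * K i l))"
      unfolding sum_blocks D_def sum_distrib_right
      by (intro sum.cong refl) (simp add: block_index_eq)
    finally show ?thesis by (simp add: sum_distrib_left mult.assoc)
  qed
  also have "\<dots> \<le> B / A * (\<Sum>i<M. (D i)\<^sup>2)"
    unfolding K_def by (rule block_gram_bound) (auto simp: D_def d'_def d intro: sum_nonneg)
  also have "\<dots> \<le> B / A * (\<Sum>i<M. real N * (\<Sum>j<n i. (d' (block_start n i + j))\<^sup>2))"
  proof (intro mult_left_mono sum_mono)
    fix i
    have "(D i)\<^sup>2 \<le> (\<Sum>j<n i. 1\<^sup>2) * (\<Sum>j<n i. (d' (block_start n i + j))\<^sup>2)"
      using Cauchy_Schwarz_ineq_sum[of "\<lambda>j. 1" "\<lambda>j. d' (block_start n i + j)" "{..<n i}"] by (simp add: D_def)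
    also have "\<dots> \<le> real N * (\<Sum>j<n i. (d' (block_start n i + j))\<^sup>2)"
      using n_le[of i] by (intro mult_right_mono sum_nonneg) auto
    finally show "(D i)\<^sup>2 \<le> real N * (\<Sum>j<n i. (d' (block_start n i + j))\<^sup>2)" .
  qed (use A_pos B_pos in auto)
  also have "\<dots> = (real N * (B / A)) * (\<Sum>m<block_start n M. (d' m)\<^sup>2)"
    unfolding sum_blocks by (simp add: sum_distrib_left mult_ac)
  also have "(\<Sum>m<block_start n M. (d' m)\<^sup>2) = (\<Sum>m<M. (d m)\<^sup>2)"
    unfolding ext[symmetric] by (intro sum.cong) (auto simp: d'_def)
  finally show ?thesis .
qed

definition coeff :: "nat \<Rightarrow> nat \<Rightarrow> complex" where
  "coeff m j = (if j \<le> block_offset n m then g (m - j) else 0)"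

lemma coeff_bound: "cmod (coeff m j) \<le> 2 * sqrt B * sqrt (1 - (xi m)\<^sup>2)"
proof (cases "j \<le> block_offset n m")
  case True
  note pos = block_position[where n = n and m = m, OF n_pos]
  have "m - j = block_start n (block_index n m) + (block_offset n m - j)" using pos(2) True by linarith
  then have "block_index n (m - j) = block_index n m"
    using block_index_eq[of "block_offset n m - j" n "block_index n m"] pos(1) by simp
  then have "xi (m - j) = xi m" by (simp add: xi_def)
  then show ?thesis using True generator_upper[of "m - j"] by (simp add: coeff_def)
next
  case False
  have "(xi m)\<^sup>2 \<le> 1" using x[of "block_index n m"] by (simp add: xi_def abs_square_le_1)
  then show ?thesis using False B_pos by (simp add: coeff_def)
qed

sublocale sys: carleson_system xi coeff N "2 * sqrt B" "real N * (B / A)"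
proof
  show "0 < xi m" "xi m < 1" for m using x by (auto simp: xi_def)
  show "cmod (coeff m j) \<le> 2 * sqrt B * sqrt (1 - (xi m)\<^sup>2)" for m j by (rule coeff_bound)
  have "0 < N" using n_pos[of 0] n_le[of 0] by simp
  then show "0 < real N * (B / A)" using A_pos B_pos by simp
qed (rule flat_gram_bound)

lemma psi_eq_orbit: "sys.\<psi> t = orbit n x g t"
proof
  fix m
  have "block_offset n m < N" using block_position(1)[where n = n and m = m, OF n_pos] n_le[of "block_index n m"] by simp
  then show "sys.\<psi> t m = orbit n x g t m"
    unfolding sys.\<psi>_def orbit_def coeff_def
    by (intro sum.mono_neutral_cong_right) (auto simp: xi_def)
qed

end

section \<open>Density and the frame property\<close>

text \<open>Otherwise the counting function is eventually infinite, and so is the density.\<close>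
lemma density_finite_imp_unbounded:
  assumes "has_natural_density lam L" "L < \<infinity>"
  shows "finite {k. lam k \<le> b}"
proof (rule ccontr)
  assume inf: "infinite {k. lam k \<le> b}"
  have "eventually (\<lambda>x. counting_fun lam x / ennreal x = \<infinity>) at_top"
    using eventually_ge_at_top[of "max b 1"]
  proof eventually_elim
    case (elim x)
    have "infinite {k. lam k \<le> x}"
      using inf elim by (elim contrapos_nn finite_subset[rotated]) auto
    then show ?case using elim by (simp add: counting_fun_def ennreal_top_divide)
  qed
  then have "((\<lambda>x. counting_fun lam x / ennreal x) \<longlongrightarrow> \<infinity>) at_top"
    by (rule tendsto_eventually)
  then have "L = \<infinity>"
    using assms(1) tendsto_unique[OF trivial_limit_at_top_linorder] unfolding has_natural_density_def by blast
  then show False using assms(2) by simp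
qed

lemma unbounded_at_top:
  fixes lam :: "nat \<Rightarrow> real"
  assumes "\<And>b. finite {k. lam k \<le> b}"
  shows "filterlim lam at_top sequentially"
  unfolding filterlim_at_top_dense
proof
  fix b
  have "finite {k. \<not> b < lam k}" using assms[of b] by (simp add: not_less)
  then show "eventually (\<lambda>k. b < lam k) sequentially"
    unfolding cofinite_eq_sequentially[symmetric] eventually_cofinite .
qed

text \<open>At \<open>x = lam k\<close> the counting function of a strictly increasing sequence equals \<open>Suc k\<close>.\<close>
lemma density_ratio:
  fixes lam :: "nat \<Rightarrow> real"
  assumes dens: "has_natural_density lam (ennreal l)" and l: "0 \<le> l" and mono: "strict_mono lam"
  shows "filterlim lam at_top sequentially" "(\<lambda>k. real (Suc k) / lam k) \<longlonglongrightarrow> l"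
proof -
  show top: "filterlim lam at_top sequentially"
    by (rule unbounded_at_top[OF density_finite_imp_unbounded[OF dens]]) simp
  have "((\<lambda>k. counting_fun lam (lam k) / ennreal (lam k)) \<longlongrightarrow> ennreal l) sequentially"
    using dens unfolding has_natural_density_def by (rule filterlim_compose[OF _ top])
  moreover have pos: "eventually (\<lambda>k. 0 < lam k) sequentially"
    using top by (simp add: filterlim_at_top_dense)
  then have "eventually (\<lambda>k. counting_fun lam (lam k) / ennreal (lam k) = ennreal (real (Suc k) / lam k)) sequentially"
  proof eventually_elim
    case (elim k)
    have "{j. lam j \<le> lam k} = {..k}" using mono by (auto simp: strict_mono_less_eq)
    then have "counting_fun lam (lam k) = ennreal (real (Suc k))"
      by (simp add: counting_fun_def ennreal_of_nat_eq_real_of_nat del: of_nat_Suc)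
    then show ?case using elim by (simp add: divide_ennreal del: of_nat_Suc)
  qed
  ultimately have lim: "(\<lambda>k. ennreal (real (Suc k) / lam k)) \<longlonglongrightarrow> ennreal l"
    by (rule Lim_transform_eventually)
  have "eventually (\<lambda>k. 0 \<le> real (Suc k) / lam k) sequentially"
    using pos by eventually_elim simp
  then show "(\<lambda>k. real (Suc k) / lam k) \<longlonglongrightarrow> l"
    using lim l by (simp only: tendsto_ennreal_iff)
qed

lemma positive_density_regular_growth:
  fixes lam :: "nat \<Rightarrow> real"
  assumes dens: "has_natural_density lam (ennreal l)" and l: "0 < l" and mono: "strict_mono lam"
    and nonneg: "\<And>k. 0 \<le> lam k"
  shows "regular_growth lam (1 / l)"
proof
  have "(\<lambda>k. inverse (real (Suc k) / lam k)) \<longlonglongrightarrow> inverse l"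
    by (intro tendsto_inverse density_ratio[OF dens _ mono]) (use l in auto)
  then show "(\<lambda>k. lam k / real (Suc k)) \<longlonglongrightarrow> 1 / l" by (simp add: inverse_eq_divide del: of_nat_Suc)
qed (use l nonneg in auto)

lemma zero_density_superlinear:
  fixes lam :: "nat \<Rightarrow> real"
  assumes dens: "has_natural_density lam 0" and mono: "strict_mono lam"
    and nonneg: "\<And>k. 0 \<le> lam k" and M: "0 < M"
  obtains D where "0 \<le> D" "\<And>k. M * real k - D \<le> lam k"
proof -
  have "has_natural_density lam (ennreal 0)" using dens by simp
  note r = density_ratio[OF this order_refl mono]
  have "eventually (\<lambda>k. real (Suc k) / lam k < 1 / M) sequentially"
    by (rule order_tendstoD(2)[OF r(2)]) (use M in simp)
  moreover have "eventually (\<lambda>k. 0 < lam k) sequentially" using r(1) by (simp add: filterlim_at_top_dense)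
  ultimately have "eventually (\<lambda>k. M * real k \<le> lam k) sequentially"
  proof eventually_elim
    case (elim k)
    then have "M * real (Suc k) < lam k" using M by (simp add: field_simps)
    moreover have "M * real k \<le> M * real (Suc k)" using M by simp
    ultimately show ?case by linarith
  qed
  then obtain K where K: "\<And>k. k \<ge> K \<Longrightarrow> M * real k \<le> lam k" by (auto simp: eventually_sequentially)
  show ?thesis
  proof (rule that[of "M * real K"])
    show "0 \<le> M * real K" using M by simp
    show "M * real k - M * real K \<le> lam k" for k
    proof (cases "k \<ge> K")
      case True
      then show ?thesis using K[of k] M mult_nonneg_nonneg[of M "real K"] by linarith
    next
      case False
      then have "M * real k \<le> M * real K" using M by simp
      then show ?thesis using nonneg[of k] by linarith
    qed
  qed
qed

context orbit_frame begin

lemma w_tendsto: "w \<longlonglongrightarrow> 0"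
proof -
  have "strict_mono (block_start n)"
    unfolding strict_mono_Suc_iff using n_pos by (simp add: block_start_Suc)
  from LIMSEQ_subseq_LIMSEQ[OF summable_LIMSEQ_zero[OF sys.omega_summable] this]
  show ?thesis by (simp add: o_def xi_def block_start_pos w_def[abs_def])
qed

lemma start_energy: "(cmod (ell2_inner (unit (block_start n i)) (orbit n x g t)))\<^sup>2 =
    x i powr (2 * t) * (cmod (g (block_start n i)))\<^sup>2"
proof -
  have "(x i powr t)\<^sup>2 = x i powr (2 * t)" using x(1)[of i] by (simp add: powr_power)
  then show ?thesis
    unfolding unit(3) orbit_block_start complex_mod_cnj norm_mult power_mult_distrib norm_of_real power2_abs by simp
qed

text \<open>The energy of the first basis vector of block \<open>i\<close> is at least \<open>A w\<^sub>i \<Sum>\<^sub>k x\<^sub>i\<^bsup>2 lam k\<^esup>\<close>, and each \<open>lam k \<le> 1 / w\<^sub>i\<close>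
  contributes at least \<open>exp (- 2)\<close> to the sum. So the counting function at \<open>1 / w\<^sub>i\<close> is at most a multiple of \<open>1 / w\<^sub>i\<close>.
  As the density exists, it can be computed along \<open>1 / w\<^sub>i \<rightarrow> \<infinity>\<close>.\<close>
lemma density_finite_of_bessel:
  assumes sm: "\<And>h. h \<in> ell2 \<Longrightarrow> summable (\<lambda>k. (cmod (ell2_inner h (orbit n x g (lam k))))\<^sup>2)"
    and up: "\<And>h. h \<in> ell2 \<Longrightarrow> (\<Sum>k. (cmod (ell2_inner h (orbit n x g (lam k))))\<^sup>2) \<le> B1 * ell2_normsq h"
    and dens: "has_natural_density lam L"
  shows "L < \<infinity>"
proof -
  define D where "D = exp 2 * B1 / A"
  have card_le: "real (card F) \<le> D * (1 / w i)" if i: "w i \<le> 1 / 2" and F: "finite F" "F \<subseteq> {k. lam k \<le> 1 / w i}" for i F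
  proof -
    let ?G = "(cmod (g (block_start n i)))\<^sup>2"
    \<comment> \<open>so that \<open>x i powr (2 / w i) \<ge> exp (- 2)\<close>\<close>
    have lnx: "- w i \<le> ln (x i)"
    proof -
      have "- w i - 2 * (w i)\<^sup>2 \<le> ln (1 - w i)"
        by (rule ln_one_minus_pos_lower_bound) (use w[of i] i in auto)
      moreover have "2 * (w i)\<^sup>2 \<le> w i" using w(1)[of i] i by (simp add: power2_eq_square mult_left_le)
      moreover have "ln (1 - w i) = 2 * ln (x i)" using x(1)[of i] by (simp add: w_def ln_realpow)
      ultimately show ?thesis by linarith
    qed
    have energy_ge: "exp (- 2) * (A * w i) \<le> (cmod (ell2_inner (unit (block_start n i)) (orbit n x g (lam k))))\<^sup>2"
      if k: "lam k \<le> 1 / w i" for k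
    proof -
      have "exp (- 2) \<le> x i powr (2 * (1 / w i))"
      proof -
        have "- 2 \<le> 2 * (1 / w i) * ln (x i)" using lnx w(1)[of i] by (simp add: field_simps)
        then show ?thesis using x(1)[of i] by (simp add: powr_def)
      qed
      also have "\<dots> \<le> x i powr (2 * lam k)" by (rule powr_mono') (use k x[of i] in auto)
      finally show ?thesis unfolding start_energy using A_pos w(1)[of i] block_start_lower[of i] by (intro mult_mono) auto
    qed
    have "real (card F) * (exp (- 2) * (A * w i)) = (\<Sum>k\<in>F. exp (- 2) * (A * w i))" by simp
    also have "\<dots> \<le> (\<Sum>k\<in>F. (cmod (ell2_inner (unit (block_start n i)) (orbit n x g (lam k))))\<^sup>2)"
      by (intro sum_mono energy_ge) (use F in auto)
    also have "\<dots> \<le> (\<Sum>k. (cmod (ell2_inner (unit (block_start n i)) (orbit n x g (lam k))))\<^sup>2)"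
      by (intro sum_le_suminf sm unit F) auto
    also have "\<dots> \<le> B1 * 1" using up[OF unit(1), of "block_start n i"] by (simp only: unit(2))
    finally have le: "real (card F) * (exp (- 2) * (A * w i)) \<le> B1" by simp
    have "real (card F) = real (card F) * (exp (- 2) * (A * w i)) * (exp 2 / (A * w i))"
      using A_pos w(1)[of i] by (simp add: exp_minus)
    also have "\<dots> \<le> B1 * (exp 2 / (A * w i))" using A_pos w(1)[of i] by (intro mult_right_mono le) auto
    finally show ?thesis by (simp add: D_def mult_ac)
  qed
  have top: "filterlim (\<lambda>i. 1 / w i) at_top sequentially"
  proof -
    have "filterlim (\<lambda>i. inverse (w i)) at_top sequentially"
      by (rule filterlim_inverse_at_top[OF w_tendsto]) (use w in auto)
    then show ?thesis by (simp add: inverse_eq_divide)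
  qed
  have lim: "(\<lambda>i. counting_fun lam (1 / w i) / ennreal (1 / w i)) \<longlonglongrightarrow> L"
    using dens unfolding has_natural_density_def by (rule filterlim_compose[OF _ top])
  have "eventually (\<lambda>i. w i < 1 / 2) sequentially" by (rule order_tendstoD[OF w_tendsto]) simp
  then have "eventually (\<lambda>i. counting_fun lam (1 / w i) / ennreal (1 / w i) \<le> ennreal D) sequentially"
  proof eventually_elim
    case (elim i)
    let ?X = "{k. lam k \<le> 1 / w i}"
    have i: "w i \<le> 1 / 2" using elim by simp
    have fin: "finite ?X"
    proof (rule ccontr)
      assume "infinite ?X"
      then have "\<exists>F. finite F \<and> card F = nat \<lceil>D * (1 / w i)\<rceil> + 1 \<and> F \<subseteq> ?X"
        by (rule infinite_arbitrarily_large)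
      then obtain F where F: "F \<subseteq> ?X" "finite F" "card F = nat \<lceil>D * (1 / w i)\<rceil> + 1" by (elim exE conjE)
      have "real (card F) \<le> D * (1 / w i)" by (rule card_le[OF i F(2,1)])
      then show False using F(3) by linarith
    qed
    have "real (card ?X) \<le> D * (1 / w i)" by (rule card_le[OF i fin]) simp
    then have "real (card ?X) / (1 / w i) \<le> D" using w(1)[of i] by (simp add: field_simps)
    moreover have "counting_fun lam (1 / w i) / ennreal (1 / w i) = ennreal (real (card ?X) / (1 / w i))"
      using fin w(1)[of i] by (simp add: counting_fun_def ennreal_of_nat_eq_real_of_nat divide_ennreal del: divide_divide_eq_right)
    ultimately show ?case by (simp only: ennreal_leI)
  qed
  then have "L \<le> ennreal D" by (rule tendsto_upperbound[OF lim _ sequentially_bot])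
  then show ?thesis by (rule le_less_trans) simp
qed

text \<open>The energy of the first basis vector of block \<open>i\<close> is at most \<open>4 B w\<^sub>i \<Sum>\<^sub>k x\<^sub>i\<^bsup>2 lam k\<^esup>\<close>. If the density is 0, then
  \<open>lam k \<ge> M k - D\<close> for every \<open>M\<close>, and the limit superior of these energies is at most \<open>4 B / M\<close>.\<close>
lemma density_positive_of_lower_bound:
  assumes A1: "0 < A1" and lower: "\<And>h. h \<in> ell2 \<Longrightarrow> A1 * ell2_normsq h \<le> (\<Sum>k. (cmod (ell2_inner h (orbit n x g (lam k))))\<^sup>2)"
    and dens: "has_natural_density lam L" and mono: "strict_mono lam" and nonneg: "\<And>k. 0 \<le> lam k"
  shows "0 < L"
proof (rule ccontr)
  assume "\<not> 0 < L"
  then have L0: "has_natural_density lam 0" using dens by (simp add: zero_less_iff_neq_zero)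
  \<comment> \<open>chosen such that the limit of the upper bounds is \<open>A1 / 2\<close>\<close>
  define M where "M = 8 * B / A1"
  have M: "0 < M" using A1 B_pos by (simp add: M_def)
  obtain D where D: "0 \<le> D" "\<And>k. M * real k - D \<le> lam k"
    using zero_density_superlinear[OF L0 mono nonneg M] by metis
  \<comment> \<open>\<open>x i powr (2 * t) = exp (- s i * t)\<close>, and \<open>s i\<close> is of the order of \<open>w i\<close>\<close>
  define s where "s = (\<lambda>i. - 2 * ln (x i))"
  have s: "0 < s i" "w i \<le> s i" for i
  proof -
    show "0 < s i" using x[of i] by (simp add: s_def)
    have "ln ((x i)\<^sup>2) \<le> (x i)\<^sup>2 - 1" using x(1)[of i] by (intro ln_le_minus_one) auto
    then show "w i \<le> s i" using x(1)[of i] by (simp add: s_def w_def ln_realpow)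
  qed
  have le: "A1 \<le> 4 * B * (s i * exp (s i * D) / (1 - exp (- (s i * M))))" for i
  proof -
    define y where "y = exp (- (s i * M))"
    have y: "0 < y" "y < 1" using s(1)[of i] M by (auto simp: y_def)
    have t: "(cmod (ell2_inner (unit (block_start n i)) (orbit n x g (lam k))))\<^sup>2 \<le> 4 * B * w i * exp (s i * D) * y ^ k" for k
    proof -
      have "x i powr (2 * lam k) = exp (- (s i * lam k))" using x(1)[of i] by (simp add: powr_def s_def)
      also have "\<dots> \<le> exp (s i * D + real k * (- (s i * M)))"
      proof -
        have "s i * (M * real k - D) \<le> s i * lam k" using D(2)[of k] s(1)[of i] by simp
        then show ?thesis by (simp add: algebra_simps)
      qed
      also have "\<dots> = exp (s i * D) * y ^ k" unfolding exp_add y_def by (simp only: exp_of_nat_mult)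
      finally have "x i powr (2 * lam k) \<le> exp (s i * D) * y ^ k" .
      moreover have "(cmod (g (block_start n i)))\<^sup>2 \<le> 4 * B * w i"
      proof -
        have "(cmod (g (block_start n i)))\<^sup>2 \<le> (2 * sqrt B * sqrt (w i))\<^sup>2"
          using generator_upper[of "block_start n i"] by (intro power_mono) (auto simp: xi_def block_start_pos w_def)
        then show ?thesis using B_pos w(1)[of i] by (simp add: power_mult_distrib)
      qed
      ultimately have "x i powr (2 * lam k) * (cmod (g (block_start n i)))\<^sup>2 \<le> (exp (s i * D) * y ^ k) * (4 * B * w i)"
        using y by (intro mult_mono) auto
      then show ?thesis unfolding start_energy by (simp only: mult_ac)
    qed
    have gs: "(\<lambda>k. 4 * B * w i * exp (s i * D) * y ^ k) sums (4 * B * w i * exp (s i * D) * (1 / (1 - y)))"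
      by (intro sums_mult geometric_sum y)
    have sm: "summable (\<lambda>k. (cmod (ell2_inner (unit (block_start n i)) (orbit n x g (lam k))))\<^sup>2)"
      by (rule summable_comparison_test'[OF sums_summable[OF gs]]) (use t in auto)
    have "A1 * 1 \<le> (\<Sum>k. (cmod (ell2_inner (unit (block_start n i)) (orbit n x g (lam k))))\<^sup>2)"
      using lower[OF unit(1)] by (simp only: unit(2))
    also have "\<dots> \<le> (\<Sum>k. 4 * B * w i * exp (s i * D) * y ^ k)"
      by (rule suminf_le[OF t sm sums_summable[OF gs]])
    also have "\<dots> = 4 * B * w i * exp (s i * D) * (1 / (1 - y))" using sums_unique[OF gs] by simp
    also have "\<dots> \<le> 4 * B * s i * exp (s i * D) * (1 / (1 - y))"
      using B_pos s(2)[of i] y by (intro mult_right_mono mult_left_mono) auto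
    finally show ?thesis by (simp add: y_def mult_ac)
  qed
  have x_lim: "x \<longlonglongrightarrow> 1"
  proof -
    have "(\<lambda>i. sqrt (1 - w i)) \<longlonglongrightarrow> sqrt (1 - 0)" by (intro tendsto_intros w_tendsto)
    then show ?thesis using x(1) by (simp add: w_def less_imp_le)
  qed
  have "s \<longlonglongrightarrow> - 2 * ln 1" unfolding s_def by (intro tendsto_intros x_lim) simp
  then have s_lim: "filterlim s (at_right 0) sequentially"
    using s(1) by (intro tendsto_imp_filterlim_at_right) auto
  have "((\<lambda>r. r * exp (r * D) / (1 - exp (- (r * M)))) \<longlongrightarrow> 1 / M) (at_right 0)"
    using M by (real_asymp simp: field_simps)
  from filterlim_compose[OF this s_lim]
  have "(\<lambda>i. 4 * B * (s i * exp (s i * D) / (1 - exp (- (s i * M))))) \<longlonglongrightarrow> 4 * B * (1 / M)"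
    by (rule tendsto_mult[OF tendsto_const])
  then have "A1 \<le> 4 * B * (1 / M)" by (rule LIMSEQ_le_const) (use le in blast)
  also have "\<dots> = A1 / 2" using B_pos A1 by (simp add: M_def)
  finally show False using A1 by simp
qed

text \<open>Positive finite density makes \<open>lam\<close> a sequence of regular growth, and the energy bounds of the Carleson
  system apply; the converse is the test on the first basis vectors of the blocks.\<close>
theorem orbit_frame_iff:
  assumes dens: "has_natural_density lam L" and mono: "strict_mono lam" and nonneg: "\<And>k. 0 \<le> lam k"
  shows "ell2_frame (\<lambda>k. orbit n x g (lam k)) \<longleftrightarrow> 0 < L \<and> L < \<infinity>"
proof
  assume fr: "ell2_frame (\<lambda>k. orbit n x g (lam k))"
  obtain A1 B1 where AB: "0 < A1" "A1 \<le> B1" "\<And>k. orbit n x g (lam k) \<in> ell2"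
    "\<And>h. h \<in> ell2 \<Longrightarrow> summable (\<lambda>k. (cmod (ell2_inner h (orbit n x g (lam k))))\<^sup>2)"
    "\<And>h. h \<in> ell2 \<Longrightarrow> A1 * ell2_normsq h \<le> (\<Sum>k. (cmod (ell2_inner h (orbit n x g (lam k))))\<^sup>2)"
    "\<And>h. h \<in> ell2 \<Longrightarrow> (\<Sum>k. (cmod (ell2_inner h (orbit n x g (lam k))))\<^sup>2) \<le> B1 * ell2_normsq h"
    by (rule ell2_frame_bounds[OF fr]) (rule that)
  have "0 < L" by (rule density_positive_of_lower_bound[OF AB(1,5) dens mono nonneg])
  moreover have "L < \<infinity>" by (rule density_finite_of_bessel[OF AB(4,6) dens])
  ultimately show "0 < L \<and> L < \<infinity>" ..
next
  assume L: "0 < L \<and> L < \<infinity>"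
  then obtain l where l: "L = ennreal l" "0 < l" by (cases L) auto
  have reg: "regular_growth lam (1 / l)"
    by (rule positive_density_regular_growth[OF dens[unfolded l(1)] l(2) mono nonneg])
  have inj: "inj lam" using mono by (rule strict_mono_imp_inj_on)
  obtain K where K: "0 \<le> K"
    "\<And>h. h \<in> ell2 \<Longrightarrow> summable (\<lambda>k. (cmod (ell2_inner h (sys.\<psi> (lam k))))\<^sup>2)"
    "\<And>h. h \<in> ell2 \<Longrightarrow> sys.Q lam h \<le> K * ell2_normsq h"
    using sys.energy_bound[OF reg] by metis
  have "A * ell2_normsq h \<le> sys.Q real h" if "h \<in> ell2" for h
    using frame_lower[OF that] by (simp add: sys.Q_def psi_eq_orbit)
  from sys.energy_lower_bound[OF reg inj A_pos this]
  obtain A1 where A1: "0 < A1" "\<And>h. h \<in> ell2 \<Longrightarrow> A1 * ell2_normsq h \<le> sys.Q lam h" by blast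
  show "ell2_frame (\<lambda>k. orbit n x g (lam k))"
    unfolding ell2_frame_def
  proof (intro conjI allI exI ballI)
    show "orbit n x g (lam k) \<in> ell2" for k
      using sys.psi_ell2[of "lam k"] by (simp add: psi_eq_orbit)
    show "0 < A1" by fact
    show "A1 \<le> max A1 K" by simp
    fix h :: "nat \<Rightarrow> complex" assume h: "h \<in> ell2"
    show "summable (\<lambda>k. (cmod (ell2_inner h (orbit n x g (lam k))))\<^sup>2)"
      using K(2)[OF h] by (simp add: psi_eq_orbit)
    show "A1 * (ell2_norm h)\<^sup>2 \<le> (\<Sum>k. (cmod (ell2_inner h (orbit n x g (lam k))))\<^sup>2)"
      using A1(2)[OF h] by (simp add: ell2_norm_power2[OF h] sys.Q_def psi_eq_orbit)
    have "K * ell2_normsq h \<le> max A1 K * ell2_normsq h" by (intro mult_right_mono ell2_normsq_nonneg h) simp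
    then show "(\<Sum>k. (cmod (ell2_inner h (orbit n x g (lam k))))\<^sup>2) \<le> max A1 K * (ell2_norm h)\<^sup>2"
      using K(3)[OF h] by (simp add: ell2_norm_power2[OF h] sys.Q_def psi_eq_orbit)
  qed
qed

end

theorem theorem1p3:
  fixes n :: "nat \<Rightarrow> nat" and z g :: "nat \<Rightarrow> complex"
    and lam :: "nat \<Rightarrow> real" and L :: ennreal
  assumes "block_diagonal_carleson_frame n z g"
    and "point_spectrum (carleson_op n z) \<subseteq> complex_of_real ` {0<..<1}"
    and "\<forall>k. 0 \<le> lam k"
    and "strict_mono lam"
    and "has_natural_density lam L"
  shows "ell2_frame (\<lambda>k. carleson_op_powr n z (of_real (lam k)) g) \<longleftrightarrow> 0 < L \<and> L < \<infinity>"
proof -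
  have n: "0 < n i" for i using assms(1) by (simp add: block_diagonal_carleson_frame_def)
  obtain N where N: "\<And>i. n i \<le> N"
    using assms(1) unfolding block_diagonal_carleson_frame_def bdd_above_def by blast
  define x where "x = (\<lambda>i. Re (z i))"
  have zx: "z i = of_real (x i) \<and> 0 < x i \<and> x i < 1" for i
    using assms(2) block_value_in_point_spectrum[where n = n and z = z and i = i, OF n] by (auto simp: x_def)
  then have z: "z = (\<lambda>i. of_real (x i))" and x: "\<And>i. 0 < x i" "\<And>i. x i < 1" by auto
  have powers: "(carleson_op n z ^^ k) g = orbit n x g (real k)" for k
    unfolding z by (rule carleson_op_power_eq_orbit[where n = n and x = x, OF n x(1)])
  have real_powers: "carleson_op_powr n z (of_real t) g = orbit n x g t" for t
    unfolding z by (rule carleson_op_powr_eq_orbit[where n = n and x = x, OF n x(1)])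
  have fr: "ell2_frame (\<lambda>k. orbit n x g (real k))"
    using assms(1) by (simp add: block_diagonal_carleson_frame_def powers)
  obtain A B where AB: "0 < A" "A \<le> B" "\<And>k. orbit n x g (real k) \<in> ell2"
    "\<And>h. h \<in> ell2 \<Longrightarrow> summable (\<lambda>k. (cmod (ell2_inner h (orbit n x g (real k))))\<^sup>2)"
    "\<And>h. h \<in> ell2 \<Longrightarrow> A * ell2_normsq h \<le> (\<Sum>k. (cmod (ell2_inner h (orbit n x g (real k))))\<^sup>2)"
    "\<And>h. h \<in> ell2 \<Longrightarrow> (\<Sum>k. (cmod (ell2_inner h (orbit n x g (real k))))\<^sup>2) \<le> B * ell2_normsq h"
    by (rule ell2_frame_bounds[OF fr]) (rule that)
  interpret orbit_frame n x g N A B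
    by unfold_locales (fact n N x AB(1,2,4,5,6))+
  show ?thesis
    unfolding real_powers by (rule orbit_frame_iff[OF assms(5,4)]) (use assms(3) in blast)
qed

end
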